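(* Let $m\ge 2$, let $M^m$ be a connected oriented smooth manifold, let $N^{m-1}$ be a closed connected oriented smooth manifold, let $p\in M$ and $T\in\mathbb R$. Let $W:N\times[T,\infty)\to M$ be a smooth map (a front propagation) and write $W(t):N\to M$, $W(t)(n)=W(n,t)$. Assume that $W$ is generic, i.e. $p$ is a regular value of $W$ and $(W(t))^{-1}(p)$ has at most one point for each $t\in[T,\infty)$. Let $T\le t_1<t_2$ be such that $p\notin\operatorname{Im}W(t_1)$ and $p\notin \operatorname{Im}W(t_2)$. Let $\mathcal N$ be the connected component of $C^\infty(N,M)$ containing the maps $W(t)$, and assume that the indeterminacy subgroup $\mathbf A(M,\mathcal N)$ is zero, so that $\operatorname{awin}_p$ is $\mathbb Z$-valued. Let $\operatorname{pas}(t_1,t_2)$ be the number of times the front passes through $p$ between the moments $t_1$ and $t_2$, i.e. the number of $t\in(t_1,t_2)$ with $p\in\operatorname{Im}W(t)$. Then $$\operatorname{pas}(t_1,t_2)\ \ge\ \bigl|\operatorname{awin}_p(W(t_2))-\operatorname{awin}_p(W(t_1))\bigr|.$$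
   Context: Everything is $C^\infty$; $I=[0,1]$; $C^\infty(N,M)$ carries the $C^\infty$ topology. A smooth map $F:N\times I\to M$ is good (with respect to $p$) if $p\notin F(N\times\{0,1\})$ and $p$ is a regular value of $F$; it is then a good homotopy between $F|_{N\times 0}$ and $F|_{N\times 1}$. $\Delta_p(F)\in\mathbb Z$ is the sum over the finite set $F^{-1}(p)$ of signs, $+1$ where $F$ is locally orientation preserving and $-1$ otherwise, with $N\times I$ carrying the product orientation. The indeterminacy subgroup $\mathbf A(M,\mathcal N)\subset\mathbb Z$ is the subgroup of degrees of smooth maps $\mu:N\times S^1\to M$ with $\mu|_{N\times s}\in\mathcal N$ for some (equivalently all) $s\in S^1$ (the degree is $0$ by definition if $M$ is not closed). Fix $\varepsilon\in\mathcal N$ with $p\notin\operatorname{Im}\varepsilon$. For $f\in\mathcal N$ with $p\notin\operatorname{Im}f$, when $\mathbf A(M,\mathcal N)=0$, the affine winding number is $\operatorname{awin}_p(f)=\Delta_p(F)\in\mathbb Z$ for any good homotopy $F$ from $\varepsilon$ to $f$; it does not depend on $F$, and differences $\operatorname{awin}_p(f_1)-\operatorname{awin}_p(f_0)$ do not depend on $\varepsilon$. *)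

theory Defs
  imports "HOL-Analysis.Analysis"
begin

section \<open>Smooth maps between subsets of Euclidean spaces\<close>

text \<open>Iterated directional derivative; for a list of basis vectors this is a partial derivative.\<close>

primrec iter_deriv :: "'e list \<Rightarrow> ('e::euclidean_space \<Rightarrow> 'f::euclidean_space) \<Rightarrow> 'e \<Rightarrow> 'f" where
  "iter_deriv [] g = g"
| "iter_deriv (v # vs) g = (\<lambda>x. frechet_derivative (iter_deriv vs g) (at x) v)"

text \<open>
  On an open set: all iterated partial derivatives exist and are differentiable, hence continuous.
  On an arbitrary set: local extendability to a smooth map on an open set. For open subsets of a
  half space this is the usual notion of smoothness up to the boundary.
\<close>

definition smooth_on_open :: "'e::euclidean_space set \<Rightarrow> ('e \<Rightarrow> 'f::euclidean_space) \<Rightarrow> bool" where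
  "smooth_on_open U g \<longleftrightarrow> open U \<and>
     (\<forall>vs. set vs \<subseteq> Basis \<longrightarrow> (\<forall>x\<in>U. iter_deriv vs g differentiable (at x)))"

definition smooth_on :: "'e::euclidean_space set \<Rightarrow> ('e \<Rightarrow> 'f::euclidean_space) \<Rightarrow> bool" where
  "smooth_on S g \<longleftrightarrow>
     (\<forall>x\<in>S. \<exists>U h. x \<in> U \<and> smooth_on_open U h \<and> (\<forall>y\<in>U \<inter> S. h y = g y))"

text \<open>Determinant of an endomorphism of a Euclidean space, by the Leibniz formula in the
  standard basis (the library only has determinants of matrices).\<close>

definition endo_det :: "('e::euclidean_space \<Rightarrow> 'e) \<Rightarrow> real" where
  "endo_det L = (\<Sum>\<pi> | \<pi> permutes Basis. of_int (sign \<pi>) * (\<Prod>b\<in>Basis. L b \<bullet> \<pi> b))"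


section \<open>Manifolds\<close>

type_synonym ('a, 'e) chart = "'a set \<times> ('a \<Rightarrow> 'e)"
type_synonym ('a, 'e) atlas = "('a, 'e) chart set"

definition carrier_of :: "('a, 'e) atlas \<Rightarrow> 'a set" where
  "carrier_of A = (\<Union>c\<in>A. fst c)"

text \<open>A map read in charts. It is meaningful at those points of \<open>\<phi> ` U\<close> that correspond to
  points mapped by \<open>f\<close> into the domain of the second chart.\<close>

definition chart_rep ::
  "('a, 'e) chart \<Rightarrow> ('b, 'f) chart \<Rightarrow> ('a \<Rightarrow> 'b) \<Rightarrow> 'e \<Rightarrow> 'f" where
  "chart_rep c d f = snd d \<circ> f \<circ> inv_into (fst c) (snd c)"

text \<open>The differential in charts is taken within the image of the chart, so that it also makes
  sense at boundary points of the source.\<close>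

definition chart_deriv ::
  "('a, 'e::euclidean_space) chart \<Rightarrow> ('b, 'f::euclidean_space) chart \<Rightarrow> ('a \<Rightarrow> 'b) \<Rightarrow> 'a \<Rightarrow> 'e \<Rightarrow> 'f" where
  "chart_deriv c d f x =
     frechet_derivative (chart_rep c d f) (at (snd c x) within snd c ` fst c)"

text \<open>
  A manifold without boundary structure on a whole type. The Hausdorff property and second
  countability are the sort constraints, and the dimension is \<open>DIM('e)\<close>.
  An orientation is given by an atlas whose transition maps have positive Jacobian
  determinants; \<open>DIM('e) \<ge> 1\<close> always holds, so every orientation arises in this way.
\<close>

definition smooth_manifold ::
  "('a::{t2_space,second_countable_topology}, 'e::euclidean_space) atlas \<Rightarrow> bool" where
  "smooth_manifold A \<longleftrightarrow> carrier_of A = UNIV \<and>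
     (\<forall>(U, \<phi>)\<in>A. open U \<and> open (\<phi> ` U) \<and> homeomorphism U (\<phi> ` U) \<phi> (inv_into U \<phi>)) \<and>
     (\<forall>c\<in>A. \<forall>d\<in>A. smooth_on (snd c ` (fst c \<inter> fst d)) (chart_rep c d (\<lambda>x. x)))"

definition oriented_manifold ::
  "('a::{t2_space,second_countable_topology}, 'e::euclidean_space) atlas \<Rightarrow> bool" where
  "oriented_manifold A \<longleftrightarrow> smooth_manifold A \<and>
     (\<forall>c\<in>A. \<forall>d\<in>A. \<forall>x\<in>fst c \<inter> fst d. endo_det (chart_deriv c d (\<lambda>x. x) x) > 0)"

definition interval_atlas :: "real set \<Rightarrow> (real, real) atlas" where
  "interval_atlas J = {(J, \<lambda>t. t)}"

text \<open>The unit circle with the angle functions as charts (counterclockwise orientation).\<close>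

definition circle_atlas :: "(complex, real) atlas" where
  "circle_atlas =
     {(cis ` {a<..<a + 2 * pi}, inv_into {a<..<a + 2 * pi} cis) | a. True}"

definition prod_atlas ::
  "('a, 'e) atlas \<Rightarrow> ('b, 'f) atlas \<Rightarrow> ('a \<times> 'b, 'e \<times> 'f) atlas" where
  "prod_atlas A B = {(U \<times> V, map_prod \<phi> \<psi>) | U \<phi> V \<psi>. (U, \<phi>) \<in> A \<and> (V, \<psi>) \<in> B}"

definition smooth_map ::
  "('a::topological_space, 'e::euclidean_space) atlas \<Rightarrow>
   ('b::topological_space, 'f::euclidean_space) atlas \<Rightarrow> ('a \<Rightarrow> 'b) \<Rightarrow> bool" where
  "smooth_map A B f \<longleftrightarrow> f ` carrier_of A \<subseteq> carrier_of B \<and> continuous_on (carrier_of A) f \<and>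
     (\<forall>c\<in>A. \<forall>d\<in>B. smooth_on (snd c ` (fst c \<inter> f -` fst d)) (chart_rep c d f))"

definition regular_value ::
  "('a, 'e::euclidean_space) atlas \<Rightarrow> ('b, 'f::euclidean_space) atlas \<Rightarrow> ('a \<Rightarrow> 'b) \<Rightarrow> 'b \<Rightarrow> bool" where
  "regular_value A B f q \<longleftrightarrow> (\<forall>x\<in>carrier_of A. f x = q \<longrightarrow>
     (\<exists>c\<in>A. \<exists>d\<in>B. x \<in> fst c \<and> q \<in> fst d \<and> surj (chart_deriv c d f x)))"


section \<open>Signed counts of preimages and the degree\<close>

definition orientation_preserving_at ::
  "('a, 'e::euclidean_space) atlas \<Rightarrow> ('b, 'e) atlas \<Rightarrow> ('a \<Rightarrow> 'b) \<Rightarrow> 'a \<Rightarrow> bool" where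
  "orientation_preserving_at A B f x \<longleftrightarrow>
     (\<exists>c\<in>A. \<exists>d\<in>B. x \<in> fst c \<and> f x \<in> fst d \<and> endo_det (chart_deriv c d f x) > 0)"

definition signed_count ::
  "('a, 'e::euclidean_space) atlas \<Rightarrow> ('b, 'e) atlas \<Rightarrow> ('a \<Rightarrow> 'b) \<Rightarrow> 'b \<Rightarrow> int" where
  "signed_count A B f q =
     (\<Sum>x | x \<in> carrier_of A \<and> f x = q. if orientation_preserving_at A B f x then 1 else -1)"

text \<open>Intended for maps from a closed oriented manifold to a connected oriented manifold
  of the same dimension.\<close>

definition mapping_degree ::
  "('a, 'e::euclidean_space) atlas \<Rightarrow> ('b::topological_space, 'e) atlas \<Rightarrow> ('a \<Rightarrow> 'b) \<Rightarrow> int" where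
  "mapping_degree A B f =
     (if compact (carrier_of B)
      then THE d. \<forall>q\<in>carrier_of B. regular_value A B f q \<longrightarrow> signed_count A B f q = d
      else 0)"


section \<open>The C-infinity topology\<close>

text \<open>The subbasic sets of the (weak) C-infinity topology: maps whose partial derivatives up to
  order \<open>r\<close> in the charts \<open>c\<close> and \<open>d\<close> are uniformly \<open>\<delta>\<close>-close to those of \<open>f\<close> over \<open>K\<close>.\<close>

definition Cinf_subbasic ::
  "('a::topological_space, 'e::euclidean_space) atlas \<Rightarrow>
   ('b::topological_space, 'f::euclidean_space) atlas \<Rightarrow>
   ('a \<Rightarrow> 'b) \<Rightarrow> ('a, 'e) chart \<Rightarrow> ('b, 'f) chart \<Rightarrow> 'a set \<Rightarrow> nat \<Rightarrow> real \<Rightarrow> ('a \<Rightarrow> 'b) set" where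
  "Cinf_subbasic A B f c d K r \<delta> =
     {g. smooth_map A B g \<and> g ` K \<subseteq> fst d \<and>
         (\<forall>vs. set vs \<subseteq> Basis \<and> length vs \<le> r \<longrightarrow>
           (\<forall>x\<in>K. norm (iter_deriv vs (chart_rep c d g) (snd c x)
                      - iter_deriv vs (chart_rep c d f) (snd c x)) < \<delta>))}"

definition Cinf_topology ::
  "('a::{t2_space,second_countable_topology}, 'e::euclidean_space) atlas \<Rightarrow>
   ('b::{t2_space,second_countable_topology}, 'f::euclidean_space) atlas \<Rightarrow> ('a \<Rightarrow> 'b) topology" where
  "Cinf_topology A B = topology_generated_by
     {Cinf_subbasic A B f c d K r \<delta> | f c d K r \<delta>.
        smooth_map A B f \<and> c \<in> A \<and> d \<in> B \<and> compact K \<and> K \<subseteq> fst c \<and> f ` K \<subseteq> fst d \<and> \<delta> > 0}"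


section \<open>Affine winding numbers\<close>

text \<open>If \<open>N\<close> is modelled on \<open>'e\<close>, then \<open>N \<times> I\<close>, \<open>N \<times> S\<^sup>1\<close> and the ambient manifold \<open>M\<close>
  of one dimension more are modelled on \<open>'e \<times> real\<close>.\<close>

definition good_homotopy ::
  "('n::topological_space, 'e::euclidean_space) atlas \<Rightarrow> ('m::topological_space, 'e \<times> real) atlas \<Rightarrow>
   'm \<Rightarrow> ('n \<Rightarrow> 'm) \<Rightarrow> ('n \<Rightarrow> 'm) \<Rightarrow> ('n \<times> real \<Rightarrow> 'm) \<Rightarrow> bool" where
  "good_homotopy N M p f g F \<longleftrightarrow>
     smooth_map (prod_atlas N (interval_atlas {0..1})) M F \<and>
     p \<notin> F ` (carrier_of N \<times> {0, 1}) \<and>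
     regular_value (prod_atlas N (interval_atlas {0..1})) M F p \<and>
     (\<forall>n\<in>carrier_of N. F (n, 0) = f n \<and> F (n, 1) = g n)"

definition Delta ::
  "('n, 'e::euclidean_space) atlas \<Rightarrow> ('m, 'e \<times> real) atlas \<Rightarrow> 'm \<Rightarrow> ('n \<times> real \<Rightarrow> 'm) \<Rightarrow> int" where
  "Delta N M p F = signed_count (prod_atlas N (interval_atlas {0..1})) M F p"

definition indeterminacy_subgroup ::
  "('n::topological_space, 'e::euclidean_space) atlas \<Rightarrow> ('m::topological_space, 'e \<times> real) atlas \<Rightarrow>
   ('n \<Rightarrow> 'm) set \<Rightarrow> int set" where
  "indeterminacy_subgroup N M \<N> =
     {mapping_degree (prod_atlas N circle_atlas) M \<mu> | \<mu>.
        smooth_map (prod_atlas N circle_atlas) M \<mu> \<and>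
        (\<exists>s\<in>sphere 0 1. (\<lambda>n. \<mu> (n, s)) \<in> \<N>)}"

definition awin ::
  "('n::topological_space, 'e::euclidean_space) atlas \<Rightarrow> ('m::topological_space, 'e \<times> real) atlas \<Rightarrow>
   'm \<Rightarrow> ('n \<Rightarrow> 'm) \<Rightarrow> ('n \<Rightarrow> 'm) \<Rightarrow> int" where
  "awin N M p \<epsilon> f = (THE k. \<exists>F. good_homotopy N M p \<epsilon> f F \<and> Delta N M p F = k)"


section \<open>Front propagations\<close>

definition generic_propagation ::
  "('n, 'e::euclidean_space) atlas \<Rightarrow> ('m, 'e \<times> real) atlas \<Rightarrow> 'm \<Rightarrow> real \<Rightarrow>
   ('n \<times> real \<Rightarrow> 'm) \<Rightarrow> bool" where
  "generic_propagation N M p T W \<longleftrightarrow>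
     regular_value (prod_atlas N (interval_atlas {T..})) M W p \<and>
     (\<forall>t\<ge>T. \<forall>n\<in>carrier_of N. \<forall>n'\<in>carrier_of N. W (n, t) = p \<and> W (n', t) = p \<longrightarrow> n = n')"

definition pas :: "'m \<Rightarrow> ('n \<times> real \<Rightarrow> 'm) \<Rightarrow> real \<Rightarrow> real \<Rightarrow> nat" where
  "pas p W t\<^sub>1 t\<^sub>2 = card {t\<in>{t\<^sub>1<..<t\<^sub>2}. p \<in> range (\<lambda>n. W (n, t))}"

end

theory Submission
  imports Defs
begin

text \<open>
  Rescaling the front over $[t_1, t_2]$ to the unit interval gives a good homotopy from
  $W(t_1)$ to $W(t_2)$ whose signed count is a sum of signs, one for each passage through $p$.
  The count \<open>Delta\<close> is additive under concatenation and changes sign under time reversal, so the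
  difference of the affine winding numbers is this sum, as soon as \<open>Delta F\<close> is known to depend
  only on the two ends of $F$. Two good homotopies from $\varepsilon$ to $f$, traversed there and
  back, close up to a map $N \times S^1 \to M$ whose signed count at $p$ is the difference of their
  counts; this is an element of the indeterminacy subgroup because the signed count of preimages
  is the same at all regular values.

  For the last fact, let $\beta_q$ be a bump function concentrated at a regular value $q$ in a
  coordinate box of the target. The integral over the closed source of the pulled back form
  $F^*(\beta_q\, dy)$ is the signed count at $q$ times the integral of $\beta_q$. Moving $q$ inside
  the box along a coordinate axis changes the form by an exact one,
  $d(\Phi\, dy_1 \cdots \widehat{dy_b} \cdots dy_k)$, and the integral of its pullback vanishes. With
  a partition of unity this comes down to $\int \det Dh = 0$ for a compactly supported $C^1$ map
  $h$ of Euclidean space. That holds because the volume of the image of a box under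
  $\mathrm{id} + s h$ is constant for small $s$, while it is a polynomial in $s$ with leading
  coefficient $\int \det Dh$. Regular values are dense by Sard's theorem, so a connected target
  links the boxes together.
\<close>

section \<open>Coordinates indexed by the standard basis\<close>

text \<open>Three obstacles shape the proof. The counting rests on the integral of
  \<open>det Dh\<close>, and the usual argument through divergence-free cofactors differentiates
  \<open>h\<close> twice; the volume argument differentiates once. So all of the degree theory is
  done for \<open>Ck (Suc 0)\<close> maps, and full smoothness returns only where homotopies are
  reparametrised and glued. Good homotopies live on N x [0, 1], which has a boundary, while
  determinants of \<open>chart_deriv\<close> behave well over open chart images; as \<open>p\<close>
  is missed at both ends, the fibre over \<open>p\<close> lies over the open interval, and all signs
  are computed there. Finally, \<open>mapping_degree\<close> and \<open>awin\<close> are definite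
  descriptions. The former is settled by the invariance of signed counts over all regular values; a
  missed value is among them, which yields the value 0 for a noncompact target. For the latter
  existence has to be dealt with: by concatenation and reversal a good homotopy from \<epsilon> to
  \<open>W(t_1)\<close> exists exactly if one to \<open>W(t_2)\<close> does, so both cases can be
  compared.\<close>

text \<open>The change of variables theorem of the library is about \<open>real ^ 'k\<close> with a well-ordered finite
  index type. Indexing by the standard basis makes it available for an arbitrary Euclidean space,
  in particular for \<open>'e \<times> real\<close>.\<close>

typedef (overloaded) 'e basis_index = "Basis :: 'e::euclidean_space set"
  using nonempty_Basis by blast

lemma Rep_basis_index_image: "range (Rep_basis_index :: 'e::euclidean_space basis_index \<Rightarrow> 'e) = Basis"
  using type_definition.Rep_range[OF type_definition_basis_index] .

instance basis_index :: (euclidean_space) finite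
proof
  have "(UNIV :: 'a basis_index set) = Abs_basis_index ` Basis"
    using type_definition.Abs_image[OF type_definition_basis_index] by (rule sym)
  then show "finite (UNIV :: 'a basis_index set)"
    by (metis finite_Basis finite_imageI)
qed

text \<open>Determinants and integrals ignore the order of the indices, so it may be pulled back
  along an arbitrary injection into the naturals.\<close>

definition basis_rank :: "'e::euclidean_space basis_index \<Rightarrow> nat" where
  "basis_rank = (SOME f. inj f)"

lemma inj_basis_rank: "inj (basis_rank :: 'e::euclidean_space basis_index \<Rightarrow> nat)"
proof -
  have "\<exists>f :: 'e basis_index \<Rightarrow> nat. inj f"
    using finite_imp_inj_to_nat_seg[OF finite[of UNIV]] by blast
  then show ?thesis
    unfolding basis_rank_def by (rule someI_ex)
qed

instantiation basis_index :: (euclidean_space) wellorder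
begin

definition less_eq_basis_index :: "'a basis_index \<Rightarrow> 'a basis_index \<Rightarrow> bool" where
  "a \<le> b \<longleftrightarrow> basis_rank a \<le> basis_rank b"

definition less_basis_index :: "'a basis_index \<Rightarrow> 'a basis_index \<Rightarrow> bool" where
  "a < b \<longleftrightarrow> basis_rank a < basis_rank b"

instance
proof
  fix P :: "'a basis_index \<Rightarrow> bool" and a
  assume *: "\<And>x. (\<And>y. y < x \<Longrightarrow> P y) \<Longrightarrow> P x"
  show "P a"
  proof (induction a rule: measure_induct_rule[where f = basis_rank])
    case (less x)
    show ?case by (rule *) (rule less, simp add: less_basis_index_def)
  qed
qed (auto simp: less_eq_basis_index_def less_basis_index_def dest: injD[OF inj_basis_rank])

end

definition to_vec :: "'e::euclidean_space \<Rightarrow> real ^ 'e basis_index" where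
  "to_vec x = (\<chi> i. x \<bullet> Rep_basis_index i)"

definition of_vec :: "real ^ 'e basis_index \<Rightarrow> 'e::euclidean_space" where
  "of_vec v = (\<Sum>i\<in>UNIV. v $ i *\<^sub>R Rep_basis_index i)"

lemma Rep_basis_index_Basis [simp]: "Rep_basis_index i \<in> Basis"
  by (rule Rep_basis_index)

lemma sum_basis_index: "(\<Sum>i\<in>UNIV. f (Rep_basis_index i)) = (\<Sum>b\<in>Basis. f b)"
  for f :: "'e::euclidean_space \<Rightarrow> 'b::comm_monoid_add"
  using sum.reindex[of Rep_basis_index "UNIV :: 'e basis_index set" f]
  by (simp add: Rep_basis_index_image inj_def Rep_basis_index_inject)

lemma prod_basis_index: "(\<Prod>i\<in>UNIV. f (Rep_basis_index i)) = (\<Prod>b\<in>Basis. f b)"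
  for f :: "'e::euclidean_space \<Rightarrow> 'b::comm_monoid_mult"
  using prod.reindex[of Rep_basis_index "UNIV :: 'e basis_index set" f]
  by (simp add: Rep_basis_index_image inj_def Rep_basis_index_inject)

lemma of_vec_to_vec [simp]: "of_vec (to_vec x) = x"
  unfolding of_vec_def to_vec_def
  using sum_basis_index[of "\<lambda>b. (x \<bullet> b) *\<^sub>R b"] by (simp add: euclidean_representation)

lemma inner_Rep_basis_index:
  "Rep_basis_index i \<bullet> Rep_basis_index j = (if i = j then 1 else 0)"
  by (simp add: inner_Basis Rep_basis_index_inject)

lemma to_vec_of_vec [simp]: "to_vec (of_vec v) = v"
  by (simp add: of_vec_def to_vec_def vec_eq_iff inner_sum_left inner_Rep_basis_index if_distrib cong: if_cong)

lemma linear_to_vec: "linear to_vec"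
  by (rule linearI) (auto simp: to_vec_def vec_eq_iff inner_add_left)

lemma linear_of_vec: "linear of_vec"
  by (rule linearI) (auto simp: of_vec_def scaleR_add_left sum.distrib scaleR_sum_right)

lemma bounded_linear_to_vec: "bounded_linear to_vec"
  using linear_to_vec linear_conv_bounded_linear by blast

lemma bounded_linear_of_vec: "bounded_linear of_vec"
  using linear_of_vec linear_conv_bounded_linear by blast

section \<open>Determinants of endomorphisms in coordinates\<close>

lemma sum_permutes_image:
  assumes "inj_on f A"
  shows "(\<Sum>\<pi> | \<pi> permutes f ` A. g \<pi>) = (\<Sum>\<pi> | \<pi> permutes A. g (map_permutation A f \<pi>))"
proof -
  have bij: "bij_betw f A (f ` A)" and bij': "bij_betw (inv_into A f) (f ` A) A"
    using bij_betw_inv_into[OF inj_on_imp_bij_betw[OF assms]] inj_on_imp_bij_betw[OF assms] by blast+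
  show ?thesis
  proof (rule sum.reindex_bij_witness[of _ "map_permutation A f" "map_permutation (f ` A) (inv_into A f)"])
    fix \<pi> assume "\<pi> \<in> {\<pi>. \<pi> permutes f ` A}"
    then have \<pi>: "\<pi> permutes f ` A" by simp
    show *: "map_permutation A f (map_permutation (f ` A) (inv_into A f) \<pi>) = \<pi>"
      by (rule map_permutation_compose_inv[OF bij' \<pi>]) (auto simp: f_inv_into_f)
    show "map_permutation (f ` A) (inv_into A f) \<pi> \<in> {\<pi>. \<pi> permutes A}"
      using map_permutation_permutes[OF bij' \<pi>] by simp
    show "g (map_permutation A f (map_permutation (f ` A) (inv_into A f) \<pi>)) = g \<pi>"
      by (simp only: *)
  next
    fix \<pi> assume "\<pi> \<in> {\<pi>. \<pi> permutes A}"
    then have \<pi>: "\<pi> permutes A" by simp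
    show "map_permutation (f ` A) (inv_into A f) (map_permutation A f \<pi>) = \<pi>"
      by (rule map_permutation_compose_inv[OF bij \<pi>]) (use assms in auto)
    show "map_permutation A f \<pi> \<in> {\<pi>. \<pi> permutes f ` A}"
      using map_permutation_permutes[OF bij \<pi>] by simp
  qed
qed

lemma endo_det_eq_det: "endo_det L = det (matrix (to_vec \<circ> L \<circ> of_vec))"
  for L :: "'e::euclidean_space \<Rightarrow> 'e"
proof -
  let ?r = "Rep_basis_index :: 'e basis_index \<Rightarrow> 'e"
  let ?A = "matrix (to_vec \<circ> L \<circ> of_vec)"
  have inj: "inj ?r" by (simp add: inj_def Rep_basis_index_inject)
  have ax: "of_vec (axis j 1) = ?r j" for j
    by (simp add: of_vec_def axis_def if_distrib[of "\<lambda>c. c *\<^sub>R _"] cong: if_cong)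
  have A: "?A $ i $ j = L (?r j) \<bullet> ?r i" for i j
    by (simp add: matrix_def to_vec_def ax)
  have "endo_det L = (\<Sum>\<pi> | \<pi> permutes ?r ` UNIV. of_int (sign \<pi>) * (\<Prod>b\<in>Basis. L b \<bullet> \<pi> b))"
    by (simp add: endo_det_def Rep_basis_index_image)
  also have "\<dots> = (\<Sum>\<pi> | \<pi> permutes (UNIV :: 'e basis_index set).
      of_int (sign (map_permutation UNIV ?r \<pi>)) * (\<Prod>b\<in>Basis. L b \<bullet> map_permutation UNIV ?r \<pi> b))"
    by (rule sum_permutes_image[OF inj])
  \<comment> \<open>The factor \<open>L b \<bullet> \<pi> b\<close> sits in column \<open>b\<close>
    and row \<open>\<pi> b\<close>, so the product is a Leibniz term of the transposed
    matrix.\<close>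
  also have "\<dots> = (\<Sum>\<pi> | \<pi> permutes (UNIV :: 'e basis_index set).
      of_int (sign \<pi>) * (\<Prod>i\<in>UNIV. transpose ?A $ i $ \<pi> i))"
  proof (rule sum.cong[OF refl])
    fix \<pi> assume "\<pi> \<in> {\<pi>. \<pi> permutes (UNIV :: 'e basis_index set)}"
    then have \<pi>: "\<pi> permutes (UNIV :: 'e basis_index set)" by simp
    have "(\<Prod>b\<in>Basis. L b \<bullet> map_permutation UNIV ?r \<pi> b) =
        (\<Prod>i\<in>UNIV. L (?r i) \<bullet> map_permutation UNIV ?r \<pi> (?r i))"
      by (rule prod_basis_index[symmetric])
    also have "\<dots> = (\<Prod>i\<in>UNIV. transpose ?A $ i $ \<pi> i)"
      by (simp add: map_permutation_apply[OF inj] A transpose_def)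
    finally show "of_int (sign (map_permutation UNIV ?r \<pi>)) * (\<Prod>b\<in>Basis. L b \<bullet> map_permutation UNIV ?r \<pi> b)
        = of_int (sign \<pi>) * (\<Prod>i\<in>UNIV. transpose ?A $ i $ \<pi> i)"
      using sign_map_permutation[OF inj \<pi> finite] by simp
  qed
  also have "\<dots> = det (transpose ?A)" by (simp add: det_def)
  finally show ?thesis by simp
qed

lemma endo_det_compose:
  assumes "linear L" "linear K"
  shows "endo_det (L \<circ> K) = endo_det L * endo_det K"
proof -
  have "to_vec \<circ> (L \<circ> K) \<circ> of_vec = (to_vec \<circ> L \<circ> of_vec) \<circ> (to_vec \<circ> K \<circ> of_vec)"
    by (auto simp: fun_eq_iff)
  moreover have "linear (to_vec \<circ> L \<circ> of_vec)" "linear (to_vec \<circ> K \<circ> of_vec)"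
    by (intro linear_compose linear_of_vec linear_to_vec assms)+
  ultimately show ?thesis
    by (simp add: endo_det_eq_det matrix_compose det_mul)
qed

lemma endo_det_nonzero_iff_surj:
  assumes "linear L"
  shows "endo_det L \<noteq> 0 \<longleftrightarrow> surj L"
proof -
  have lin: "linear (to_vec \<circ> L \<circ> of_vec)"
    by (intro linear_compose linear_of_vec linear_to_vec assms)
  have bij: "bij to_vec" "bij of_vec"
    by (auto intro!: o_bij[of of_vec] o_bij[of to_vec])
  have "endo_det L \<noteq> 0 \<longleftrightarrow> inj (to_vec \<circ> L \<circ> of_vec)"
    using det_nz_iff_inj[OF lin] by (simp add: endo_det_eq_det)
  also have "\<dots> \<longleftrightarrow> surj (to_vec \<circ> L \<circ> of_vec)"
    using lin linear_injective_imp_surjective linear_surjective_imp_injective by blast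
  also have "\<dots> \<longleftrightarrow> surj L"
  proof
    assume s: "surj (to_vec \<circ> L \<circ> of_vec)"
    show "surj L"
      unfolding surj_def
    proof
      fix y
      obtain v where "to_vec y = (to_vec \<circ> L \<circ> of_vec) v"
        using s by (metis surj_def)
      then have "of_vec (to_vec y) = of_vec (to_vec (L (of_vec v)))" by simp
      then show "\<exists>x. y = L x" by auto
    qed
  next
    assume "surj L"
    then show "surj (to_vec \<circ> L \<circ> of_vec)"
      using comp_surj[OF bij_is_surj[OF bij(2)] comp_surj[OF _ bij_is_surj[OF bij(1)]]] by blast
  qed
  finally show ?thesis .
qed

text \<open>Every Leibniz term contains exactly one factor for the basis vector
  \<open>(0, 1)\<close>, and this factor picks up \<open>c\<close>. It describes the effect on
  orientation signs of a change of time with derivative \<open>c\<close>.\<close>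

lemma endo_det_scale_snd:
  fixes L :: "'e::euclidean_space \<times> real \<Rightarrow> 'e \<times> real"
  assumes "linear L"
  shows "endo_det (L \<circ> (\<lambda>(y, s). (y, c * s))) = c * endo_det L"
proof -
  have [simp]: "(0, 1) \<notin> (\<lambda>u. (u, 0)) ` (Basis :: 'e set)"
    by auto
  have B: "(Basis :: ('e \<times> real) set) = insert (0, 1) ((\<lambda>u. (u, 0)) ` Basis)"
    by (auto simp: Basis_prod_def)
  have "L (0, c) = c *\<^sub>R L (0, 1)"
    using linear_cmul[OF assms, of c "(0, 1)"] by simp
  then have "(\<Prod>b\<in>Basis. (L \<circ> (\<lambda>(y, s). (y, c * s))) b \<bullet> \<pi> b) = c * (\<Prod>b\<in>Basis. L b \<bullet> \<pi> b)" for \<pi>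
    unfolding B by (simp add: prod.reindex inj_on_def)
  then show ?thesis
    by (simp add: endo_det_def sum_distrib_left mult.left_commute)
qed

text \<open>A permutation that moves \<open>(0, 1)\<close> sends it to some \<open>(u, 0)\<close>,
  and the factor \<open>(0, 1) \<bullet> (u, 0)\<close> kills its term. The other permutations are
  those of the basis of the first factor, carried over by \<open>map_permutation\<close>.\<close>

lemma endo_det_map_prod_id:
  fixes L :: "'e::euclidean_space \<Rightarrow> 'e"
  assumes "linear L"
  shows "endo_det (\<lambda>(y, s :: real). (L y, s)) = endo_det L"
proof -
  let ?f = "\<lambda>u :: 'e. (u, 0 :: real)"
  let ?K = "\<lambda>(y, s :: real). (L y, s)"
  have L0: "L 0 = 0" using assms by (rule linear_0)
  have notin: "(0, 1) \<notin> ?f ` Basis"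
    by auto
  have inj: "inj_on ?f Basis"
    by (simp add: inj_on_def)
  have B: "(Basis :: ('e \<times> real) set) = insert (0, 1) (?f ` Basis)"
    by (auto simp: Basis_prod_def)
  have sub: "?f ` Basis \<subseteq> (Basis :: ('e \<times> real) set)"
    unfolding B by (rule subset_insertI)
  have z: "of_int (sign \<pi>) * (\<Prod>b\<in>Basis. ?K b \<bullet> \<pi> b) = 0"
    if \<pi>: "\<pi> permutes Basis" "\<not> \<pi> permutes ?f ` Basis" for \<pi>
  proof -
    have "\<pi> (0, 1) \<noteq> (0, 1)"
    proof
      assume "\<pi> (0, 1) = (0, 1)"
      moreover have "x = (0, 1)" if "x \<in> Basis - ?f ` Basis" for x
        using that unfolding B by blast
      ultimately have "\<pi> permutes ?f ` Basis"
        by (intro permutes_superset[OF \<pi>(1)]) metis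
      with \<pi> show False by simp
    qed
    moreover have "\<pi> (0, 1) \<in> Basis"
      using permutes_in_image[OF \<pi>(1), of "(0, 1)"] unfolding B by blast
    ultimately have "\<pi> (0, 1) \<in> ?f ` Basis"
      unfolding B by blast
    then obtain u where "\<pi> (0, 1) = (u, 0)" by blast
    then have "?K (0, 1) \<bullet> \<pi> (0, 1) = 0" by (simp add: L0)
    moreover have "(0, 1) \<in> (Basis :: ('e \<times> real) set)" unfolding B by blast
    ultimately have "(\<Prod>b\<in>Basis. ?K b \<bullet> \<pi> b) = 0"
      by (intro prod_zero finite_Basis bexI)
    then show ?thesis by simp
  qed
  have "endo_det ?K = (\<Sum>\<pi> | \<pi> permutes ?f ` Basis. of_int (sign \<pi>) * (\<Prod>b\<in>Basis. ?K b \<bullet> \<pi> b))"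
    unfolding endo_det_def
  proof (rule sum.mono_neutral_right)
    show "finite {\<pi>. \<pi> permutes (Basis :: ('e \<times> real) set)}"
      by (rule finite_permutations[OF finite_Basis])
    show "{\<pi>. \<pi> permutes ?f ` Basis} \<subseteq> {\<pi>. \<pi> permutes (Basis :: ('e \<times> real) set)}"
      using permutes_subset[OF _ sub] by blast
  qed (use z in blast)
  also have "\<dots> = (\<Sum>\<pi> | \<pi> permutes Basis. of_int (sign (map_permutation Basis ?f \<pi>)) *
      (\<Prod>b\<in>Basis. ?K b \<bullet> map_permutation Basis ?f \<pi> b))"
    by (rule sum_permutes_image[OF inj])
  also have "\<dots> = (\<Sum>\<pi> | \<pi> permutes Basis. of_int (sign \<pi>) * (\<Prod>b\<in>Basis. L b \<bullet> \<pi> b))"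
  proof (rule sum.cong[OF refl])
    fix \<pi> assume "\<pi> \<in> {\<pi>. \<pi> permutes (Basis :: 'e set)}"
    then have \<pi>: "\<pi> permutes (Basis :: 'e set)" by simp
    let ?m = "map_permutation Basis ?f \<pi>"
    have "?m permutes ?f ` Basis"
      by (rule map_permutation_permutes[OF inj_on_imp_bij_betw[OF inj] \<pi>])
    then have m: "?m (0, 1) = (0, 1)"
      using notin by (rule permutes_not_in)
    have "(\<Prod>b\<in>Basis. ?K b \<bullet> ?m b) = (?K (0, 1) \<bullet> ?m (0, 1)) * (\<Prod>b\<in>?f ` Basis. ?K b \<bullet> ?m b)"
      unfolding B by (rule prod.insert) (use notin in auto)
    also have "\<dots> = (\<Prod>b\<in>Basis. ?K (?f b) \<bullet> ?m (?f b))"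
      by (simp add: m L0 prod.reindex[OF inj])
    also have "\<dots> = (\<Prod>b\<in>Basis. L b \<bullet> \<pi> b)"
      by (rule prod.cong[OF refl]) (simp add: map_permutation_apply[OF inj])
    finally show "of_int (sign ?m) * (\<Prod>b\<in>Basis. ?K b \<bullet> ?m b) = of_int (sign \<pi>) * (\<Prod>b\<in>Basis. L b \<bullet> \<pi> b)"
      using sign_map_permutation[OF inj \<pi> finite_Basis] by simp
  qed
  finally show ?thesis by (simp add: endo_det_def)
qed

section \<open>Continuously differentiable functions and the smooth step\<close>

text \<open>Total differentiability is demanded at each level, as in \<open>smooth_on_open\<close>,
  and only partial derivatives are passed on. The finite order is kept because the degree theory
  works with \<open>Ck (Suc 0)\<close>.\<close>

primrec Ck :: "nat \<Rightarrow> 'a::euclidean_space set \<Rightarrow> ('a \<Rightarrow> 'b::euclidean_space) \<Rightarrow> bool" where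
  "Ck 0 U f \<longleftrightarrow> continuous_on U f"
| "Ck (Suc k) U f \<longleftrightarrow> (\<forall>x\<in>U. f differentiable (at x)) \<and>
     (\<forall>b\<in>Basis. Ck k U (\<lambda>x. frechet_derivative f (at x) b))"

text \<open>\<open>frechet_derivative\<close> chooses one of the maps that are derivatives, and both
  functions have the same ones. So the equation holds also at points where neither function is
  differentiable.\<close>

lemma frechet_derivative_cong_open:
  assumes "open U" "x \<in> U" "\<And>y. y \<in> U \<Longrightarrow> f y = g y"
  shows "frechet_derivative f (at x) = frechet_derivative g (at x)"
proof -
  have "(f has_derivative D) (at x) \<longleftrightarrow> (g has_derivative D) (at x)" for D
    using has_derivative_transform_within_open[of f D x UNIV U g]
      has_derivative_transform_within_open[of g D x UNIV U f] assms by auto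
  then show ?thesis by (simp add: frechet_derivative_def)
qed

lemma differentiable_cong_open:
  assumes "open U" "x \<in> U" "\<And>y. y \<in> U \<Longrightarrow> f y = g y" "f differentiable (at x)"
  shows "g differentiable (at x)"
  using assms has_derivative_transform_within_open[of f _ x UNIV U g]
  unfolding differentiable_def by auto

lemma has_derivative_frechet:
  "f differentiable (at x) \<Longrightarrow> (f has_derivative frechet_derivative f (at x)) (at x)"
  by (simp add: frechet_derivative_works)

lemma frechet_derivative_eq:
  "(f has_derivative D) (at x) \<Longrightarrow> frechet_derivative f (at x) = D"
  using frechet_derivative_at by metis

lemma Ck_cong:
  assumes "open U" "\<And>x. x \<in> U \<Longrightarrow> f x = g x" "Ck k U f"
  shows "Ck k U g"
  using assms(2,3)
proof (induction k arbitrary: f g)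
  case 0
  then show ?case by (auto cong: continuous_on_cong)
next
  case (Suc k)
  have "g differentiable (at x)" if "x \<in> U" for x
    using differentiable_cong_open[OF assms(1) that] Suc.prems that by (auto simp del: differentiable_def)
  moreover have "Ck k U (\<lambda>x. frechet_derivative g (at x) b)" if "b \<in> Basis" for b
  proof (rule Suc.IH)
    show "Ck k U (\<lambda>x. frechet_derivative f (at x) b)" using Suc.prems that by simp
    show "frechet_derivative f (at x) b = frechet_derivative g (at x) b" if "x \<in> U" for x
      using frechet_derivative_cong_open[OF assms(1) that] Suc.prems(1) by metis
  qed
  ultimately show ?case by simp
qed

lemma Ck_subset: "Ck k U f \<Longrightarrow> V \<subseteq> U \<Longrightarrow> Ck k V f"
  by (induction k arbitrary: f) (auto intro: continuous_on_subset)

lemma Ck_differentiable: "Ck (Suc k) U f \<Longrightarrow> x \<in> U \<Longrightarrow> f differentiable (at x)"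
  by simp

lemma Ck_continuous_on: "Ck k U f \<Longrightarrow> continuous_on U f"
  by (cases k) (auto simp: differentiable_imp_continuous_within
      intro!: continuous_at_imp_continuous_on)

lemma Ck_Suc: "Ck (Suc k) U f \<Longrightarrow> Ck k U f"
proof (induction k arbitrary: f)
  case 0
  then show ?case using Ck_continuous_on by (metis Ck.simps(1))
next
  case (Suc k)
  have "\<forall>b\<in>Basis. Ck (Suc k) U (\<lambda>x. frechet_derivative f (at x) b)"
    "\<forall>x\<in>U. f differentiable (at x)"
    using Suc.prems Ck.simps(2)[of "Suc k" U f] by blast+
  then show ?case using Suc.IH Ck.simps(2)[of k U f] by blast
qed

lemma Ck_local:
  assumes "\<And>x. x \<in> U \<Longrightarrow> \<exists>V. open V \<and> x \<in> V \<and> Ck k V f"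
  shows "Ck k U f"
  using assms
proof (induction k arbitrary: f)
  case 0
  show ?case
    unfolding Ck.simps
  proof (rule continuous_at_imp_continuous_on, rule ballI)
    fix x assume "x \<in> U"
    from 0[OF this] obtain V where "open V" "x \<in> V" "continuous_on V f" by auto
    then show "isCont f x" using continuous_on_eq_continuous_at by blast
  qed
next
  case (Suc k)
  have "f differentiable (at x)" if "x \<in> U" for x
    using Suc.prems[OF that] by auto
  moreover have "Ck k U (\<lambda>x. frechet_derivative f (at x) b)" if "b \<in> Basis" for b
    by (rule Suc.IH) (use Suc.prems that in fastforce)
  ultimately show ?case by simp
qed

lemma iter_deriv_append: "iter_deriv (vs @ ws) f = iter_deriv vs (iter_deriv ws f)"
  by (induction vs) auto

text \<open>\<open>iter_deriv\<close> applies the last entry of the list first, and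
  \<open>Ck\<close> peels off this innermost derivative; hence the appended lists and the reverse
  induction.\<close>

lemma smooth_on_open_iff_Ck: "smooth_on_open U f \<longleftrightarrow> open U \<and> (\<forall>k. Ck k U f)"
proof (intro iffI conjI allI)
  show "open U" if "smooth_on_open U f" using that by (simp add: smooth_on_open_def)
  show "Ck k U f" if "smooth_on_open U f" for k
    using that
  proof (induction k arbitrary: f)
    case 0
    then have "\<forall>x\<in>U. f differentiable (at x)"
      unfolding smooth_on_open_def by (metis empty_set empty_subsetI iter_deriv.simps(1))
    then show ?case
      by (auto intro!: continuous_at_imp_continuous_on differentiable_imp_continuous_within)
  next
    case (Suc k)
    have "\<forall>x\<in>U. f differentiable (at x)"
      using Suc.prems unfolding smooth_on_open_def by (metis empty_set empty_subsetI iter_deriv.simps(1))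
    moreover have "smooth_on_open U (\<lambda>x. frechet_derivative f (at x) b)" if "b \<in> Basis" for b
      unfolding smooth_on_open_def
    proof (intro conjI allI impI)
      show "open U" using Suc.prems by (simp add: smooth_on_open_def)
      fix vs :: "'a list" assume "set vs \<subseteq> Basis"
      then have "set (vs @ [b]) \<subseteq> Basis" using that by simp
      then have "\<forall>x\<in>U. iter_deriv (vs @ [b]) f differentiable at x"
        using Suc.prems unfolding smooth_on_open_def by blast
      then show "\<forall>x\<in>U. iter_deriv vs (\<lambda>x. frechet_derivative f (at x) b) differentiable at x"
        by (simp add: iter_deriv_append)
    qed
    ultimately show ?case using Suc.IH by simp
  qed
next
  assume f: "open U \<and> (\<forall>k. Ck k U f)"
  have "\<forall>x\<in>U. iter_deriv vs f differentiable (at x)" if "set vs \<subseteq> Basis" "\<forall>k. Ck k U f" for vs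
    using that
  proof (induction vs arbitrary: f rule: rev_induct)
    case Nil
    then have "Ck (Suc 0) U f" by blast
    then show ?case by simp
  next
    case (snoc b vs)
    have "Ck (Suc k) U f" for k using snoc.prems by blast
    then have "\<forall>k. Ck k U (\<lambda>x. frechet_derivative f (at x) b)"
      using snoc.prems(1) by simp
    with snoc.IH[of "\<lambda>x. frechet_derivative f (at x) b"] snoc.prems(1) show ?case
      by (simp add: iter_deriv_append)
  qed
  with f show "smooth_on_open U f" by (simp add: smooth_on_open_def)
qed

lemma Ck_const [simp]: "Ck k U (\<lambda>x. c)"
  by (induction k arbitrary: c) (auto simp: frechet_derivative_const)

lemma Ck_bounded_linear:
  assumes "bounded_linear L"
  shows "Ck k U L"
proof (cases k)
  case 0
  then show ?thesis using assms by (simp add: linear_continuous_on)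
next
  case (Suc m)
  have "frechet_derivative L (at x) = L" for x
    using bounded_linear_imp_has_derivative[OF assms] by (rule frechet_derivative_eq)
  then show ?thesis
    using assms Suc by (auto intro: bounded_linear_imp_differentiable)
qed

lemma Ck_add:
  assumes "open U" "Ck k U f" "Ck k U g"
  shows "Ck k U (\<lambda>x. f x + g x)"
  using assms(2,3)
proof (induction k arbitrary: f g)
  case 0
  then show ?case by (simp add: continuous_on_add)
next
  case (Suc k)
  have "Ck k U (\<lambda>x. frechet_derivative (\<lambda>x. f x + g x) (at x) b)" if b: "b \<in> Basis" for b
  proof (rule Ck_cong[OF assms(1)])
    show "Ck k U (\<lambda>x. frechet_derivative f (at x) b + frechet_derivative g (at x) b)"
      using Suc.prems b by (intro Suc.IH) auto
    show "frechet_derivative f (at x) b + frechet_derivative g (at x) b =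
        frechet_derivative (\<lambda>x. f x + g x) (at x) b" if "x \<in> U" for x
      using frechet_derivative_eq[OF has_derivative_add[OF has_derivative_frechet has_derivative_frechet, of f x g]]
        Suc.prems that by simp
  qed
  then show ?case using Suc.prems by (simp add: differentiable_add)
qed

lemma Ck_sum:
  assumes "open U" "\<And>i. i \<in> I \<Longrightarrow> Ck k U (f i)"
  shows "Ck k U (\<lambda>x. \<Sum>i\<in>I. f i x)"
  using assms(2)
proof (induction I rule: infinite_finite_induct)
  case (insert i I)
  then show ?case by (simp add: Ck_add[OF assms(1)])
qed simp_all

lemma Ck_bilinear:
  assumes "open U" "bounded_bilinear B" "Ck k U f" "Ck k U g"
  shows "Ck k U (\<lambda>x. B (f x) (g x))"
  using assms(3,4)
proof (induction k arbitrary: f g)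
  case 0
  then show ?case using bounded_bilinear.continuous_on[OF assms(2)] by simp
next
  case (Suc k)
  have d: "((\<lambda>x. B (f x) (g x)) has_derivative (\<lambda>h. B (f x) (frechet_derivative g (at x) h) +
      B (frechet_derivative f (at x) h) (g x))) (at x)" if "x \<in> U" for x
    using bounded_bilinear.FDERIV[OF assms(2) has_derivative_frechet has_derivative_frechet, of f x g]
      Suc.prems that by simp
  have "Ck k U (\<lambda>x. frechet_derivative (\<lambda>x. B (f x) (g x)) (at x) b)" if b: "b \<in> Basis" for b
  proof (rule Ck_cong[OF assms(1)])
    show "Ck k U (\<lambda>x. B (f x) (frechet_derivative g (at x) b) + B (frechet_derivative f (at x) b) (g x))"
      using Suc.prems b by (intro Ck_add assms(1) Suc.IH Ck_Suc[of k U f] Ck_Suc[of k U g]) auto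
    show "B (f x) (frechet_derivative g (at x) b) + B (frechet_derivative f (at x) b) (g x) =
        frechet_derivative (\<lambda>x. B (f x) (g x)) (at x) b" if "x \<in> U" for x
      using frechet_derivative_eq[OF d[OF that]] by simp
  qed
  then show ?case using d by (auto simp: differentiable_def)
qed

lemmas Ck_scaleR = Ck_bilinear[OF _ bounded_bilinear_scaleR]
lemmas Ck_mult = Ck_bilinear[OF _ bounded_bilinear_mult]
lemmas Ck_inner = Ck_bilinear[OF _ bounded_bilinear_inner]

lemma Ck_prod:
  fixes f :: "'i \<Rightarrow> 'a::euclidean_space \<Rightarrow> real"
  assumes "open U" "\<And>i. i \<in> I \<Longrightarrow> Ck k U (f i)"
  shows "Ck k U (\<lambda>x. \<Prod>i\<in>I. f i x)"
  using assms(2)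
proof (induction I rule: infinite_finite_induct)
  case (insert i I)
  then show ?case by (simp add: Ck_mult[OF assms(1)])
qed simp_all

text \<open>The chain rule, expanded in the basis of the middle space, writes a partial derivative
  of the composite as a sum of products: coefficients of the derivative of \<open>g\<close> times
  partial derivatives of \<open>f\<close> composed with \<open>g\<close>. The induction hypothesis
  covers the latter because \<open>f\<close> is arbitrary in it.\<close>

lemma Ck_compose:
  fixes f :: "'b::euclidean_space \<Rightarrow> 'c::euclidean_space" and g :: "'a::euclidean_space \<Rightarrow> 'b"
  assumes "open U" "Ck k U g" "Ck k V f" "open V" "g ` U \<subseteq> V"
  shows "Ck k U (\<lambda>x. f (g x))"
  using assms(2,3)
proof (induction k arbitrary: f)
  case 0
  then show ?case using assms(5) by (auto intro: continuous_on_compose2)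
next
  case (Suc k)
  have d: "((\<lambda>x. f (g x)) has_derivative (\<lambda>h. frechet_derivative f (at (g x)) (frechet_derivative g (at x) h))) (at x)"
    if "x \<in> U" for x
    using diff_chain_at[OF has_derivative_frechet has_derivative_frechet, of g x f]
      Suc.prems that assms(5) by (auto simp: o_def image_subset_iff)
  have "Ck k U (\<lambda>x. frechet_derivative (\<lambda>x. f (g x)) (at x) b)" if b: "b \<in> Basis" for b
  proof (rule Ck_cong[OF assms(1)])
    show "Ck k U (\<lambda>x. \<Sum>c\<in>Basis. (frechet_derivative g (at x) b \<bullet> c) *\<^sub>R frechet_derivative f (at (g x)) c)"
    proof (intro Ck_sum assms(1) Ck_scaleR Ck_inner Ck_const)
      show "Ck k U (\<lambda>x. frechet_derivative g (at x) b)" using Suc.prems b by simp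
      fix c :: 'b assume "c \<in> Basis"
      then show "Ck k U (\<lambda>x. frechet_derivative f (at (g x)) c)"
        using Suc.prems Ck_Suc[OF Suc.prems(1)]
        by (intro Suc.IH[of "\<lambda>y. frechet_derivative f (at y) c"]) auto
    qed
    fix x assume x: "x \<in> U"
    have lin: "linear (frechet_derivative f (at (g x)))"
      using Suc.prems(2) x assms(5) by (intro linear_frechet_derivative) auto
    let ?v = "frechet_derivative g (at x) b" and ?D = "frechet_derivative f (at (g x))"
    have "(\<Sum>c\<in>Basis. (?v \<bullet> c) *\<^sub>R ?D c) = ?D (\<Sum>c\<in>Basis. (?v \<bullet> c) *\<^sub>R c)"
      by (simp only: linear_sum[OF lin] linear_cmul[OF lin])
    also have "\<dots> = ?D ?v"
      by (simp only: euclidean_representation)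
    also have "\<dots> = frechet_derivative (\<lambda>x. f (g x)) (at x) b"
      by (simp only: frechet_derivative_eq[OF d[OF x]])
    finally show "(\<Sum>c\<in>Basis. (?v \<bullet> c) *\<^sub>R ?D c) = frechet_derivative (\<lambda>x. f (g x)) (at x) b" .
  qed
  then show ?case using d by (auto simp: differentiable_def)
qed

lemma Ck_Pair:
  assumes "open U" "Ck k U f" "Ck k U g"
  shows "Ck k U (\<lambda>x. (f x, g x))"
proof -
  have "Ck k U (\<lambda>x. (\<lambda>u. (u, 0)) (f x) + (\<lambda>u. (0, u)) (g x))"
    by (intro Ck_add Ck_compose[OF assms(1) assms(2) Ck_bounded_linear[of _ _ UNIV]]
        Ck_compose[OF assms(1) assms(3) Ck_bounded_linear[of _ _ UNIV]] assms(1)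
        bounded_linear_Pair bounded_linear_zero bounded_linear_ident) auto
  then show ?thesis by simp
qed

lemma Ck_vec:
  fixes f :: "'i::finite \<Rightarrow> 'a::euclidean_space \<Rightarrow> real"
  assumes "open U" "\<And>i. Ck k U (f i)"
  shows "Ck k U (\<lambda>x. \<chi> i. f i x)"
proof -
  have "Ck k U (\<lambda>x. \<Sum>i\<in>UNIV. f i x *\<^sub>R axis i (1::real))"
    by (intro Ck_sum Ck_scaleR assms Ck_const)
  moreover have "(\<Sum>i\<in>UNIV. f i x *\<^sub>R axis i (1::real)) = (\<chi> i. f i x)" for x
    by (simp add: vec_eq_iff axis_def if_distrib cong: if_cong)
  ultimately show ?thesis by simp
qed

lemma Ck_nth:
  assumes "open U" "Ck k U f"
  shows "Ck k U (\<lambda>x. f x $ i)"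
  by (rule Ck_compose[OF assms Ck_bounded_linear[OF bounded_linear_vec_nth, of k UNIV]]) auto

lemma Ck_real_Suc:
  fixes f :: "real \<Rightarrow> real"
  assumes "open U" "\<And>x. x \<in> U \<Longrightarrow> (f has_real_derivative f' x) (at x)" "Ck k U f'"
  shows "Ck (Suc k) U f"
proof -
  have d: "(f has_derivative (*) (f' x)) (at x)" if "x \<in> U" for x
    using assms(2)[OF that] by (simp add: has_field_derivative_def)
  have "Ck k U (\<lambda>x. frechet_derivative f (at x) 1)"
    by (rule Ck_cong[OF assms(1) _ assms(3)]) (simp add: frechet_derivative_eq[OF d])
  then show ?thesis using d by (auto simp: differentiable_def)
qed

lemma Ck_inverse:
  assumes "open U" "Ck k U f" "\<And>x. x \<in> U \<Longrightarrow> f x \<noteq> (0::real)"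
  shows "Ck k U (\<lambda>x. inverse (f x))"
proof -
  have op: "open {x::real. x \<noteq> 0}" using open_Collect_neq[of "\<lambda>x::real. x" "\<lambda>x. 0"] by simp
  have "Ck k {x::real. x \<noteq> 0} inverse"
  proof (induction k)
    case 0
    show ?case by (auto intro!: continuous_intros)
  next
    case (Suc k)
    show ?case
    proof (rule Ck_real_Suc[OF op])
      show "(inverse has_real_derivative (-1) * (inverse x * inverse x)) (at x)" if "x \<in> {x. x \<noteq> 0}" for x :: real
        using that by (auto intro!: derivative_eq_intros)
      show "Ck k {x::real. x \<noteq> 0} (\<lambda>x. (-1) * (inverse x * inverse x))"
        by (intro Ck_mult op Ck_const Suc)
    qed
  qed
  then show ?thesis
    by (rule Ck_compose[OF assms(1,2) _ op]) (use assms(3) in auto)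
qed

section \<open>The flat exponential and the smooth step\<close>

definition flat_exp :: "nat \<Rightarrow> real \<Rightarrow> real" where
  "flat_exp n x = (if x \<le> 0 then 0 else (1 / x) ^ n * exp (- (1 / x)))"

lemma flat_exp_tendsto: "(flat_exp n \<longlongrightarrow> 0) (at 0)"
proof -
  have "((\<lambda>x. inverse x ^ n / exp (inverse x)) \<longlongrightarrow> (0::real)) (at_right 0)"
    by (rule filterlim_compose[OF tendsto_power_div_exp_0[of n] filterlim_inverse_at_top_right])
  moreover have "eventually (\<lambda>x. inverse x ^ n / exp (inverse x) = flat_exp n x) (at_right (0::real))"
    unfolding eventually_at_right_field
    by (rule exI[of _ 1]) (simp add: flat_exp_def exp_minus divide_inverse)
  ultimately have "(flat_exp n \<longlongrightarrow> 0) (at_right 0)"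
    by (rule Lim_transform_eventually)
  moreover have "(flat_exp n \<longlongrightarrow> 0) (at_left 0)"
    by (rule Lim_transform_eventually[OF tendsto_const])
       (auto simp: eventually_at_left_field flat_exp_def intro!: exI[of _ "-1"])
  ultimately show ?thesis by (simp add: filterlim_at_split)
qed

text \<open>The powers of \<open>1 / x\<close> make the family closed under differentiation up to
  linear combinations, so the smoothness of all members is a single induction.
  \<open>flat_exp 0\<close> is the classical flat function.\<close>

lemma flat_exp_deriv:
  "(flat_exp n has_real_derivative flat_exp (n + 2) x - real n * flat_exp (n + 1) x) (at x)"
proof -
  consider "x < 0" | "x = 0" | "x > 0" by linarith
  then show ?thesis
  proof cases
    case 1
    have "((\<lambda>x. 0) has_real_derivative 0) (at x)" by simp
    then have "(flat_exp n has_real_derivative 0) (at x)"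
      by (rule has_field_derivative_transform_within_open[of _ _ _ "{..<0}"]) (use 1 in \<open>auto simp: flat_exp_def\<close>)
    then show ?thesis using 1 by (simp add: flat_exp_def)
  next
    case 2
    have "(flat_exp n has_real_derivative 0) (at 0)"
      unfolding has_field_derivative_iff
    \<comment> \<open>The difference quotient of \<open>flat_exp n\<close> at \<open>0\<close> is
      \<open>flat_exp (Suc n)\<close> itself.\<close>
    proof (rule Lim_transform_eventually[OF flat_exp_tendsto[of "Suc n"]])
      show "\<forall>\<^sub>F y in at 0. flat_exp (Suc n) y = (flat_exp n y - flat_exp n 0) / (y - 0)"
        by (auto simp: flat_exp_def eventually_at_filter)
    qed
    then show ?thesis using 2 by (simp add: flat_exp_def)
  next
    case 3
    have pow: "m = 0" if "x ^ m \<noteq> x * x ^ (m - Suc 0)" for m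
      using that by (cases m) auto
    have "((\<lambda>x. (1 / x) ^ n * exp (- (1 / x))) has_real_derivative flat_exp (n + 2) x - real n * flat_exp (n + 1) x) (at x)"
      using 3
      using pow by (cases n) (auto intro!: derivative_eq_intros simp: flat_exp_def field_simps power2_eq_square)
    then show ?thesis
      by (rule has_field_derivative_transform_within_open[of _ _ _ "{0<..}"]) (use 3 in \<open>auto simp: flat_exp_def\<close>)
  qed
qed

lemma Ck_flat_exp: "Ck k UNIV (flat_exp n)"
proof (induction k arbitrary: n)
  case 0
  show ?case using DERIV_isCont[OF flat_exp_deriv] by (auto intro: continuous_at_imp_continuous_on)
next
  case (Suc k)
  have "Ck k UNIV (\<lambda>x. flat_exp (n + 2) x + (- real n) * flat_exp (n + 1) x)"
    by (intro Ck_add Ck_mult open_UNIV Suc Ck_const)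
  then show ?case by (intro Ck_real_Suc[OF open_UNIV flat_exp_deriv]) simp
qed

text \<open>Used in three roles: as a change of time that rests outside (0, 1), as the profile of
  radial cutoffs, and through its derivative as a one-dimensional bump with an explicit
  primitive.\<close>

definition smooth_step :: "real \<Rightarrow> real" where
  "smooth_step x = flat_exp 0 x * inverse (flat_exp 0 x + flat_exp 0 (1 - x))"

lemma smooth_step_denominator_pos: "flat_exp 0 x + flat_exp 0 (1 - x) > 0"
  by (cases "x > 0"; cases "x < 1") (auto simp: flat_exp_def add_pos_pos)

lemma Ck_smooth_step: "Ck k UNIV smooth_step"
proof -
  have "Ck k UNIV (\<lambda>x. flat_exp 0 (1 - x))"
  proof (rule Ck_compose[OF open_UNIV _ Ck_flat_exp open_UNIV])
    have "Ck k UNIV (\<lambda>x. 1 + (-1) * x :: real)"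
      by (intro Ck_add Ck_mult Ck_const open_UNIV Ck_bounded_linear bounded_linear_ident)
    then show "Ck k UNIV (\<lambda>x. 1 - x :: real)" by simp
  qed simp
  then have "Ck k UNIV (\<lambda>x. flat_exp 0 x * inverse (flat_exp 0 x + flat_exp 0 (1 - x)))"
    using smooth_step_denominator_pos
    by (intro Ck_mult Ck_inverse Ck_add open_UNIV Ck_flat_exp) (auto simp: less_le)
  then show ?thesis by (simp add: smooth_step_def[abs_def])
qed

lemma smooth_step_le_0 [simp]: "x \<le> 0 \<Longrightarrow> smooth_step x = 0"
  by (simp add: smooth_step_def flat_exp_def)

lemma smooth_step_ge_1 [simp]: "x \<ge> 1 \<Longrightarrow> smooth_step x = 1"
  by (simp add: smooth_step_def flat_exp_def)

lemma smooth_step_deriv: "(smooth_step has_real_derivative deriv smooth_step x) (at x)"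
  using Ck_differentiable[OF Ck_smooth_step[of "Suc 0"], of x] DERIV_deriv_iff_real_differentiable by blast

lemma Ck_deriv_smooth_step: "Ck k UNIV (deriv smooth_step)"
proof (rule Ck_cong[OF open_UNIV])
  show "Ck k UNIV (\<lambda>x. frechet_derivative smooth_step (at x) 1)"
    using Ck_smooth_step[of "Suc k"] by simp
  show "frechet_derivative smooth_step (at x) 1 = deriv smooth_step x" for x
    using frechet_derivative_eq[of smooth_step "(*) (deriv smooth_step x)" x] smooth_step_deriv[of x]
    by (simp add: has_field_derivative_def)
qed

lemma deriv_smooth_step_pos:
  assumes "0 < x" "x < 1"
  shows "deriv smooth_step x > 0"
proof -
  let ?u = "flat_exp 0 x" and ?v = "flat_exp 0 (1 - x)"
  have pos: "?u > 0" "?v > 0" "flat_exp 2 x > 0" "flat_exp 2 (1 - x) > 0"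
    using assms by (auto simp: flat_exp_def)
  have u: "(flat_exp 0 has_real_derivative flat_exp 2 x) (at x)" for x
    using flat_exp_deriv[of 0 x] by (simp add: numeral_2_eq_2)
  have v: "((\<lambda>x. flat_exp 0 (1 - x)) has_real_derivative - flat_exp 2 (1 - x)) (at x)"
  proof -
    have "((\<lambda>x. 1 - x) has_real_derivative - 1) (at x)"
      by (auto intro!: derivative_eq_intros)
    from DERIV_chain2[OF u this] show ?thesis by simp
  qed
  have "((\<lambda>x. flat_exp 0 x / (flat_exp 0 x + flat_exp 0 (1 - x))) has_real_derivative
     (flat_exp 2 x * (?u + ?v) - ?u * (flat_exp 2 x + - flat_exp 2 (1 - x))) / ((?u + ?v) * (?u + ?v))) (at x)"
    using smooth_step_denominator_pos[of x] by (intro DERIV_divide u v DERIV_add) simp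
  then have "deriv smooth_step x = (flat_exp 2 x * (?u + ?v) - ?u * (flat_exp 2 x + - flat_exp 2 (1 - x))) / ((?u + ?v) * (?u + ?v))"
    by (simp add: smooth_step_def[abs_def] divide_inverse DERIV_imp_deriv)
  \<comment> \<open>In the quotient rule the product of \<open>?u\<close> with its own derivative
    cancels, and two positive terms remain.\<close>
  also have "\<dots> = (flat_exp 2 x * ?v + ?u * flat_exp 2 (1 - x)) / ((?u + ?v) * (?u + ?v))"
    by (simp add: algebra_simps)
  also have "\<dots> > 0"
    using pos by (intro divide_pos_pos add_pos_pos mult_pos_pos)
  finally show ?thesis .
qed

text \<open>At \<open>0\<close> and \<open>1\<close> themselves the continuity of the derivative is
  used; it vanishes on both open outer half-lines.\<close>

lemma deriv_smooth_step_outside: "x \<le> 0 \<or> x \<ge> 1 \<Longrightarrow> deriv smooth_step x = 0"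
proof -
  have cont: "continuous_on UNIV (deriv smooth_step)"
    using Ck_deriv_smooth_step[of 0] by simp
  have neg: "deriv smooth_step x = 0" if "x < 0 \<or> x > 1" for x
  proof -
    have "(smooth_step has_real_derivative 0) (at x)"
    proof (cases "x < 0")
      case True
      have "((\<lambda>x. 0) has_real_derivative 0) (at x)" by simp
      then show ?thesis
        by (rule has_field_derivative_transform_within_open[of _ _ _ "{..<0}"]) (use True in auto)
    next
      case False
      have "((\<lambda>x. 1) has_real_derivative 0) (at x)" by simp
      then show ?thesis
        by (rule has_field_derivative_transform_within_open[of _ _ _ "{1<..}"]) (use False that in auto)
    qed
    then show ?thesis by (rule DERIV_imp_deriv)
  qed
  have "closure {..<0::real} \<subseteq> {x. deriv smooth_step x = 0}" "closure {1<..} \<subseteq> {x. deriv smooth_step x = 0}"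
    by (rule closure_minimal; use neg cont in \<open>auto intro!: closed_Collect_eq\<close>)+
  then show "x \<le> 0 \<or> x \<ge> 1 \<Longrightarrow> deriv smooth_step x = 0" by auto
qed

lemma smooth_step_strict_mono:
  assumes "0 \<le> x" "x < y" "y \<le> 1"
  shows "smooth_step x < smooth_step y"
proof (rule DERIV_pos_imp_increasing_open[OF assms(2)])
  show "\<exists>d. (smooth_step has_real_derivative d) (at z) \<and> d > 0" if "x < z" "z < y" for z
    using smooth_step_deriv[of z] deriv_smooth_step_pos[of z] that assms by force
  show "continuous_on {x..y} smooth_step"
    using Ck_continuous_on[OF Ck_smooth_step] continuous_on_subset by blast
qed

lemma smooth_step_pos: "0 < x \<Longrightarrow> 0 < smooth_step x"
  using smooth_step_strict_mono[of 0 x] by (cases "x \<ge> 1") auto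

lemma smooth_step_less_1: "x < 1 \<Longrightarrow> smooth_step x < 1"
  using smooth_step_strict_mono[of x 1] by (cases "x \<le> 0") auto

lemma smooth_step_bounds: "0 \<le> smooth_step x" "smooth_step x \<le> 1"
  using smooth_step_pos[of x] smooth_step_less_1[of x] smooth_step_le_0[of x] smooth_step_ge_1[of x]
  by linarith+

lemma smooth_step_bij: "bij_betw smooth_step {0<..<1} {0<..<1}"
proof -
  have inj: "inj_on smooth_step {0<..<1}"
  proof (rule linorder_inj_onI')
    fix i j :: real assume "i \<in> {0<..<1}" "j \<in> {0<..<1}" "i < j"
    then show "smooth_step i \<noteq> smooth_step j"
      using smooth_step_strict_mono[of i j] by simp
  qed
  have "y \<in> smooth_step ` {0<..<1}" if "0 < y" "y < 1" for y
  proof -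
    have "\<exists>x. 0 \<le> x \<and> x \<le> 1 \<and> smooth_step x = y"
      by (rule IVT') (use that Ck_continuous_on[OF Ck_smooth_step] continuous_on_subset in auto)
    then obtain x where x: "0 \<le> x" "x \<le> 1" "smooth_step x = y" by blast
    then have "x \<noteq> 0" "x \<noteq> 1" using that by auto
    with x show ?thesis by force
  qed
  with inj show ?thesis
    using smooth_step_pos smooth_step_less_1 unfolding bij_betw_def
    by (metis (no_types, lifting) antisym greaterThanLessThan_iff image_subsetI subsetI)
qed

section \<open>The integral of a compactly supported Jacobian\<close>

definition jac :: "(real^'k \<Rightarrow> real^'k) \<Rightarrow> real^'k \<Rightarrow> real" where
  "jac f x = det (matrix (frechet_derivative f (at x)))"

lemma continuous_on_matrix_derivative:
  fixes h :: "real^'k \<Rightarrow> real^'k"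
  assumes "Ck (Suc 0) U h"
  shows "continuous_on U (\<lambda>x. matrix (frechet_derivative h (at x)) $ i $ j)"
proof -
  have "continuous_on U (\<lambda>x. frechet_derivative h (at x) (axis j 1))"
    using assms by (simp add: axis_in_Basis_iff)
  then show ?thesis
    unfolding matrix_def by (auto intro!: continuous_intros)
qed

lemma continuous_on_det [continuous_intros]:
  fixes A :: "'a::topological_space \<Rightarrow> real^'k^'k"
  assumes "\<And>i j. continuous_on U (\<lambda>x. A x $ i $ j)"
  shows "continuous_on U (\<lambda>x. det (A x))"
  unfolding det_def by (intro continuous_intros assms)

lemma continuous_on_jac:
  assumes "Ck (Suc 0) U h"
  shows "continuous_on U (jac h)"
  unfolding jac_def[abs_def]
  by (intro continuous_on_det continuous_on_matrix_derivative assms)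

text \<open>In the coefficient of \<open>s ^ m\<close> of \<open>det (1 + s A)\<close>, \<open>T\<close> is the set of rows contributed by \<open>s A\<close>.\<close>

definition det_coeff :: "nat \<Rightarrow> real^'k^'k \<Rightarrow> real" where
  "det_coeff m A = (\<Sum>T | card T = m. \<Sum>\<pi> | \<pi> permutes UNIV. of_int (sign \<pi>) *
     ((\<Prod>i\<in>T. A $ i $ \<pi> i) * (\<Prod>i\<in>-T. mat 1 $ i $ \<pi> i)))"

lemma det_mat_1_add_scaleR:
  fixes A :: "real^'k^'k"
  shows "det (mat 1 + s *\<^sub>R A) = (\<Sum>m\<le>CARD('k). det_coeff m A * s ^ m)"
proof -
  let ?c = "\<lambda>T. \<Sum>\<pi> | \<pi> permutes UNIV. of_int (sign \<pi>) *
     ((\<Prod>i\<in>T. A $ i $ \<pi> i) * (\<Prod>i\<in>-T. mat 1 $ i $ \<pi> i))"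
  have "(\<Prod>i\<in>UNIV. (mat 1 + s *\<^sub>R A) $ i $ \<pi> i) =
      (\<Sum>T\<in>UNIV. s ^ card T * ((\<Prod>i\<in>T. A $ i $ \<pi> i) * (\<Prod>i\<in>-T. mat 1 $ i $ \<pi> i)))" for \<pi>
    using prod_add[of "UNIV :: 'k set" "\<lambda>i. s * A $ i $ \<pi> i" "\<lambda>i. mat 1 $ i $ \<pi> i"]
    by (simp add: add.commute prod.distrib Compl_eq_Diff_UNIV mult.assoc)
  then have "det (mat 1 + s *\<^sub>R A) = (\<Sum>T\<in>UNIV. s ^ card T * ?c T)"
    by (simp add: det_def sum_distrib_left sum.swap[of _ _ "{\<pi>. \<pi> permutes UNIV}"] mult.left_commute)
  also have "\<dots> = (\<Sum>m\<le>CARD('k). \<Sum>T | T \<in> UNIV \<and> card T = m. s ^ card T * ?c T)"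
    by (rule sum.group[symmetric]) (auto intro: card_mono)
  also have "\<dots> = (\<Sum>m\<le>CARD('k). det_coeff m A * s ^ m)"
    by (simp add: det_coeff_def sum_distrib_left mult.commute[of _ "s ^ _"])
  finally show ?thesis .
qed

lemma det_coeff_card: "det_coeff CARD('k) A = det A" for A :: "real^'k^'k"
proof -
  have "{T :: 'k set. card T = CARD('k)} = {UNIV}"
    using card_eq_UNIV_imp_eq_UNIV by fastforce
  then show ?thesis by (simp add: det_coeff_def det_def)
qed

lemma continuous_on_det_coeff:
  assumes "\<And>i j. continuous_on U (\<lambda>x. A x $ i $ j)"
  shows "continuous_on U (\<lambda>x. det_coeff m (A x))"
  unfolding det_coeff_def by (intro continuous_intros assms)

text \<open>For \<open>0 \<le> r \<le> s\<close> the map \<open>v + r L v\<close> is injective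
  because \<open>r L v\<close> is shorter than \<open>v\<close>. So the determinant has no zero
  between \<open>r = 0\<close>, where it is \<open>1\<close>, and \<open>r = s\<close>. This removes
  the absolute value from the change of variables formula.\<close>

lemma det_mat_1_add_scaleR_pos:
  fixes L :: "real^'k \<Rightarrow> real^'k"
  assumes "linear L" and C: "\<And>v. norm (L v) \<le> C * norm v" and s: "0 \<le> s" "s * C < 1"
  shows "det (mat 1 + s *\<^sub>R matrix L) > 0"
proof (rule ccontr)
  have nz: "det (mat 1 + r *\<^sub>R matrix L) \<noteq> 0" if r: "0 \<le> r" "r \<le> s" for r
  proof -
    have eq: "(mat 1 + r *\<^sub>R matrix L) *v v = v + r *\<^sub>R L v" for v
      using assms(1) by (simp add: matrix_vector_mult_add_rdistrib scaleR_matrix_vector_assoc[symmetric] matrix_works)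
    have "v = 0" if "v + r *\<^sub>R L v = 0" for v
    proof (rule ccontr)
      assume v: "v \<noteq> 0"
      have "norm v = norm (r *\<^sub>R L v)"
        using that by (metis add_eq_0_iff2 norm_minus_cancel)
      also have "\<dots> \<le> r * (C * norm v)" using r C[of v] by (simp add: mult_left_mono)
      also have "\<dots> = (r * C) * norm v" by simp
      also have "\<dots> < norm v"
      proof -
        have "r * C < 1"
          using r s by (cases "C \<ge> 0") (auto intro: le_less_trans[OF mult_right_mono] simp: mult_nonneg_nonpos not_le less_le_trans[of _ 1] intro: le_less_trans[of _ 0])
        then show ?thesis using v by simp
      qed
      finally show False by simp
    qed
    then have "inj ((*v) (mat 1 + r *\<^sub>R matrix L))"
      using iffD2[OF linear_injective_0[OF matrix_vector_mul_linear[of "mat 1 + r *\<^sub>R matrix L"]]] eq by metis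
    then show ?thesis
      using det_nz_iff_inj[OF matrix_vector_mul_linear, of "mat 1 + r *\<^sub>R matrix L"]
      by (simp only: matrix_of_matrix_vector_mul)
  qed
  assume "\<not> det (mat 1 + s *\<^sub>R matrix L) > 0"
  moreover have "det (mat 1 + 0 *\<^sub>R matrix L) = 1" by simp
  moreover have "continuous_on {0..s} (\<lambda>r. det (mat 1 + r *\<^sub>R matrix L))"
    by (intro continuous_on_det) (auto intro!: continuous_intros)
  ultimately have "\<exists>r\<ge>0. r \<le> s \<and> det (mat 1 + r *\<^sub>R matrix L) = 0"
    using s(1) by (intro IVT2') auto
  with nz show False by blast
qed

text \<open>On \<open>B\<close> compactness bounds the partial derivatives; off \<open>B\<close> the
  map vanishes on an open set, so its derivative is zero.\<close>

lemma compact_support_derivative_bound: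
  fixes h :: "real^'k \<Rightarrow> real^'k"
  assumes h: "Ck (Suc 0) UNIV h" and B: "compact B" "\<And>x. x \<notin> B \<Longrightarrow> h x = 0"
  obtains C where "C \<ge> 0" "\<And>x v. norm (frechet_derivative h (at x) v) \<le> C * norm v"
proof -
  let ?D = "\<lambda>x. frechet_derivative h (at x)"
  have lin: "linear (?D x)" for x
    using h by (intro linear_frechet_derivative) simp
  have "continuous_on B (\<lambda>x. \<Sum>b\<in>Basis. norm (?D x b))"
    using h by (auto intro!: continuous_intros intro: continuous_on_subset)
  then have "bounded ((\<lambda>x. \<Sum>b\<in>Basis. norm (?D x b)) ` B)"
    using B(1) compact_continuous_image compact_imp_bounded by blast
  then obtain C where C: "C > 0" "\<And>x. x \<in> B \<Longrightarrow> \<bar>\<Sum>b\<in>Basis. norm (?D x b)\<bar> \<le> C"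
    unfolding bounded_pos by auto
  have "norm (?D x v) \<le> C * norm v" for x v
  proof (cases "x \<in> B")
    case True
    have "?D x v = ?D x (\<Sum>b\<in>Basis. (v \<bullet> b) *\<^sub>R b)"
      by (simp only: euclidean_representation)
    also have "\<dots> = (\<Sum>b\<in>Basis. (v \<bullet> b) *\<^sub>R ?D x b)"
      by (simp only: linear_sum[OF lin] linear_cmul[OF lin])
    finally have "norm (?D x v) \<le> (\<Sum>b\<in>Basis. norm ((v \<bullet> b) *\<^sub>R ?D x b))"
      using norm_sum by metis
    also have "\<dots> \<le> (\<Sum>b\<in>Basis. norm v * norm (?D x b))"
      by (intro sum_mono) (auto intro!: mult_right_mono Basis_le_norm)
    also have "\<dots> = norm v * (\<Sum>b\<in>Basis. norm (?D x b))" by (simp add: sum_distrib_left)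
    also have "\<dots> \<le> norm v * C"
      using C(2)[OF True] by (intro mult_left_mono) auto
    finally show ?thesis by (simp add: mult.commute)
  next
    case False
    have "frechet_derivative h (at x) = frechet_derivative (\<lambda>x. 0) (at x)"
      by (rule frechet_derivative_cong_open[of "-B"])
         (use False B in \<open>auto simp: open_Compl compact_imp_closed\<close>)
    then show ?thesis using C(1) by (simp add: frechet_derivative_const)
  qed
  with C(1) show ?thesis by (intro that[of C]) auto
qed

text \<open>The contraction estimate gives injectivity, and surjectivity through Banach's fixed
  point theorem for \<open>x \<mapsto> y - s h x\<close>. A bijection that is the identity off
  \<open>B\<close> maps \<open>B\<close> onto itself.\<close>

lemma perturbation_of_identity_image:
  fixes h :: "'a::euclidean_space \<Rightarrow> 'a"
  assumes lip: "\<And>x y. norm (s *\<^sub>R h x - s *\<^sub>R h y) \<le> c * norm (x - y)" and c: "0 \<le> c" "c < 1"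
    and B: "\<And>x. x \<notin> B \<Longrightarrow> h x = 0"
  shows "inj (\<lambda>x. x + s *\<^sub>R h x)" "(\<lambda>x. x + s *\<^sub>R h x) ` B = B"
proof -
  let ?F = "\<lambda>x. x + s *\<^sub>R h x"
  show inj: "inj ?F"
  proof (rule injI, rule ccontr)
    fix x y assume eq: "?F x = ?F y" and "x \<noteq> y"
    then have "norm (x - y) > 0" by simp
    have "x - y = s *\<^sub>R h y - s *\<^sub>R h x" using eq by (simp add: algebra_simps)
    then have "norm (x - y) \<le> c * norm (y - x)" using lip[of y x] by simp
    also have "\<dots> < norm (x - y)"
      using c \<open>norm (x - y) > 0\<close> by (simp add: norm_minus_commute)
    finally show False by simp
  qed
  have surj: "\<exists>x. ?F x = y" for y
  proof -
    have "\<exists>!x. y - s *\<^sub>R h x = x"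
    proof (rule banach_fix_type[OF c], intro allI)
      fix x x' show "dist (y - s *\<^sub>R h x) (y - s *\<^sub>R h x') \<le> c * dist x x'"
        using lip[of x' x] by (simp add: dist_norm norm_minus_commute)
    qed
    then obtain x where "y - s *\<^sub>R h x = x" by blast
    then have "?F x = y" by (simp add: algebra_simps)
    then show ?thesis ..
  qed
  show "?F ` B = B"
  proof (intro equalityI subsetI)
    fix y assume "y \<in> ?F ` B"
    then obtain x where x: "x \<in> B" "y = ?F x" by blast
    show "y \<in> B"
    proof (rule ccontr)
      assume "y \<notin> B"
      then have "?F y = ?F x" using x B by simp
      then have "y = x" using inj by (rule injD[rotated])
      with x \<open>y \<notin> B\<close> show False by simp
    qed
  next
    fix y assume y: "y \<in> B"
    obtain x where x: "?F x = y" using surj by blast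
    have "x \<in> B"
    proof (rule ccontr)
      assume "x \<notin> B"
      then have "x = y" using x B by simp
      with y \<open>x \<notin> B\<close> show False by simp
    qed
    with x show "y \<in> ?F ` B" by blast
  qed
qed

theorem integral_jac_compact_support:
  fixes h :: "real^'k::{finite,wellorder} \<Rightarrow> real^'k::_"
  assumes h: "Ck (Suc 0) UNIV h" and B: "\<And>x. x \<notin> cbox a b \<Longrightarrow> h x = 0"
  shows "integral (cbox a b) (jac h) = 0"
proof -
  let ?B = "cbox a b" and ?n = "CARD('k)"
  let ?D = "\<lambda>x. frechet_derivative h (at x)"
  have der: "(h has_derivative ?D x) (at x)" for x
    using h by (intro has_derivative_frechet) simp
  have lin: "linear (?D x)" for x
    using der has_derivative_linear by blast
  obtain C where C: "C \<ge> 0" "\<And>x v. norm (?D x v) \<le> C * norm v"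
    using compact_support_derivative_bound[OF h compact_cbox B] by metis
  have lip: "norm (h x - h y) \<le> C * norm (x - y)" for x y
  proof (rule differentiable_bound[of UNIV h ?D])
    show "onorm (?D x) \<le> C" for x using C by (intro onorm_bound) auto
  qed (auto intro: der)
  define I where "I m = integral ?B (\<lambda>x. det_coeff m (matrix (?D x)))" for m
  have int: "(\<lambda>x. det_coeff m (matrix (?D x))) integrable_on ?B" for m
    by (intro integrable_continuous continuous_on_det_coeff
        continuous_on_subset[OF continuous_on_matrix_derivative[OF h]]) auto
  have eq: "(\<Sum>m\<le>?n. I m * s ^ m) = measure lebesgue ?B" if s: "0 \<le> s" "s * C < 1" for s
  proof -
    let ?F = "\<lambda>x. x + s *\<^sub>R h x"
    have F: "inj ?F" "?F ` ?B = ?B"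
    proof -
      have "norm (s *\<^sub>R h x - s *\<^sub>R h y) \<le> (s * C) * norm (x - y)" for x y
        using mult_left_mono[OF lip[of x y] s(1)] s(1)
        by (simp add: scaleR_diff_right[symmetric] mult.assoc)
      then show "inj ?F" "?F ` ?B = ?B"
        using perturbation_of_identity_image[of s h "s * C" ?B] s C(1) B by auto
    qed
    have derF: "(?F has_derivative (\<lambda>v. v + s *\<^sub>R ?D x v)) (at x within ?B)" for x
      by (rule has_derivative_add[OF has_derivative_ident has_derivative_scaleR_right[OF has_derivative_at_withinI[OF der]]])
    have mF: "matrix (\<lambda>v. v + s *\<^sub>R ?D x v) = mat 1 + s *\<^sub>R matrix (?D x)" for x
      unfolding matrix_def vec_eq_iff mat_def axis_def by simp
    have "((\<lambda>x. \<bar>det (matrix (\<lambda>v. v + s *\<^sub>R ?D x v))\<bar>) has_integral measure lebesgue ?B) ?B"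
      using has_measure_differentiable_image[of ?B ?F "\<lambda>x v. v + s *\<^sub>R ?D x v" "measure lebesgue ?B"]
        derF F(2) inj_on_subset[OF F(1) subset_UNIV[of ?B]] by simp
    moreover have "\<bar>det (matrix (\<lambda>v. v + s *\<^sub>R ?D x v))\<bar> = (\<Sum>m\<le>?n. det_coeff m (matrix (?D x)) * s ^ m)" for x
      using det_mat_1_add_scaleR_pos[OF lin C(2) s, of x] unfolding mF det_mat_1_add_scaleR by simp
    ultimately have "((\<lambda>x. \<Sum>m\<le>?n. det_coeff m (matrix (?D x)) * s ^ m) has_integral measure lebesgue ?B) ?B"
      by simp
    moreover have "((\<lambda>x. \<Sum>m\<le>?n. det_coeff m (matrix (?D x)) * s ^ m) has_integral (\<Sum>m\<le>?n. I m * s ^ m)) ?B"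
      unfolding I_def by (intro has_integral_sum has_integral_mult_left integrable_integral int) auto
    ultimately show ?thesis using has_integral_unique by blast
  qed
  \<comment> \<open>The polynomial minus its constant value, so that all small \<open>s\<close>
    become roots.\<close>
  define c where "c m = (if m = 0 then I 0 - measure lebesgue ?B else I m)" for m
  have c: "(\<Sum>m\<le>?n. c m * s ^ m) = (\<Sum>m\<le>?n. I m * s ^ m) - measure lebesgue ?B" for s
  proof -
    have "(\<Sum>m\<le>?n. c m * s ^ m) = (\<Sum>m\<le>?n. I m * s ^ m - (if m = 0 then measure lebesgue ?B else 0))"
      by (rule sum.cong) (auto simp: c_def)
    then show ?thesis by (simp add: sum_subtractf)
  qed
  \<comment> \<open>With \<open>C + 1\<close> in place of \<open>C\<close> the right end also makes
    sense for \<open>C = 0\<close>, and \<open>s * C < 1\<close> is strict.\<close>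
  have "{0..1 / (C + 1)} \<subseteq> {s. (\<Sum>m\<le>?n. c m * s ^ m) = 0}"
  proof
    fix s assume s: "s \<in> {0..1 / (C + 1)}"
    then have "s * (C + 1) \<le> 1" using C(1) by (simp add: field_simps)
    then have "s * C < 1" using s C(1) by (cases "s = 0") (auto simp: algebra_simps)
    with eq[of s] s show "s \<in> {s. (\<Sum>m\<le>?n. c m * s ^ m) = 0}" by (simp add: c)
  qed
  moreover have "infinite {0..1 / (C + 1)}"
    using C(1) by (simp add: infinite_Icc)
  ultimately have "infinite {s. (\<Sum>m\<le>?n. c m * s ^ m) = 0}"
    using finite_subset by blast
  then have "c ?n = 0"
    using Transcendental.polyfun_finite_roots[of c ?n] by blast
  \<comment> \<open>\<open>CARD('k)\<close> is positive, so the leading coefficient is not the one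
    from which the volume was subtracted.\<close>
  then have "I ?n = 0" by (simp add: c_def)
  then show ?thesis by (simp add: I_def det_coeff_card jac_def[abs_def])
qed

section \<open>Jacobians, cutoffs and change of variables\<close>

lemma jac_cong_open:
  assumes "open S" "x \<in> S" "\<And>y. y \<in> S \<Longrightarrow> f y = g y"
  shows "jac f x = jac g x"
  unfolding jac_def using frechet_derivative_cong_open[OF assms] by simp

lemma jac_compose:
  fixes f g :: "real^'k \<Rightarrow> real^'k"
  assumes "f differentiable (at (g x))" "g differentiable (at x)"
  shows "jac (f \<circ> g) x = jac f (g x) * jac g x"
proof -
  have "frechet_derivative (f \<circ> g) (at x) = frechet_derivative f (at (g x)) \<circ> frechet_derivative g (at x)"
    by (rule frechet_derivative_eq) (intro diff_chain_at has_derivative_frechet assms)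
  then show ?thesis
    using assms unfolding jac_def
    by (simp add: matrix_compose linear_frechet_derivative det_mul)
qed

text \<open>The language for exact forms: the Jacobian of \<open>set_row b (g x) (f x)\<close> is
  the coefficient of the product of the differentials \<open>df_j\<close> with \<open>dg\<close> in
  place \<open>b\<close>. Up to sign this is the exterior derivative of \<open>g\<close> times the
  product of the other \<open>df_j\<close>.\<close>

definition set_row :: "'k \<Rightarrow> real \<Rightarrow> real^'k \<Rightarrow> real^'k" where
  "set_row b t v = (\<chi> j. if j = b then t else v $ j)"

lemma set_row_nth [simp]: "set_row b t v $ j = (if j = b then t else v $ j)"
  by (simp add: set_row_def)

lemma Ck_set_row:
  assumes "open U" "Ck k U g" "Ck k U f"
  shows "Ck k U (\<lambda>x. set_row b (g x) (f x))"
  unfolding set_row_def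
proof (rule Ck_vec[OF assms(1)])
  show "Ck k U (\<lambda>x. if j = b then g x else f x $ j)" for j
    using assms(2) Ck_nth[OF assms(1,3)] by (cases "j = b") simp_all
qed

lemma has_derivative_set_row:
  assumes "(g has_derivative g') (at x)" "(f has_derivative f') (at x)"
  shows "((\<lambda>x. set_row b (g x) (f x)) has_derivative (\<lambda>h. set_row b (g' h) (f' h))) (at x)"
proof -
  have eq: "set_row b t v = v + (t - v $ b) *\<^sub>R axis b 1" for t v
    by (auto simp: vec_eq_iff axis_def)
  show ?thesis
    unfolding eq
    by (intro has_derivative_add has_derivative_scaleR_left has_derivative_diff assms
        bounded_linear.has_derivative[OF bounded_linear_vec_nth])
qed

lemma jac_set_row:
  assumes "g differentiable (at x)" "f differentiable (at x)"
  shows "jac (\<lambda>x. set_row b (g x) (f x)) x =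
    det (\<chi> i. if i = b then (\<chi> j. frechet_derivative g (at x) (axis j 1))
             else row i (matrix (frechet_derivative f (at x))))"
proof -
  have "frechet_derivative (\<lambda>x. set_row b (g x) (f x)) (at x) =
    (\<lambda>h. set_row b (frechet_derivative g (at x) h) (frechet_derivative f (at x) h))"
    by (intro frechet_derivative_eq has_derivative_set_row has_derivative_frechet assms)
  then show ?thesis
    unfolding jac_def
    by (intro arg_cong[where f = det]) (simp add: vec_eq_iff matrix_def row_def)
qed

text \<open>Linearity of the determinant in row \<open>b\<close>. It lets a partition of unity act
  on the primitive \<open>g\<close> of an exact form.\<close>

lemma jac_set_row_sum:
  assumes "finite P" "\<And>p. p \<in> P \<Longrightarrow> g p differentiable (at x)" "f differentiable (at x)"
  shows "jac (\<lambda>x. set_row b (\<Sum>p\<in>P. g p x) (f x)) x = (\<Sum>p\<in>P. jac (\<lambda>x. set_row b (g p x) (f x)) x)"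
proof -
  have d: "((\<lambda>x. \<Sum>p\<in>P. g p x) has_derivative (\<lambda>h. \<Sum>p\<in>P. frechet_derivative (g p) (at x) h)) (at x)"
    by (intro has_derivative_sum has_derivative_frechet assms)
  then have diff: "(\<lambda>x. \<Sum>p\<in>P. g p x) differentiable (at x)"
    by (auto simp: differentiable_def)
  have "(\<chi> j. \<Sum>p\<in>P. frechet_derivative (g p) (at x) (axis j 1)) =
    (\<Sum>p\<in>P. \<chi> j. frechet_derivative (g p) (at x) (axis j 1))"
    by (simp add: vec_eq_iff)
  then have "jac (\<lambda>x. set_row b (\<Sum>p\<in>P. g p x) (f x)) x =
    (\<Sum>p\<in>P. det (\<chi> i. if i = b then (\<chi> j. frechet_derivative (g p) (at x) (axis j 1))
             else row i (matrix (frechet_derivative f (at x)))))"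
    unfolding jac_set_row[OF diff assms(3)] frechet_derivative_eq[OF d]
    by (simp only: det_linear_row_sum[OF assms(1)])
  also have "\<dots> = (\<Sum>p\<in>P. jac (\<lambda>x. set_row b (g p x) (f x)) x)"
    by (rule sum.cong) (simp_all add: jac_set_row assms)
  finally show ?thesis .
qed

text \<open>The matrix is the identity with row \<open>b\<close> replaced by the gradient of
  \<open>g\<close>, so only the diagonal entry of that row survives. In terms of forms: the
  derivative of \<open>g\<close> times the product of all \<open>dy_j\<close> with
  \<open>j \<noteq> b\<close> sees the partial derivative in direction \<open>b\<close>
  alone.\<close>

lemma jac_set_row_id:
  fixes g :: "real^'k \<Rightarrow> real"
  assumes "g differentiable (at x)"
  shows "jac (\<lambda>y. set_row b (g y) y) x = frechet_derivative g (at x) (axis b 1)"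
proof -
  let ?I = "mat 1 :: real^'k^'k"
  let ?v = "\<chi> j. frechet_derivative g (at x) (axis j 1)"
  have row: "row i ?I = (axis i 1 :: real^'k)" for i
    by (auto simp: row_def mat_def axis_def vec_eq_iff)
  have id: "frechet_derivative (\<lambda>y. y) (at x) = id"
    by (rule frechet_derivative_eq) (auto intro!: derivative_eq_intros simp: id_def)
  have "(\<Sum>i\<in>UNIV. ?v $ i *s row i ?I) = ?v"
    unfolding row by (rule basis_expansion)
  then have "jac (\<lambda>y. set_row b (g y) y) x =
    det (\<chi> i. if i = b then (\<Sum>i\<in>UNIV. ?v $ i *s row i ?I) else row i ?I)"
    by (simp only: jac_set_row[OF assms differentiable_ident] id matrix_id_mat_1)
  also have "\<dots> = ?v $ b * det ?I"
    by (rule cramer_lemma_transpose[of b ?v ?I])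
  finally show ?thesis by simp
qed

text \<open>A row of the derivative vanishes. Hence a single component of a map already controls the
  support of its Jacobian.\<close>

lemma jac_zero_component:
  assumes "open S" "x \<in> S" "\<And>y. y \<in> S \<Longrightarrow> f y $ b = 0" "f differentiable (at x)"
  shows "jac f x = 0"
proof -
  have "jac f x = jac (\<lambda>y. set_row b 0 (f y)) x"
    by (rule jac_cong_open[OF assms(1,2)]) (use assms(3) in \<open>auto simp: vec_eq_iff\<close>)
  also have "\<dots> = 0"
  proof -
    have "row b (\<chi> i. if i = b then (\<chi> j. frechet_derivative (\<lambda>x. 0 :: real) (at x) (axis j 1))
             else row i (matrix (frechet_derivative f (at x)))) = 0"
      by (simp add: frechet_derivative_const vec_eq_iff row_def)
    then show ?thesis
      unfolding jac_set_row[OF differentiable_const assms(4)] by (rule det_zero_row(1))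
  qed
  finally show ?thesis .
qed

text \<open>The squared norm keeps the argument smooth at the centre. The argument is at least
  \<open>3\<close> up to radius \<open>r\<close> and at most \<open>0\<close> from radius
  \<open>2 * r\<close> on.\<close>

definition ball_bump :: "'a::euclidean_space \<Rightarrow> real \<Rightarrow> 'a \<Rightarrow> real" where
  "ball_bump a r y = smooth_step (4 - ((y - a) \<bullet> (y - a)) / r\<^sup>2)"

lemma Ck_ball_bump: "Ck k UNIV (ball_bump a r)"
proof -
  have "Ck k UNIV (\<lambda>y. 4 + (- (1 / r\<^sup>2)) * ((y + (- a)) \<bullet> (y + (- a))))"
    by (intro Ck_add Ck_mult Ck_inner Ck_const open_UNIV Ck_bounded_linear bounded_linear_ident)
  then have "Ck k UNIV (\<lambda>y. 4 - ((y - a) \<bullet> (y - a)) / r\<^sup>2)" by simp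
  then show ?thesis
    unfolding ball_bump_def[abs_def] by (rule Ck_compose[OF open_UNIV _ Ck_smooth_step open_UNIV]) simp
qed

lemma ball_bump_nonneg: "0 \<le> ball_bump a r y"
  by (simp add: ball_bump_def smooth_step_bounds)

lemma ball_bump_eq_1:
  assumes "r > 0" "dist a y < r"
  shows "ball_bump a r y = 1"
proof -
  have "(y - a) \<bullet> (y - a) = (dist a y)\<^sup>2"
    unfolding dist_commute[of a] by (simp only: dist_norm power2_norm_eq_inner)
  also have "\<dots> \<le> r\<^sup>2" using assms by (intro power_mono) auto
  finally have "((y - a) \<bullet> (y - a)) / r\<^sup>2 \<le> 1" using assms by (simp add: field_simps)
  then show ?thesis by (simp add: ball_bump_def)
qed

lemma ball_bump_eq_0:
  assumes "r > 0" "y \<notin> cball a (2 * r)"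
  shows "ball_bump a r y = 0"
proof -
  have "(2 * r)\<^sup>2 \<le> (dist a y)\<^sup>2" using assms by (intro power_mono) auto
  also have "\<dots> = (y - a) \<bullet> (y - a)"
    unfolding dist_commute[of a] by (simp only: dist_norm power2_norm_eq_inner)
  finally have "((y - a) \<bullet> (y - a)) / r\<^sup>2 \<ge> 4" using assms by (simp add: field_simps)
  then show ?thesis by (simp add: ball_bump_def)
qed

text \<open>One minus a finite product of factors \<open>1 - bump\<close> is \<open>1\<close> where
  some bump is \<open>1\<close> and \<open>0\<close> where all bumps vanish. The value
  \<open>1\<close> is attained on an open set around \<open>K\<close>, so that the cutoff does not
  affect derivatives at points of \<open>K\<close>.\<close>

lemma smooth_cutoff:
  fixes K W :: "'a::euclidean_space set"
  assumes "compact K" "open W" "K \<subseteq> W"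
  obtains \<kappa> N L where "\<And>k. Ck k UNIV \<kappa>" "open N" "K \<subseteq> N" "\<And>y. y \<in> N \<Longrightarrow> \<kappa> y = (1::real)"
    "compact L" "L \<subseteq> W" "\<And>y. y \<notin> L \<Longrightarrow> \<kappa> y = 0"
proof -
  have "\<exists>r>0. cball x (2 * r) \<subseteq> W" if "x \<in> K" for x
  proof -
    have "x \<in> W" using assms(3) that by (rule subsetD)
    then obtain e where "e > 0" "cball x e \<subseteq> W"
      using assms(2) unfolding open_contains_cball by auto
    then show ?thesis by (intro exI[of _ "e / 2"]) auto
  qed
  then obtain r where r: "\<And>x. x \<in> K \<Longrightarrow> r x > 0 \<and> cball x (2 * r x) \<subseteq> W" by metis
  obtain P where P: "P \<subseteq> K" "finite P" "K \<subseteq> (\<Union>x\<in>P. ball x (r x))"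
  proof (rule compactE_image[OF assms(1), of K "\<lambda>x. ball x (r x)"])
    show "K \<subseteq> (\<Union>x\<in>K. ball x (r x))" using r by force
  qed auto
  let ?\<kappa> = "\<lambda>y. 1 + (-1) * (\<Prod>x\<in>P. 1 + (-1) * ball_bump x (r x) y)"
  show ?thesis
  proof (rule that[of ?\<kappa> "\<Union>x\<in>P. ball x (r x)" "\<Union>x\<in>P. cball x (2 * r x)"])
    show "Ck k UNIV ?\<kappa>" for k
      by (intro Ck_add Ck_mult Ck_prod Ck_const open_UNIV Ck_ball_bump)
    show "?\<kappa> y = 1" if "y \<in> (\<Union>x\<in>P. ball x (r x))" for y
    proof -
      from that obtain x where x: "x \<in> P" "dist x y < r x" by auto
      then have "1 + (-1) * ball_bump x (r x) y = 0"
        using ball_bump_eq_1[of "r x" x y] r P by auto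
      then have "(\<Prod>x\<in>P. 1 + (-1) * ball_bump x (r x) y) = 0"
        using x(1) P(2) by (intro prod_zero) auto
      then show ?thesis by simp
    qed
    show "?\<kappa> y = 0" if "y \<notin> (\<Union>x\<in>P. cball x (2 * r x))" for y
    proof -
      have "(\<Prod>x\<in>P. 1 + (-1) * ball_bump x (r x) y) = 1"
        using that r P(1) by (intro prod.neutral ballI) (auto simp: ball_bump_eq_0 subset_iff)
      then show ?thesis by simp
    qed
  qed (use P r in \<open>auto intro!: compact_UN\<close>)
qed

lemma continuous_compact_support_integrable:
  fixes f :: "'a::euclidean_space \<Rightarrow> real"
  assumes "continuous_on UNIV f" "compact L" "\<And>y. y \<notin> L \<Longrightarrow> f y = 0"
  shows "f absolutely_integrable_on UNIV" "f integrable_on UNIV"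
proof -
  obtain a b where ab: "L \<subseteq> cbox a b"
    using bounded_subset_cbox_symmetric compact_imp_bounded assms(2) by metis
  have "f absolutely_integrable_on cbox a b"
    by (intro absolutely_integrable_continuous continuous_on_subset[OF assms(1)]) auto
  then have "(\<lambda>y. if y \<in> cbox a b then f y else 0) absolutely_integrable_on UNIV"
    by (simp only: absolutely_integrable_restrict_UNIV)
  moreover have "(\<lambda>y. if y \<in> cbox a b then f y else 0) = f"
    using ab assms(3) by (auto simp: fun_eq_iff)
  ultimately show "f absolutely_integrable_on UNIV" by simp
  then show "f integrable_on UNIV"
    using set_lebesgue_integral_eq_integral(1) by blast
qed

text \<open>The theorem for vector-valued integrands, read in \<open>real ^ 1\<close>.\<close>

lemma integral_change_of_variables_scalar:
  fixes f :: "real^'k::{finite,wellorder} \<Rightarrow> real" and g :: "real^'k::_ \<Rightarrow> real^'k::_"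
  assumes "S \<in> sets lebesgue" "\<And>x. x \<in> S \<Longrightarrow> (g has_derivative g' x) (at x within S)"
    "inj_on g S" "f absolutely_integrable_on g ` S"
  shows "integral S (\<lambda>x. \<bar>det (matrix (g' x))\<bar> * f (g x)) = integral (g ` S) f"
proof -
  let ?F = "\<lambda>x. vec (f x) :: real^1"
  let ?H = "\<lambda>x. \<bar>det (matrix (g' x))\<bar> *\<^sub>R ?F (g x)"
  have F: "?F absolutely_integrable_on g ` S"
    using assms(4) by (simp add: absolutely_integrable_on_1_iff)
  note cv = has_absolute_integral_change_of_variables[OF assms(1-3), of ?F "integral (g ` S) ?F"]
  have "integral (g ` S) ?F = vec (integral (g ` S) f)"
    using F absolutely_integrable_on_def integral_on_1_eq[of "g ` S" ?F] by (simp add: vec_eq_iff)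
  moreover have "integral S ?H = vec (integral S (\<lambda>x. \<bar>det (matrix (g' x))\<bar> * f (g x)))"
    using integral_on_1_eq[of S ?H] by simp
  ultimately show ?thesis using cv F by (simp add: vec_eq_iff)
qed

section \<open>Densities on compact sets with oriented charts\<close>

text \<open>\<open>X\<close> is a compact subset with relatively open chart domains, not a whole
  type, because the source of a degree is N x S^1 with the circle sitting in the plane. The inverse
  charts \<open>\<psi>\<close> are parameters so that charts may be composed with the coordinate map
  \<open>to_vec\<close>.\<close>

locale oriented_charts =
  fixes X :: "'x::t2_space set" and I :: "'i set" and U :: "'i \<Rightarrow> 'x set"
    and \<phi> :: "'i \<Rightarrow> 'x \<Rightarrow> real^'k::{finite,wellorder}" and \<psi> :: "'i \<Rightarrow> real^'k::_ \<Rightarrow> 'x"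
  assumes compact_X: "compact X"
    and cover: "X \<subseteq> (\<Union>i\<in>I. U i)"
    and chart_openin: "i \<in> I \<Longrightarrow> openin (top_of_set X) (U i)"
    and chart_open: "i \<in> I \<Longrightarrow> open (\<phi> i ` U i)"
    and chart_homeo: "i \<in> I \<Longrightarrow> homeomorphism (U i) (\<phi> i ` U i) (\<phi> i) (\<psi> i)"
    and trans_C1: "i \<in> I \<Longrightarrow> j \<in> I \<Longrightarrow> Ck (Suc 0) (\<phi> i ` (U i \<inter> U j)) (\<phi> j \<circ> \<psi> i)"
    and trans_pos: "i \<in> I \<Longrightarrow> j \<in> I \<Longrightarrow> x \<in> U i \<Longrightarrow> x \<in> U j \<Longrightarrow> jac (\<phi> j \<circ> \<psi> i) (\<phi> i x) > 0"
begin

lemma inv_chart [simp]: "i \<in> I \<Longrightarrow> x \<in> U i \<Longrightarrow> \<psi> i (\<phi> i x) = x"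
  using chart_homeo homeomorphism_apply1 by metis

lemma chart_subset: "i \<in> I \<Longrightarrow> U i \<subseteq> X"
  using chart_openin openin_imp_subset by blast

lemma chart_inj: "i \<in> I \<Longrightarrow> inj_on (\<phi> i) (U i)"
  by (rule inj_on_inverseI[of _ "\<psi> i"]) simp

lemma chart_continuous: "i \<in> I \<Longrightarrow> continuous_on (U i) (\<phi> i)"
  using chart_homeo homeomorphism_def by metis

lemma inv_chart_continuous: "i \<in> I \<Longrightarrow> continuous_on (\<phi> i ` U i) (\<psi> i)"
  using chart_homeo homeomorphism_def by metis

lemma openin_Int_subset: "openin (top_of_set X) A \<Longrightarrow> B \<subseteq> X \<Longrightarrow> openin (top_of_set B) (B \<inter> A)"
  by (auto simp: openin_open)

lemma chart_image_open:
  assumes "i \<in> I" "openin (top_of_set X) A"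
  shows "open (\<phi> i ` (U i \<inter> A))"
proof -
  have "openin (top_of_set (U i)) (U i \<inter> A)"
    using openin_Int_subset[OF assms(2) chart_subset[OF assms(1)]] .
  then have "openin (top_of_set (\<phi> i ` U i)) (\<phi> i ` (U i \<inter> A))"
    by (rule homeomorphism_imp_open_map[OF chart_homeo[OF assms(1)]])
  then show ?thesis
    using chart_open[OF assms(1)] by (rule openin_open_trans)
qed

lemma chart_image_open_Int:
  "i \<in> I \<Longrightarrow> j \<in> I \<Longrightarrow> openin (top_of_set X) A \<Longrightarrow> open (\<phi> i ` (U i \<inter> U j \<inter> A))"
  using chart_image_open[of i "U j \<inter> A"] chart_openin by (simp add: Int_assoc openin_Int)

lemma inv_chart_image: "i \<in> I \<Longrightarrow> \<psi> i ` \<phi> i ` U i \<subseteq> U i"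
  by auto

lemma chart_mem_image: "i \<in> I \<Longrightarrow> x \<in> U i \<Longrightarrow> B \<subseteq> U i \<Longrightarrow> \<phi> i x \<in> \<phi> i ` B \<longleftrightarrow> x \<in> B"
  by (rule inj_on_image_mem_iff[OF chart_inj])

lemma compact_closedin: "compact K \<Longrightarrow> openin (top_of_set X) (X - K)"
  by (simp add: Diff_eq openin_open_Int compact_imp_closed open_Compl)

text \<open>The relatively open set \<open>A\<close> is part of the notion because a map into a
  manifold can be read in a target chart only over an open part of the source.\<close>

definition C1_in :: "'x set \<Rightarrow> ('x \<Rightarrow> 'b::euclidean_space) \<Rightarrow> bool" where
  "C1_in A G \<longleftrightarrow> openin (top_of_set X) A \<and> (\<forall>i\<in>I. Ck (Suc 0) (\<phi> i ` (U i \<inter> A)) (G \<circ> \<psi> i))"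

text \<open>The coefficient in the chart \<open>i\<close> of the standard volume form pulled back by
  \<open>G\<close>.\<close>

definition jacX :: "('x \<Rightarrow> (real, 'k) vec) \<Rightarrow> 'i \<Rightarrow> 'x \<Rightarrow> real" where
  "jacX G i x = jac (G \<circ> \<psi> i) (\<phi> i x)"

lemma C1_in_openin: "C1_in A G \<Longrightarrow> openin (top_of_set X) A"
  by (simp add: C1_in_def)

lemma C1_in_Ck: "C1_in A G \<Longrightarrow> i \<in> I \<Longrightarrow> Ck (Suc 0) (\<phi> i ` (U i \<inter> A)) (G \<circ> \<psi> i)"
  by (simp add: C1_in_def del: Ck.simps)

lemma C1_in_differentiable:
  "C1_in A G \<Longrightarrow> i \<in> I \<Longrightarrow> x \<in> U i \<Longrightarrow> x \<in> A \<Longrightarrow> (G \<circ> \<psi> i) differentiable (at (\<phi> i x))"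
  using C1_in_Ck[of A G i] Ck_differentiable[of 0 "\<phi> i ` (U i \<inter> A)" "G \<circ> \<psi> i"] by blast

lemma C1_in_subset: "C1_in A G \<Longrightarrow> openin (top_of_set X) B \<Longrightarrow> B \<subseteq> A \<Longrightarrow> C1_in B G"
  unfolding C1_in_def by (blast intro: Ck_subset)

lemma C1_in_cong:
  assumes "C1_in A G" "\<And>x. x \<in> A \<Longrightarrow> G x = H x"
  shows "C1_in A H"
  unfolding C1_in_def
proof (intro conjI ballI)
  show "openin (top_of_set X) A" using assms(1) by (rule C1_in_openin)
  fix i assume i: "i \<in> I"
  show "Ck (Suc 0) (\<phi> i ` (U i \<inter> A)) (H \<circ> \<psi> i)"
    by (rule Ck_cong[OF chart_image_open[OF i C1_in_openin[OF assms(1)]] _ C1_in_Ck[OF assms(1) i]])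
       (use i assms(2) in auto)
qed

lemma C1_in_Un:
  assumes "C1_in A G" "C1_in B G"
  shows "C1_in (A \<union> B) G"
  unfolding C1_in_def
proof (intro conjI ballI)
  show "openin (top_of_set X) (A \<union> B)" using assms by (intro openin_Un C1_in_openin)
  fix i assume i: "i \<in> I"
  show "Ck (Suc 0) (\<phi> i ` (U i \<inter> (A \<union> B))) (G \<circ> \<psi> i)"
  proof (rule Ck_local)
    fix y assume "y \<in> \<phi> i ` (U i \<inter> (A \<union> B))"
    then have "y \<in> \<phi> i ` (U i \<inter> A) \<or> y \<in> \<phi> i ` (U i \<inter> B)" by blast
    then show "\<exists>V. open V \<and> y \<in> V \<and> Ck (Suc 0) V (G \<circ> \<psi> i)"
      using chart_image_open[OF i C1_in_openin[OF assms(1)]] chart_image_open[OF i C1_in_openin[OF assms(2)]]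
        C1_in_Ck[OF assms(1) i] C1_in_Ck[OF assms(2) i] by blast
  qed
qed

lemma C1_in_compose:
  assumes "C1_in A G" "Ck (Suc 0) W H" "open W" "G ` A \<subseteq> W"
  shows "C1_in A (\<lambda>x. H (G x))"
  unfolding C1_in_def
proof (intro conjI ballI)
  show "openin (top_of_set X) A" using assms(1) by (rule C1_in_openin)
  fix i assume i: "i \<in> I"
  have "Ck (Suc 0) (\<phi> i ` (U i \<inter> A)) (\<lambda>y. H ((G \<circ> \<psi> i) y))"
    by (rule Ck_compose[OF chart_image_open[OF i C1_in_openin[OF assms(1)]] C1_in_Ck[OF assms(1) i] assms(2,3)])
       (use i assms(4) in auto)
  then show "Ck (Suc 0) (\<phi> i ` (U i \<inter> A)) ((\<lambda>x. H (G x)) \<circ> \<psi> i)" by (simp only: o_def)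
qed

lemma C1_in_Pair:
  assumes "C1_in A G" "C1_in A H"
  shows "C1_in A (\<lambda>x. (G x, H x))"
  unfolding C1_in_def
proof (intro conjI ballI)
  show "openin (top_of_set X) A" using assms(1) by (rule C1_in_openin)
  fix i assume i: "i \<in> I"
  have "Ck (Suc 0) (\<phi> i ` (U i \<inter> A)) (\<lambda>y. ((G \<circ> \<psi> i) y, (H \<circ> \<psi> i) y))"
    by (rule Ck_Pair[OF chart_image_open[OF i C1_in_openin[OF assms(1)]] C1_in_Ck[OF assms(1) i] C1_in_Ck[OF assms(2) i]])
  then show "Ck (Suc 0) (\<phi> i ` (U i \<inter> A)) ((\<lambda>x. (G x, H x)) \<circ> \<psi> i)" by (simp only: o_def)
qed

lemma C1_in_mult:
  fixes f g :: "'x \<Rightarrow> real"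
  assumes "C1_in A f" "C1_in A g"
  shows "C1_in A (\<lambda>x. f x * g x)"
proof -
  have "C1_in A (\<lambda>x. (\<lambda>p. fst p * snd p) (f x, g x))"
    by (rule C1_in_compose[OF C1_in_Pair[OF assms] Ck_mult[OF open_UNIV
        Ck_bounded_linear[OF bounded_linear_fst] Ck_bounded_linear[OF bounded_linear_snd]] open_UNIV]) simp
  then show ?thesis by simp
qed

lemma C1_in_set_row:
  assumes "C1_in A g" "C1_in A f"
  shows "C1_in A (\<lambda>x. set_row b (g x) (f x))"
proof -
  have "C1_in A (\<lambda>x. (\<lambda>p. set_row b (fst p) (snd p)) (g x, f x))"
    by (rule C1_in_compose[OF C1_in_Pair[OF assms] Ck_set_row[OF open_UNIV
        Ck_bounded_linear[OF bounded_linear_fst] Ck_bounded_linear[OF bounded_linear_snd]] open_UNIV]) simp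
  then show ?thesis by simp
qed

lemma C1_in_nth: "C1_in A f \<Longrightarrow> C1_in A (\<lambda>x. f x $ b)"
  by (rule C1_in_compose[OF _ Ck_bounded_linear[OF bounded_linear_vec_nth] open_UNIV]) simp_all

lemma C1_in_sum:
  fixes f :: "'p \<Rightarrow> 'x \<Rightarrow> real"
  assumes "openin (top_of_set X) A" "\<And>p. p \<in> P \<Longrightarrow> C1_in A (f p)"
  shows "C1_in A (\<lambda>x. \<Sum>p\<in>P. f p x)"
  unfolding C1_in_def
proof (intro conjI ballI)
  fix i assume i: "i \<in> I"
  have "Ck (Suc 0) (\<phi> i ` (U i \<inter> A)) (\<lambda>y. \<Sum>p\<in>P. (f p \<circ> \<psi> i) y)"
    by (rule Ck_sum[OF chart_image_open[OF i assms(1)] C1_in_Ck[OF assms(2) i]])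
  then show "Ck (Suc 0) (\<phi> i ` (U i \<inter> A)) ((\<lambda>x. \<Sum>p\<in>P. f p x) \<circ> \<psi> i)" by (simp only: o_def)
qed (rule assms)

lemma C1_in_const: "openin (top_of_set X) A \<Longrightarrow> C1_in A (\<lambda>x. c)"
  unfolding C1_in_def by (simp add: o_def del: Ck.simps)

lemma C1_in_chart: "i \<in> I \<Longrightarrow> C1_in (U i) (\<phi> i)"
  unfolding C1_in_def using chart_openin trans_C1 by (simp del: Ck.simps)

lemma continuous_on_charts:
  assumes A: "A \<subseteq> X" and f: "\<And>i. i \<in> I \<Longrightarrow> continuous_on (U i \<inter> A) f"
  shows "continuous_on A f"
  unfolding continuous_on_eq_continuous_within
proof
  fix x assume x: "x \<in> A"
  then obtain i where i: "i \<in> I" "x \<in> U i" using A cover by blast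
  obtain S where S: "open S" "U i = X \<inter> S"
    using chart_openin[OF i(1)] unfolding openin_open by blast
  have "continuous (at x within U i \<inter> A) f"
    using f[OF i(1)] x i(2) by (simp add: continuous_on_eq_continuous_within)
  moreover have "at x within U i \<inter> A = at x within A"
    by (rule at_within_nhd[of x S]) (use S x i(2) A in auto)
  ultimately show "continuous (at x within A) f" by simp
qed

lemma C1_in_continuous_on:
  assumes "C1_in A G"
  shows "continuous_on A G"
proof (rule continuous_on_charts)
  show "A \<subseteq> X" using assms C1_in_openin openin_imp_subset by blast
  fix i assume i: "i \<in> I"
  have "continuous_on (\<phi> i ` (U i \<inter> A)) (G \<circ> \<psi> i)"
    by (rule Ck_continuous_on[OF C1_in_Ck[OF assms i]])
  then have "continuous_on (U i \<inter> A) ((G \<circ> \<psi> i) \<circ> \<phi> i)"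
    by (rule continuous_on_compose[OF continuous_on_subset[OF chart_continuous[OF i] Int_lower1]])
  then show "continuous_on (U i \<inter> A) G"
    by (rule continuous_on_eq) (use i in auto)
qed

text \<open>The chain rule on an overlap of charts; it supplies the transformation law in
  \<open>is_density\<close>.\<close>

lemma jacX_change:
  assumes "C1_in A G" "i \<in> I" "j \<in> I" "x \<in> U i" "x \<in> U j" "x \<in> A"
  shows "jacX G i x = jacX G j x * jac (\<phi> j \<circ> \<psi> i) (\<phi> i x)"
proof -
  have op: "open (\<phi> i ` (U i \<inter> U j \<inter> A))"
    using assms C1_in_openin chart_image_open_Int by blast
  have "jacX G i x = jac ((G \<circ> \<psi> j) \<circ> (\<phi> j \<circ> \<psi> i)) (\<phi> i x)"
    unfolding jacX_def by (rule jac_cong_open[OF op]) (use assms in auto)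
  also have "\<dots> = jac (G \<circ> \<psi> j) ((\<phi> j \<circ> \<psi> i) (\<phi> i x)) * jac (\<phi> j \<circ> \<psi> i) (\<phi> i x)"
  proof (rule jac_compose)
    show "G \<circ> \<psi> j differentiable at ((\<phi> j \<circ> \<psi> i) (\<phi> i x))"
      using C1_in_differentiable[OF assms(1,3,5,6)] assms by simp
    show "\<phi> j \<circ> \<psi> i differentiable at (\<phi> i x)"
      using C1_in_differentiable[OF C1_in_chart[OF assms(3)] assms(2,4,5)] .
  qed
  finally show ?thesis using assms by (simp add: jacX_def)
qed

lemma jacX_sgn:
  assumes "C1_in A G" "i \<in> I" "j \<in> I" "x \<in> U i" "x \<in> U j" "x \<in> A"
  shows "sgn (jacX G i x) = sgn (jacX G j x)"
  using jacX_change[OF assms] trans_pos[OF assms(2-5)] by (simp add: sgn_mult)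

lemma continuous_on_jacX:
  assumes "C1_in A G" "i \<in> I"
  shows "continuous_on (U i \<inter> A) (jacX G i)"
proof -
  have "continuous_on (\<phi> i ` (U i \<inter> A)) (jac (G \<circ> \<psi> i))"
    by (intro continuous_on_jac C1_in_Ck assms)
  then show ?thesis
    unfolding jacX_def[abs_def]
    by (rule continuous_on_compose2[OF _ continuous_on_subset[OF chart_continuous[OF assms(2)] Int_lower1]]) simp
qed

text \<open>A continuous form of top degree with support in the compact set \<open>K\<close>, given
  by its coefficients in the charts. Transition Jacobians are positive by \<open>trans_pos\<close>,
  so the law without absolute values is that of a form and of a density at the same time.\<close>

definition is_density :: "'x set \<Rightarrow> ('i \<Rightarrow> 'x \<Rightarrow> real) \<Rightarrow> bool" where
  "is_density K w \<longleftrightarrow> compact K \<and> K \<subseteq> X \<and> (\<forall>i\<in>I. continuous_on (U i) (w i)) \<and>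
     (\<forall>i\<in>I. \<forall>j\<in>I. \<forall>x\<in>U i \<inter> U j. w i x = w j x * jac (\<phi> j \<circ> \<psi> i) (\<phi> i x)) \<and>
     (\<forall>i\<in>I. \<forall>x\<in>U i. x \<notin> K \<longrightarrow> w i x = 0)"

definition pullback_density :: "'x set \<Rightarrow> ('x \<Rightarrow> real) \<Rightarrow> ('x \<Rightarrow> (real, 'k) vec) \<Rightarrow> 'i \<Rightarrow> 'x \<Rightarrow> real" where
  "pullback_density A h G i x = (if x \<in> A then h x * jacX G i x else 0)"

text \<open>The extension by zero is continuous because \<open>A\<close> and the complement of
  \<open>K\<close> are relatively open, cover \<open>X\<close>, and the two descriptions agree where
  both apply.\<close>

lemma is_density_pullback:
  assumes G: "C1_in A G" and h: "continuous_on A h" and K: "compact K" "K \<subseteq> A"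
    and z: "\<And>i x. i \<in> I \<Longrightarrow> x \<in> U i \<Longrightarrow> x \<in> A \<Longrightarrow> x \<notin> K \<Longrightarrow> h x * jacX G i x = 0"
  shows "is_density K (pullback_density A h G)"
proof -
  have A: "openin (top_of_set X) A" using G by (rule C1_in_openin)
  then have AX: "A \<subseteq> X" by (rule openin_imp_subset)
  have "continuous_on (U i) (pullback_density A h G i)" if i: "i \<in> I" for i
  proof -
    have 1: "continuous_on (U i \<inter> A) (pullback_density A h G i)"
      by (rule continuous_on_eq[of _ "\<lambda>x. h x * jacX G i x"])
         (auto intro!: continuous_on_mult continuous_on_jacX[OF G i] intro: continuous_on_subset[OF h]
           simp: pullback_density_def)
    have 2: "continuous_on (U i \<inter> (X - K)) (pullback_density A h G i)"
      by (rule continuous_on_eq[of _ "\<lambda>x. 0"]) (use z i in \<open>auto simp: pullback_density_def\<close>)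
    have sub: "U i = (U i \<inter> A) \<union> (U i \<inter> (X - K))"
      using chart_subset[OF i] K(2) by blast
    show ?thesis
    proof (subst sub, rule continuous_on_Un_local_open)
      show "openin (top_of_set (U i \<inter> A \<union> U i \<inter> (X - K))) (U i \<inter> A)"
        using openin_Int_subset[OF A chart_subset[OF i]] sub by metis
      show "openin (top_of_set (U i \<inter> A \<union> U i \<inter> (X - K))) (U i \<inter> (X - K))"
        using openin_Int_subset[OF compact_closedin[OF K(1)] chart_subset[OF i]] sub by metis
    qed (rule 1 2)+
  qed
  moreover have "pullback_density A h G i x = pullback_density A h G j x * jac (\<phi> j \<circ> \<psi> i) (\<phi> i x)"
    if "i \<in> I" "j \<in> I" "x \<in> U i \<inter> U j" for i j x
    using jacX_change[OF G, of i j x] that by (simp add: pullback_density_def)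
  ultimately show ?thesis
    unfolding is_density_def using K AX
  proof (intro conjI ballI impI)
    show "pullback_density A h G i x = 0" if "i \<in> I" "x \<in> U i" "x \<notin> K" for i x
      using z[OF that(1,2) _ that(3)] by (cases "x \<in> A") (simp_all add: pullback_density_def)
  qed blast+
qed

definition chart_integral :: "'i \<Rightarrow> ('x \<Rightarrow> real) \<Rightarrow> real" where
  "chart_integral i f = integral UNIV (\<lambda>y. if y \<in> \<phi> i ` U i then f (\<psi> i y) else 0)"

lemma chart_extension:
  fixes f :: "'x \<Rightarrow> real"
  assumes i: "i \<in> I" and f: "continuous_on (U i) f" and L: "compact L" "L \<subseteq> U i"
    and z: "\<And>x. x \<in> U i \<Longrightarrow> x \<notin> L \<Longrightarrow> f x = 0"
  shows "continuous_on UNIV (\<lambda>y. if y \<in> \<phi> i ` U i then f (\<psi> i y) else 0)" (is "continuous_on _ ?e")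
    and "(\<lambda>y. if y \<in> \<phi> i ` U i then f (\<psi> i y) else 0) absolutely_integrable_on UNIV"
    and "(\<lambda>y. if y \<in> \<phi> i ` U i then f (\<psi> i y) else 0) integrable_on UNIV"
proof -
  have cL: "compact (\<phi> i ` L)"
    using compact_continuous_image[OF continuous_on_subset[OF chart_continuous[OF i] L(2)] L(1)] .
  have 1: "continuous_on (\<phi> i ` U i) ?e"
    by (rule continuous_on_eq[of _ "\<lambda>y. f (\<psi> i y)"])
       (use continuous_on_compose2[OF f inv_chart_continuous[OF i] inv_chart_image[OF i]] in auto)
  have z': "?e y = 0" if "y \<notin> \<phi> i ` L" for y
  proof (cases "y \<in> \<phi> i ` U i")
    case True
    then obtain x where x: "x \<in> U i" "y = \<phi> i x" by blast
    then have "x \<notin> L" using that by blast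
    then show ?thesis using x z i by simp
  qed simp
  have 2: "continuous_on (- \<phi> i ` L) ?e"
    by (rule continuous_on_eq[of _ "\<lambda>y. 0"]) (use z' in auto)
  have "UNIV = \<phi> i ` U i \<union> - \<phi> i ` L" using L(2) by blast
  then show cont: "continuous_on UNIV ?e"
    using continuous_on_open_Un[OF chart_open[OF i] _ 1 2] cL by (simp add: compact_imp_closed open_Compl)
  show "?e absolutely_integrable_on UNIV" "?e integrable_on UNIV"
    using continuous_compact_support_integrable[of ?e "\<phi> i ` L"] cont cL z' by blast+
qed

lemma chart_integral_sum:
  assumes "finite J" "i \<in> I"
    and f: "\<And>j. j \<in> J \<Longrightarrow> continuous_on (U i) (f j) \<and> compact (L j) \<and> L j \<subseteq> U i \<and> (\<forall>x\<in>U i. x \<notin> L j \<longrightarrow> f j x = 0)"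
  shows "chart_integral i (\<lambda>x. \<Sum>j\<in>J. f j x) = (\<Sum>j\<in>J. chart_integral i (f j))"
proof -
  have eq: "(\<lambda>y. if y \<in> \<phi> i ` U i then \<Sum>j\<in>J. f j (\<psi> i y) else 0) =
    (\<lambda>y. \<Sum>j\<in>J. if y \<in> \<phi> i ` U i then f j (\<psi> i y) else 0)"
    by auto
  show ?thesis
    unfolding chart_integral_def eq
  proof (rule integral_sum[OF assms(1)])
    fix j assume j: "j \<in> J"
    show "(\<lambda>y. if y \<in> \<phi> i ` U i then f j (\<psi> i y) else 0) integrable_on UNIV"
      by (rule chart_extension(3)[OF assms(2), of "f j" "L j"]) (use f[OF j] in auto)
  qed
qed

text \<open>Both integrands vanish off \<open>L\<close>, hence off the overlap of the two charts;
  there the transition map has positive Jacobian, and the change of variables formula applies with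
  its absolute value dropped.\<close>

lemma chart_integral_change:
  assumes i: "i \<in> I" and j: "j \<in> I" and f: "continuous_on (U j) f" and L: "compact L" "L \<subseteq> U i \<inter> U j"
    and z: "\<And>x. x \<in> U j \<Longrightarrow> x \<notin> L \<Longrightarrow> f x = 0"
    and g: "\<And>x. x \<in> U i \<inter> U j \<Longrightarrow> g x = f x * jac (\<phi> j \<circ> \<psi> i) (\<phi> i x)"
    and gz: "\<And>x. x \<in> U i \<Longrightarrow> x \<notin> L \<Longrightarrow> g x = 0"
  shows "chart_integral i g = chart_integral j f"
proof -
  let ?S = "\<phi> i ` (U i \<inter> U j)" and ?T = "\<phi> j \<circ> \<psi> i"
  let ?e = "\<lambda>y. if y \<in> \<phi> j ` U j then f (\<psi> j y) else 0"
  have TS: "?T ` ?S = \<phi> j ` (U i \<inter> U j)"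
    unfolding image_image by (rule image_cong) (use i in simp_all)
  have "L \<subseteq> U j" using L(2) by blast
  then have "?e absolutely_integrable_on UNIV"
    by (rule chart_extension(2)[OF j f L(1) _ z])
  moreover have "?T ` ?S \<in> sets lebesgue"
    unfolding TS using chart_image_open[OF j chart_openin[OF i]] by (simp add: Int_commute)
  ultimately have int: "?e absolutely_integrable_on ?T ` ?S"
    using set_integrable_subset[of lebesgue UNIV ?e "?T ` ?S"] by simp
  have "chart_integral i g = integral UNIV (\<lambda>y. if y \<in> ?S then g (\<psi> i y) else 0)"
    unfolding chart_integral_def
  proof (rule arg_cong[where f = "integral UNIV"], rule ext)
    fix y
    show "(if y \<in> \<phi> i ` U i then g (\<psi> i y) else 0) = (if y \<in> ?S then g (\<psi> i y) else 0)"
    proof (cases "y \<in> \<phi> i ` U i")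
      case True
      then obtain x where x: "x \<in> U i" "y = \<phi> i x" by blast
      then have "y \<in> ?S \<longleftrightarrow> x \<in> U i \<inter> U j" by (simp add: chart_mem_image[OF i])
      then show ?thesis using x gz[of x] i L(2) by auto
    qed auto
  qed
  also have "\<dots> = integral ?S (\<lambda>y. g (\<psi> i y))"
    by (rule integral_restrict_UNIV)
  also have "\<dots> = integral ?S (\<lambda>y. \<bar>det (matrix (frechet_derivative ?T (at y)))\<bar> * ?e (?T y))"
  proof (rule integral_cong)
    fix y assume "y \<in> ?S"
    then obtain x where x: "x \<in> U i" "x \<in> U j" "y = \<phi> i x" by blast
    then show "g (\<psi> i y) = \<bar>det (matrix (frechet_derivative ?T (at y)))\<bar> * ?e (?T y)"
      using g[of x] trans_pos[OF i j x(1,2)] i j by (simp add: jac_def)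
  qed
  also have "\<dots> = integral (?T ` ?S) ?e"
  proof (rule integral_change_of_variables_scalar)
    show "?S \<in> sets lebesgue"
      using chart_image_open[OF i chart_openin[OF j]] by simp
    show "(?T has_derivative frechet_derivative ?T (at x)) (at x within ?S)" if "x \<in> ?S" for x
      by (rule has_derivative_at_withinI[OF has_derivative_frechet[OF Ck_differentiable[OF trans_C1[OF i j] that]]])
    show "inj_on ?T ?S"
    proof (rule inj_onI)
      fix y z assume "y \<in> ?S" "z \<in> ?S" and eq: "?T y = ?T z"
      then obtain u v where uv: "u \<in> U i \<inter> U j" "y = \<phi> i u" "v \<in> U i \<inter> U j" "z = \<phi> i v" by blast
      then have "\<phi> j u = \<phi> j v" using eq i by simp
      then have "u = v" using uv inj_onD[OF chart_inj[OF j]] by blast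
      then show "y = z" using uv by simp
    qed
  qed (rule int)
  also have "\<dots> = integral UNIV (\<lambda>y. if y \<in> \<phi> j ` (U i \<inter> U j) then ?e y else 0)"
    unfolding TS by (rule integral_restrict_UNIV[symmetric])
  also have "\<dots> = chart_integral j f"
    unfolding chart_integral_def
  proof (rule arg_cong[where f = "integral UNIV"], rule ext)
    fix y
    show "(if y \<in> \<phi> j ` (U i \<inter> U j) then ?e y else 0) = ?e y"
    proof (cases "y \<in> \<phi> j ` U j")
      case True
      then obtain x where x: "x \<in> U j" "y = \<phi> j x" by blast
      then have "y \<in> \<phi> j ` (U i \<inter> U j) \<longleftrightarrow> x \<in> U i \<inter> U j" by (simp add: chart_mem_image[OF j])
      then show ?thesis using x z[of x] j L(2) by auto
    qed auto
  qed
  finally show ?thesis .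
qed

text \<open>Finitely many ball bumps, moved to \<open>X\<close> by charts and divided by their sum.
  The functions are indexed by the centres \<open>p\<close> of the balls; \<open>c p\<close> is the
  chart used at \<open>p\<close>, and \<open>L p\<close> is the transported ball of twice the
  radius.\<close>

lemma partition_of_unity:
  obtains P :: "'x set" and c :: "'x \<Rightarrow> 'i" and \<theta> :: "'x \<Rightarrow> 'x \<Rightarrow> real" and L :: "'x \<Rightarrow> 'x set"
  where "finite P" "\<And>p. p \<in> P \<Longrightarrow> c p \<in> I" "\<And>p. p \<in> P \<Longrightarrow> C1_in X (\<theta> p)"
    "\<And>p. p \<in> P \<Longrightarrow> compact (L p) \<and> L p \<subseteq> U (c p)"
    "\<And>p x. p \<in> P \<Longrightarrow> x \<in> X \<Longrightarrow> x \<notin> L p \<Longrightarrow> \<theta> p x = 0"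
    "\<And>x. x \<in> X \<Longrightarrow> (\<Sum>p\<in>P. \<theta> p x) = 1"
proof -
  \<comment> \<open>The doubled ball has to fit into the chart image: it contains the support of the
    bump, which is then extended by zero to all of \<open>X\<close>.\<close>
  have "\<exists>i r. i \<in> I \<and> p \<in> U i \<and> r > 0 \<and> cball (\<phi> i p) (2 * r) \<subseteq> \<phi> i ` U i" if p: "p \<in> X" for p
  proof -
    obtain i where i: "i \<in> I" "p \<in> U i" using p cover by blast
    then have "\<phi> i p \<in> \<phi> i ` U i" by blast
    then obtain e where "e > 0" "cball (\<phi> i p) e \<subseteq> \<phi> i ` U i"
      using chart_open[OF i(1)] unfolding open_contains_cball by blast
    then show ?thesis using i by (intro exI[of _ i] exI[of _ "e / 2"]) auto
  qed
  then obtain c r where cr: "\<And>p. p \<in> X \<Longrightarrow> c p \<in> I \<and> p \<in> U (c p) \<and> r p > 0 \<and>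
      cball (\<phi> (c p) p) (2 * r p) \<subseteq> \<phi> (c p) ` U (c p)" by metis
  define L where "L p = \<psi> (c p) ` cball (\<phi> (c p) p) (2 * r p)" for p
  define \<beta> where "\<beta> p x = (if x \<in> U (c p) then ball_bump (\<phi> (c p) p) (r p) (\<phi> (c p) x) else 0)" for p x
  define B where "B p = U (c p) \<inter> \<phi> (c p) -` ball (\<phi> (c p) p) (r p)" for p
  have L: "compact (L p)" "L p \<subseteq> U (c p)" if "p \<in> X" for p
  proof -
    have c: "c p \<in> I" and sub: "cball (\<phi> (c p) p) (2 * r p) \<subseteq> \<phi> (c p) ` U (c p)" using cr that by auto
    show "compact (L p)" unfolding L_def
      by (intro compact_continuous_image continuous_on_subset[OF inv_chart_continuous[OF c] sub] compact_cball)
    show "L p \<subseteq> U (c p)" unfolding L_def using sub c by auto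
  qed
  have \<beta>0: "\<beta> p x = 0" if "p \<in> X" "x \<notin> L p" for p x
  proof (cases "x \<in> U (c p)")
    case True
    have "\<phi> (c p) x \<notin> cball (\<phi> (c p) p) (2 * r p)"
    proof
      assume "\<phi> (c p) x \<in> cball (\<phi> (c p) p) (2 * r p)"
      then have "\<psi> (c p) (\<phi> (c p) x) \<in> L p" unfolding L_def by blast
      with True that cr show False by auto
    qed
    then show ?thesis using True cr[OF that(1)] by (simp add: \<beta>_def ball_bump_eq_0)
  qed (simp add: \<beta>_def)
  have \<beta>C: "C1_in X (\<beta> p)" if p: "p \<in> X" for p
  proof -
    have c: "c p \<in> I" using cr p by auto
    have "C1_in (U (c p)) (\<lambda>x. ball_bump (\<phi> (c p) p) (r p) (\<phi> (c p) x))"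
      by (rule C1_in_compose[OF C1_in_chart[OF c] Ck_ball_bump open_UNIV]) simp
    then have 1: "C1_in (U (c p)) (\<beta> p)"
      by (rule C1_in_cong) (simp add: \<beta>_def)
    have "C1_in (X - L p) (\<lambda>x. 0 :: real)"
      by (intro C1_in_const compact_closedin L p)
    then have 2: "C1_in (X - L p) (\<beta> p)"
      by (rule C1_in_cong) (use \<beta>0[OF p] in auto)
    have "U (c p) \<union> (X - L p) = X" using L[OF p] chart_subset[OF c] by blast
    then show ?thesis using C1_in_Un[OF 1 2] by simp
  qed
  have Bop: "openin (top_of_set X) (B p)" if p: "p \<in> X" for p
  proof -
    have c: "c p \<in> I" using cr p by auto
    have "openin (top_of_set (U (c p))) (B p)"
      unfolding B_def using chart_continuous[OF c] by (intro continuous_openin_preimage_gen) auto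
    then show ?thesis using chart_openin[OF c] openin_trans by blast
  qed
  have "\<exists>O'. open O' \<and> B p = X \<inter> O'" if "p \<in> X" for p
    using Bop[OF that] by (simp add: openin_open)
  then obtain O' where O': "\<And>p. p \<in> X \<Longrightarrow> open (O' p) \<and> B p = X \<inter> O' p" by metis
  obtain P where P: "P \<subseteq> X" "finite P" "X \<subseteq> (\<Union>p\<in>P. O' p)"
  proof (rule compactE_image[OF compact_X, of X O'])
    show "open (O' p)" if "p \<in> X" for p using O' that by blast
    show "X \<subseteq> (\<Union>p\<in>X. O' p)"
    proof
      fix p assume p: "p \<in> X"
      then have "p \<in> B p" using cr[OF p] by (simp add: B_def)
      then show "p \<in> (\<Union>p\<in>X. O' p)" using O'[OF p] p by blast
    qed
  qed
  define S where "S x = (\<Sum>p\<in>P. \<beta> p x)" for x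
  have nonneg: "\<beta> p x \<ge> 0" for p x by (simp add: \<beta>_def ball_bump_nonneg)
  have S: "S x > 0" if x: "x \<in> X" for x
  proof -
    obtain p where p: "p \<in> P" "x \<in> O' p" using P x by blast
    then have "x \<in> B p" using O' P x by blast
    then have "\<beta> p x = 1"
      using cr[of p] p P by (auto simp: B_def \<beta>_def intro!: ball_bump_eq_1)
    then show ?thesis
      unfolding S_def using p(1) P(2) nonneg by (intro sum_pos2[of P p]) auto
  qed
  have SC: "C1_in X S"
    unfolding S_def[abs_def] using \<beta>C P(1) by (intro C1_in_sum) auto
  have inv: "Ck (Suc 0) {0<..} (inverse :: real \<Rightarrow> real)"
    by (rule Ck_inverse[OF _ Ck_bounded_linear[OF bounded_linear_ident]]) auto
  have iSC: "C1_in X (\<lambda>x. inverse (S x))"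
    by (rule C1_in_compose[OF SC inv]) (use S in auto)
  show ?thesis
  proof (rule that[of P c "\<lambda>p x. \<beta> p x * inverse (S x)" L])
    show "C1_in X (\<lambda>x. \<beta> p x * inverse (S x))" if "p \<in> P" for p
      using \<beta>C P(1) that iSC by (intro C1_in_mult) auto
    show "(\<Sum>p\<in>P. \<beta> p x * inverse (S x)) = 1" if "x \<in> X" for x
      using S[OF that] by (simp add: sum_distrib_right[symmetric] S_def)
    show "\<beta> p x * inverse (S x) = 0" if "p \<in> P" "x \<in> X" "x \<notin> L p" for p x
      using \<beta>0 that P(1) by auto
    show "c p \<in> I" "compact (L p) \<and> L p \<subseteq> U (c p)" if "p \<in> P" for p
      using cr L P(1) that by blast+
  qed (rule P)
qed

end

section \<open>Integration of densities and Stokes\<close>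

context oriented_charts
begin

lemma chart_integral_cong:
  assumes "i \<in> I" "\<And>x. x \<in> U i \<Longrightarrow> f x = g x"
  shows "chart_integral i f = chart_integral i g"
  unfolding chart_integral_def
  by (rule arg_cong[where f = "integral UNIV"], rule ext) (use assms in auto)

lemma jacX_zero_component:
  assumes f: "C1_in A f" and K: "compact K" and z: "\<And>x. x \<in> A \<Longrightarrow> x \<notin> K \<Longrightarrow> f x $ b = 0"
    and x: "i \<in> I" "x \<in> U i" "x \<in> A" "x \<notin> K"
  shows "jacX f i x = 0"
proof -
  have A: "openin (top_of_set X) A" using f by (rule C1_in_openin)
  have "open (\<phi> i ` (U i \<inter> (A \<inter> (X - K))))"
    by (rule chart_image_open[OF x(1)]) (intro openin_Int A compact_closedin K)
  moreover have "\<phi> i x \<in> \<phi> i ` (U i \<inter> (A \<inter> (X - K)))"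
    using x chart_subset[OF x(1)] by blast
  moreover have "(f \<circ> \<psi> i) y $ b = 0" if "y \<in> \<phi> i ` (U i \<inter> (A \<inter> (X - K)))" for y
    using that z x(1) by auto
  ultimately show ?thesis
    unfolding jacX_def by (rule jac_zero_component[OF _ _ _ C1_in_differentiable[OF f x(1-3)]])
qed

text \<open>In the chart, \<open>f\<close> is multiplied by a cutoff that is \<open>1\<close> near
  the image of \<open>K\<close>, which gives a compactly supported map \<open>h\<close> of Euclidean
  space. Off the image of \<open>K\<close> the cutoff may vary, but there component \<open>b\<close>
  is zero, so neither Jacobian notices, and \<open>integral_jac_compact_support\<close> applies to
  \<open>h\<close>.\<close>

lemma chart_integral_jac_zero:
  assumes f: "C1_in A f" and i: "i \<in> I" and K: "compact K" "K \<subseteq> A" "K \<subseteq> U i"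
    and z: "\<And>x. x \<in> A \<Longrightarrow> x \<notin> K \<Longrightarrow> f x $ b = 0"
  shows "chart_integral i (pullback_density A (\<lambda>_. 1) f i) = 0"
proof -
  let ?W = "\<phi> i ` (U i \<inter> A)" and ?F = "f \<circ> \<psi> i" and ?C = "\<phi> i ` K"
  let ?e = "\<lambda>y. if y \<in> \<phi> i ` U i then pullback_density A (\<lambda>_. 1) f i (\<psi> i y) else 0"
  have W: "open ?W" using chart_image_open[OF i C1_in_openin[OF f]] .
  have C: "compact ?C" "?C \<subseteq> ?W"
    using compact_continuous_image[OF continuous_on_subset[OF chart_continuous[OF i] K(3)] K(1)] K by auto
  obtain \<kappa> N L where \<kappa>: "\<And>k. Ck k UNIV \<kappa>" "open N" "?C \<subseteq> N" "\<And>y. y \<in> N \<Longrightarrow> \<kappa> y = (1::real)"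
    "compact L" "L \<subseteq> ?W" "\<And>y. y \<notin> L \<Longrightarrow> \<kappa> y = 0"
    using smooth_cutoff[OF C(1) W C(2)] by metis
  define h where "h y = (if y \<in> ?W then \<kappa> y *\<^sub>R ?F y else 0)" for y
  have h0: "h y = 0" if "y \<notin> L" for y
    using that \<kappa>(7) by (simp add: h_def)
  have hC: "Ck (Suc 0) UNIV h"
  proof (rule Ck_local)
    fix y
    show "\<exists>V. open V \<and> y \<in> V \<and> Ck (Suc 0) V h"
    proof (cases "y \<in> ?W")
      case True
      have "Ck (Suc 0) ?W (\<lambda>y. \<kappa> y *\<^sub>R ?F y)"
        by (rule Ck_scaleR[OF W Ck_subset[OF \<kappa>(1) subset_UNIV] C1_in_Ck[OF f i]])
      then have "Ck (Suc 0) ?W h"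
        by (rule Ck_cong[OF W, rotated]) (simp add: h_def)
      then show ?thesis using W True by blast
    next
      case False
      have op: "open (- L)" using \<kappa>(5) by (simp add: compact_imp_closed open_Compl)
      have "Ck (Suc 0) (- L) h"
        by (rule Ck_cong[OF op _ Ck_const[of "Suc 0" _ 0]]) (simp add: h0)
      then show ?thesis using op False \<kappa>(6) by blast
    qed
  qed
  have hd: "h differentiable (at y)" for y
    using hC by (rule Ck_differentiable) simp
  obtain a e where box: "L \<subseteq> cbox a e"
    using bounded_subset_cbox_symmetric compact_imp_bounded \<kappa>(5) by metis
  have jac0: "jac h y = 0" if "y \<notin> L" for y
    by (rule jac_zero_component[of "- L" y h b])
       (use that h0 hd \<kappa>(5) in \<open>auto simp: compact_imp_closed open_Compl\<close>)
  have eq: "?e y = jac h y" for y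
  proof (cases "y \<in> ?C")
    case True
    then obtain x where x: "x \<in> K" "y = \<phi> i x" by blast
    have "jac h y = jac ?F y"
      by (rule jac_cong_open[of "N \<inter> ?W"])
         (use \<kappa>(2-4) W C(2) True in \<open>auto simp: h_def\<close>)
    moreover have "x \<in> U i" "x \<in> A" using x K by blast+
    ultimately show ?thesis using x i by (simp add: pullback_density_def jacX_def)
  next
    case False
    have op: "open (- ?C)" using C(1) by (simp add: compact_imp_closed open_Compl)
    have hb: "h y' $ b = 0" if "y' \<notin> ?C" for y'
    proof (cases "y' \<in> ?W")
      case True
      then obtain x where x: "x \<in> U i" "x \<in> A" "y' = \<phi> i x" by blast
      then have "x \<notin> K" using that by blast
      then show ?thesis using x z[of x] i by (simp add: h_def)
    qed (simp add: h_def)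
    have "jac h y = 0"
      by (rule jac_zero_component[OF op _ _ hd]) (use False hb in auto)
    moreover have "?e y = 0"
    proof (cases "y \<in> \<phi> i ` U i")
      case True
      then obtain x where x: "x \<in> U i" "y = \<phi> i x" by blast
      then have "x \<notin> K" using False by blast
      then have "x \<in> A \<Longrightarrow> jacX f i x = 0" using jacX_zero_component[OF f K(1) z i x(1)] by blast
      then show ?thesis using x i by (simp add: pullback_density_def)
    qed simp
    ultimately show ?thesis by simp
  qed
  have "chart_integral i (pullback_density A (\<lambda>_. 1) f i) = integral UNIV (jac h)"
    unfolding chart_integral_def by (rule arg_cong[where f = "integral UNIV"], rule ext) (rule eq)
  also have "jac h = (\<lambda>y. if y \<in> cbox a e then jac h y else 0)"
    using jac0 box by (auto simp: fun_eq_iff)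
  also have "integral UNIV (\<lambda>y. if y \<in> cbox a e then jac h y else 0) = integral (cbox a e) (jac h)"
    by (rule integral_restrict_UNIV)
  also have "\<dots> = 0"
    by (rule integral_jac_compact_support[OF hC]) (use box h0 in blast)
  finally show ?thesis .
qed

end

text \<open>Fixing one partition of unity makes the integral \<open>dint\<close> a definition. The
  locale is entered by interpretation in \<open>signed_count_eq_in_box\<close>.\<close>

locale charts_with_partition = oriented_charts X I U \<phi> \<psi>
  for X :: "'x::t2_space set" and I :: "'i set" and U :: "'i \<Rightarrow> 'x set"
    and \<phi> :: "'i \<Rightarrow> 'x \<Rightarrow> real^'k::{finite,wellorder}" and \<psi> :: "'i \<Rightarrow> real^'k::_ \<Rightarrow> 'x" +
  fixes P :: "'x set" and c :: "'x \<Rightarrow> 'i" and \<theta> :: "'x \<Rightarrow> 'x \<Rightarrow> real" and L :: "'x \<Rightarrow> 'x set"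
  assumes finite_P: "finite P" and c_in: "\<And>p. p \<in> P \<Longrightarrow> c p \<in> I"
    and \<theta>_C1: "\<And>p. p \<in> P \<Longrightarrow> C1_in X (\<theta> p)"
    and L: "\<And>p. p \<in> P \<Longrightarrow> compact (L p) \<and> L p \<subseteq> U (c p)"
    and \<theta>_support: "\<And>p x. p \<in> P \<Longrightarrow> x \<in> X \<Longrightarrow> x \<notin> L p \<Longrightarrow> \<theta> p x = 0"
    and \<theta>_sum: "\<And>x. x \<in> X \<Longrightarrow> (\<Sum>p\<in>P. \<theta> p x) = 1"
begin

definition dint :: "('i \<Rightarrow> 'x \<Rightarrow> real) \<Rightarrow> real" where
  "dint w = (\<Sum>p\<in>P. chart_integral (c p) (\<lambda>x. \<theta> p x * w (c p) x))"

lemma dint_cong: "(\<And>i x. i \<in> I \<Longrightarrow> x \<in> U i \<Longrightarrow> w i x = w' i x) \<Longrightarrow> dint w = dint w'"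
  unfolding dint_def by (intro sum.cong chart_integral_cong c_in) (auto simp: c_in)

lemma \<theta>_continuous: "p \<in> P \<Longrightarrow> i \<in> I \<Longrightarrow> continuous_on (U i) (\<theta> p)"
  using C1_in_continuous_on[OF \<theta>_C1] chart_subset continuous_on_subset by blast

lemma \<theta>_density:
  assumes w: "is_density K w" and p: "p \<in> P" and i: "i \<in> I"
  shows "continuous_on (U i) (\<lambda>x. \<theta> p x * w i x)" "compact (K \<inter> L p)"
    "\<And>x. x \<in> U i \<Longrightarrow> x \<notin> K \<inter> L p \<Longrightarrow> \<theta> p x * w i x = 0"
proof -
  show "continuous_on (U i) (\<lambda>x. \<theta> p x * w i x)"
    using w i unfolding is_density_def by (blast intro: continuous_on_mult \<theta>_continuous p)
  show "compact (K \<inter> L p)"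
    using w L[OF p] unfolding is_density_def by (blast intro: compact_Int)
  show "\<theta> p x * w i x = 0" if "x \<in> U i" "x \<notin> K \<inter> L p" for x
  proof (cases "x \<in> K")
    case True
    then show ?thesis using that \<theta>_support[OF p] chart_subset[OF i] by auto
  next
    case False
    then have "w i x = 0" using w i that(1) unfolding is_density_def by blast
    then show ?thesis by simp
  qed
qed

text \<open>Each summand \<open>\<theta> p * w\<close> has support in both \<open>U (c p)\<close>
  and \<open>U i\<close> and may be integrated in the chart \<open>i\<close> instead of
  \<open>c p\<close>; there the functions \<open>\<theta> p\<close> sum to \<open>1\<close>.\<close>

lemma dint_local:
  assumes w: "is_density K w" and i: "i \<in> I" and K: "K \<subseteq> U i"
  shows "dint w = chart_integral i (w i)"
proof -
  have "chart_integral (c p) (\<lambda>x. \<theta> p x * w (c p) x) = chart_integral i (\<lambda>x. \<theta> p x * w i x)"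
    if p: "p \<in> P" for p
  proof (rule chart_integral_change[OF c_in[OF p] i])
    show "continuous_on (U i) (\<lambda>x. \<theta> p x * w i x)" "compact (K \<inter> L p)"
      using \<theta>_density[OF w p i] by blast+
    show "K \<inter> L p \<subseteq> U (c p) \<inter> U i" using K L[OF p] by blast
    show "\<theta> p x * w i x = 0" if "x \<in> U i" "x \<notin> K \<inter> L p" for x
      by (rule \<theta>_density(3)[OF w p i that])
    show "\<theta> p x * w (c p) x = 0" if "x \<in> U (c p)" "x \<notin> K \<inter> L p" for x
      by (rule \<theta>_density(3)[OF w p c_in[OF p] that])
    show "\<theta> p x * w (c p) x = \<theta> p x * w i x * jac (\<phi> i \<circ> \<psi> (c p)) (\<phi> (c p) x)"
      if "x \<in> U (c p) \<inter> U i" for x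
    proof -
      have "w (c p) x = w i x * jac (\<phi> i \<circ> \<psi> (c p)) (\<phi> (c p) x)"
        using w i c_in[OF p] that unfolding is_density_def by blast
      then show ?thesis by simp
    qed
  qed
  then have "dint w = (\<Sum>p\<in>P. chart_integral i (\<lambda>x. \<theta> p x * w i x))"
    by (simp add: dint_def)
  also have "\<dots> = chart_integral i (\<lambda>x. \<Sum>p\<in>P. \<theta> p x * w i x)"
  proof (rule chart_integral_sum[OF finite_P i, symmetric])
    fix p assume p: "p \<in> P"
    show "continuous_on (U i) (\<lambda>x. \<theta> p x * w i x) \<and> compact (K \<inter> L p) \<and> K \<inter> L p \<subseteq> U i \<and>
      (\<forall>x\<in>U i. x \<notin> K \<inter> L p \<longrightarrow> \<theta> p x * w i x = 0)"
      using \<theta>_density[OF w p i] K by blast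
  qed
  also have "\<dots> = chart_integral i (w i)"
    by (rule chart_integral_cong[OF i])
       (use chart_subset[OF i] \<theta>_sum in \<open>auto simp: sum_distrib_right[symmetric]\<close>)
  finally show ?thesis .
qed

lemma dint_sum:
  assumes J: "finite J" and w: "\<And>j. j \<in> J \<Longrightarrow> is_density (K j) (w j)"
  shows "dint (\<lambda>i x. \<Sum>j\<in>J. w j i x) = (\<Sum>j\<in>J. dint (w j))"
proof -
  have "chart_integral (c p) (\<lambda>x. \<theta> p x * (\<Sum>j\<in>J. w j (c p) x)) =
    (\<Sum>j\<in>J. chart_integral (c p) (\<lambda>x. \<theta> p x * w j (c p) x))" if p: "p \<in> P" for p
    unfolding sum_distrib_left
  proof (rule chart_integral_sum[OF J c_in[OF p]])
    fix j assume j: "j \<in> J"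
    show "continuous_on (U (c p)) (\<lambda>x. \<theta> p x * w j (c p) x) \<and> compact (K j \<inter> L p) \<and> K j \<inter> L p \<subseteq> U (c p) \<and>
      (\<forall>x\<in>U (c p). x \<notin> K j \<inter> L p \<longrightarrow> \<theta> p x * w j (c p) x = 0)"
      using \<theta>_density[OF w[OF j] p c_in[OF p]] L[OF p] by blast
  qed
  then have "dint (\<lambda>i x. \<Sum>j\<in>J. w j i x) = (\<Sum>p\<in>P. \<Sum>j\<in>J. chart_integral (c p) (\<lambda>x. \<theta> p x * w j (c p) x))"
    by (simp add: dint_def)
  also have "\<dots> = (\<Sum>j\<in>J. dint (w j))"
    unfolding dint_def by (rule sum.swap)
  finally show ?thesis .
qed

lemma dint_add:
  assumes "is_density K w" "is_density K' w'"
  shows "dint (\<lambda>i x. w i x + w' i x) = dint w + dint w'"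
  using dint_sum[of "UNIV :: bool set" "\<lambda>t. if t then K else K'" "\<lambda>t. if t then w else w'"] assms
  by (simp add: UNIV_bool add.commute)

text \<open>The partition of unity multiplies only component \<open>b\<close>, that is, the
  primitive and not the form: \<open>\<theta> p\<close> times the form would in general not be
  exact. By linearity in row \<open>b\<close> the Jacobian of \<open>f\<close> is the sum of those
  of the maps \<open>g p\<close>, and component \<open>b\<close> of each \<open>g p\<close> is
  supported in one chart.\<close>

theorem dint_stokes:
  assumes f: "C1_in A f" and K: "compact K" "K \<subseteq> A"
    and z: "\<And>x. x \<in> A \<Longrightarrow> x \<notin> K \<Longrightarrow> f x $ b = 0"
  shows "dint (pullback_density A (\<lambda>_. 1) f) = 0"
proof -
  have A: "openin (top_of_set X) A" "A \<subseteq> X"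
    using C1_in_openin[OF f] openin_imp_subset by auto
  define g where "g p x = set_row b (\<theta> p x * f x $ b) (f x)" for p x
  have \<theta>A: "C1_in A (\<theta> p)" if "p \<in> P" for p
    using C1_in_subset[OF \<theta>_C1[OF that] A] .
  have fb: "C1_in A (\<lambda>x. \<theta> p x * f x $ b)" if "p \<in> P" for p
    by (intro C1_in_mult \<theta>A that C1_in_nth f)
  have g: "C1_in A (g p)" if "p \<in> P" for p
    unfolding g_def[abs_def] by (intro C1_in_set_row fb that f)
  have gz: "g p x $ b = 0" if "p \<in> P" "x \<in> A" "x \<notin> K \<inter> L p" for p x
    using z that \<theta>_support A(2) by (auto simp: g_def)
  have cK: "compact (K \<inter> L p)" "K \<inter> L p \<subseteq> A" "K \<inter> L p \<subseteq> U (c p)" if "p \<in> P" for p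
    using K L[OF that] by (auto simp: compact_Int)
  have dens: "is_density (K \<inter> L p) (pullback_density A (\<lambda>_. 1) (g p))" if p: "p \<in> P" for p
  proof (rule is_density_pullback[OF g[OF p] continuous_on_const cK(1,2)[OF p]])
    show "1 * jacX (g p) i x = 0" if "i \<in> I" "x \<in> U i" "x \<in> A" "x \<notin> K \<inter> L p" for i x
      using jacX_zero_component[OF g[OF p] cK(1)[OF p] gz[OF p] that] by simp
  qed
  have jac: "jacX f i x = (\<Sum>p\<in>P. jacX (g p) i x)" if i: "i \<in> I" "x \<in> U i" "x \<in> A" for i x
  proof -
    have "jacX f i x = jac (\<lambda>y. set_row b (\<Sum>p\<in>P. ((\<lambda>x. \<theta> p x * f x $ b) \<circ> \<psi> i) y) ((f \<circ> \<psi> i) y)) (\<phi> i x)"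
      unfolding jacX_def
    proof (rule jac_cong_open[OF chart_image_open[OF i(1) A(1)]])
      show "\<phi> i x \<in> \<phi> i ` (U i \<inter> A)" using i by blast
      fix y assume "y \<in> \<phi> i ` (U i \<inter> A)"
      then obtain x' where x': "x' \<in> U i" "x' \<in> A" "y = \<phi> i x'" by blast
      have "(\<Sum>p\<in>P. \<theta> p x' * f x' $ b) = f x' $ b"
        using \<theta>_sum[of x'] x' A(2) by (simp add: sum_distrib_right[symmetric] subset_iff)
      then show "(f \<circ> \<psi> i) y = set_row b (\<Sum>p\<in>P. ((\<lambda>x. \<theta> p x * f x $ b) \<circ> \<psi> i) y) ((f \<circ> \<psi> i) y)"
        unfolding x'(3) using x'(1,2) i(1) by (simp add: vec_eq_iff)
    qed
    also have "\<dots> = (\<Sum>p\<in>P. jac (\<lambda>y. set_row b (((\<lambda>x. \<theta> p x * f x $ b) \<circ> \<psi> i) y) ((f \<circ> \<psi> i) y)) (\<phi> i x))"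
      by (rule jac_set_row_sum[OF finite_P C1_in_differentiable[OF fb i] C1_in_differentiable[OF f i]])
    also have "\<dots> = (\<Sum>p\<in>P. jacX (g p) i x)"
      by (simp add: jacX_def g_def[abs_def] o_def)
    finally show ?thesis .
  qed
  have "dint (pullback_density A (\<lambda>_. 1) f) = dint (\<lambda>i x. \<Sum>p\<in>P. pullback_density A (\<lambda>_. 1) (g p) i x)"
    by (rule dint_cong) (simp add: pullback_density_def jac)
  also have "\<dots> = (\<Sum>p\<in>P. dint (pullback_density A (\<lambda>_. 1) (g p)))"
    by (rule dint_sum[OF finite_P dens])
  also have "\<dots> = (\<Sum>p\<in>P. 0)"
  proof (rule sum.cong[OF refl])
    fix p assume p: "p \<in> P"
    show "dint (pullback_density A (\<lambda>_. 1) (g p)) = 0"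
      unfolding dint_local[OF dens[OF p] c_in[OF p] cK(3)[OF p]]
      by (rule chart_integral_jac_zero[OF g[OF p] c_in[OF p] cK[OF p] gz[OF p]])
  qed
  finally show ?thesis by simp
qed

end

text \<open>Centred at \<open>q\<close> with support in the cube of side \<open>r\<close>; the shift
  by \<open>1 / 2\<close> moves the support [0, 1] of the derivative of \<open>smooth_step\<close>
  to the centre. The product form makes the primitive in one coordinate explicit, since only one
  factor has to be integrated.\<close>

definition cube_bump :: "real \<Rightarrow> real^'k \<Rightarrow> real^'k \<Rightarrow> real" where
  "cube_bump r q y = (\<Prod>j\<in>UNIV. deriv smooth_step ((y $ j - q $ j) / r + 1 / 2))"

text \<open>The partial derivative of \<open>slab_bump b r q q'\<close> in direction \<open>b\<close> is the difference of the cube bumps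
  at \<open>q\<close> and \<open>q'\<close> if these differ only in the coordinate \<open>b\<close>.\<close>

definition slab_bump :: "'k \<Rightarrow> real \<Rightarrow> real^'k \<Rightarrow> real^'k \<Rightarrow> real^'k \<Rightarrow> real" where
  "slab_bump b r q q' y =
     r * (smooth_step ((y $ b - q $ b) / r + 1 / 2) - smooth_step ((y $ b - q' $ b) / r + 1 / 2)) *
     (\<Prod>j\<in>UNIV - {b}. deriv smooth_step ((y $ j - q $ j) / r + 1 / 2))"

lemma Ck_affine_nth: "Ck k UNIV (\<lambda>y :: real^'k. (y $ j - s) / r + 1 / 2)"
proof -
  have "Ck k UNIV (\<lambda>y :: real^'k. (1 / r) * (y $ j) + (- s / r + 1 / 2))"
    by (intro Ck_add Ck_mult Ck_const open_UNIV Ck_bounded_linear bounded_linear_vec_nth)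
  moreover have "(\<lambda>y :: real^'k. (1 / r) * (y $ j) + (- s / r + 1 / 2)) = (\<lambda>y. (y $ j - s) / r + 1 / 2)"
    by (auto simp: fun_eq_iff diff_divide_distrib)
  ultimately show ?thesis by simp
qed

lemma Ck_cube_bump: "Ck k UNIV (cube_bump r q)"
  unfolding cube_bump_def[abs_def]
  by (intro Ck_prod open_UNIV Ck_compose[OF open_UNIV Ck_affine_nth Ck_deriv_smooth_step open_UNIV]) auto

lemma Ck_slab_bump: "Ck k UNIV (slab_bump b r q q')"
proof -
  have "Ck k UNIV (\<lambda>y. (r * (smooth_step ((y $ b - q $ b) / r + 1 / 2) + (-1) * smooth_step ((y $ b - q' $ b) / r + 1 / 2))) *
     (\<Prod>j\<in>UNIV - {b}. deriv smooth_step ((y $ j - q $ j) / r + 1 / 2)))"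
    by (intro Ck_mult Ck_add Ck_prod Ck_const open_UNIV Ck_compose[OF open_UNIV Ck_affine_nth Ck_deriv_smooth_step open_UNIV]
        Ck_compose[OF open_UNIV Ck_affine_nth Ck_smooth_step open_UNIV]) auto
  then show ?thesis by (simp add: slab_bump_def[abs_def])
qed

lemma cube_bump_nonneg: "cube_bump r q y \<ge> 0"
  unfolding cube_bump_def
proof (rule prod_nonneg)
  show "0 \<le> deriv smooth_step t" for t
    using deriv_smooth_step_pos[of t] deriv_smooth_step_outside[of t] by (cases "0 < t \<and> t < 1") auto
qed

lemma cube_bump_center_pos: "cube_bump r q q > 0"
  unfolding cube_bump_def by (intro prod_pos) (simp add: deriv_smooth_step_pos)

lemma deriv_smooth_step_nonzero: "deriv smooth_step t \<noteq> 0 \<Longrightarrow> 0 < t \<and> t < 1"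
  using deriv_smooth_step_outside[of t] by linarith

lemma cube_bump_support:
  assumes "r > 0" "cube_bump r q y \<noteq> 0"
  shows "\<bar>y $ j - q $ j\<bar> < r / 2"
proof -
  have "deriv smooth_step ((y $ j - q $ j) / r + 1 / 2) \<noteq> 0"
    using assms(2) unfolding cube_bump_def by (metis finite UNIV_I prod_zero_iff)
  then have "0 < (y $ j - q $ j) / r + 1 / 2 \<and> (y $ j - q $ j) / r + 1 / 2 < 1"
    using deriv_smooth_step_nonzero by blast
  then have "- (1 / 2) * r < y $ j - q $ j \<and> y $ j - q $ j < (1 / 2) * r"
    using assms(1) by (simp add: field_simps)
  then show ?thesis unfolding abs_less_iff by (intro conjI; linarith)
qed

text \<open>In direction \<open>b\<close> the two steps are both \<open>0\<close> below the box and
  both \<open>1\<close> above it. So their difference is supported in the box although neither step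
  has compact support.\<close>

lemma slab_bump_support:
  assumes "r > 0" "\<And>j. a $ j + r / 2 \<le> q $ j \<and> q $ j \<le> e $ j - r / 2"
    "\<And>j. a $ j + r / 2 \<le> q' $ j \<and> q' $ j \<le> e $ j - r / 2" "slab_bump b r q q' y \<noteq> 0"
  shows "y \<in> cbox a e"
proof -
  have "a $ j \<le> y $ j \<and> y $ j \<le> e $ j" for j
  proof (cases "j = b")
    case False
    then have "deriv smooth_step ((y $ j - q $ j) / r + 1 / 2) \<noteq> 0"
      using assms(4) by (auto simp: slab_bump_def)
    then have "0 < (y $ j - q $ j) / r + 1 / 2 \<and> (y $ j - q $ j) / r + 1 / 2 < 1"
      using deriv_smooth_step_nonzero by blast
    then have "- (1 / 2) * r < y $ j - q $ j \<and> y $ j - q $ j < (1 / 2) * r"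
      using assms(1) by (simp add: field_simps)
    then show ?thesis using assms(2)[of j] by (intro conjI; linarith)
  next
    case True
    have ne: "smooth_step ((y $ b - q $ b) / r + 1 / 2) \<noteq> smooth_step ((y $ b - q' $ b) / r + 1 / 2)"
      using assms(4) by (auto simp: slab_bump_def)
    have "\<not> y $ b < a $ b"
    proof
      assume "y $ b < a $ b"
      then have "(y $ b - q $ b) / r + 1 / 2 \<le> 0" "(y $ b - q' $ b) / r + 1 / 2 \<le> 0"
        using assms(1) assms(2)[of b] assms(3)[of b] by (auto simp: field_simps)
      then show False using ne by simp
    qed
    moreover have "\<not> y $ b > e $ b"
    proof
      assume "y $ b > e $ b"
      then have "(y $ b - q $ b) / r + 1 / 2 \<ge> 1" "(y $ b - q' $ b) / r + 1 / 2 \<ge> 1"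
        using assms(1) assms(2)[of b] assms(3)[of b] by (auto simp: field_simps)
      then show False using ne by simp
    qed
    ultimately show ?thesis using True by auto
  qed
  then show ?thesis by (simp add: mem_box_cart)
qed

text \<open>Along direction \<open>b\<close> only the difference of steps varies, and the factor
  \<open>r\<close> in \<open>slab_bump\<close> cancels the inner derivative \<open>1 / r\<close>.
  The remaining product is common to both cube bumps because \<open>q\<close> and \<open>q'\<close>
  agree off \<open>b\<close>.\<close>

lemma slab_bump_derivative:
  assumes "r > 0" "\<And>j. j \<noteq> b \<Longrightarrow> q' $ j = q $ j"
  shows "frechet_derivative (slab_bump b r q q') (at y) (axis b 1) = cube_bump r q y - cube_bump r q' y"
proof -
  let ?l = "\<lambda>t. y + t *\<^sub>R axis b 1" and ?\<Pi> = "\<Prod>j\<in>UNIV - {b}. deriv smooth_step ((y $ j - q $ j) / r + 1 / 2)"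
  let ?s = "\<lambda>q t. (y $ b + t - q $ b) / r + 1 / 2"
  let ?D = "frechet_derivative (slab_bump b r q q') (at y)"
  have diff: "slab_bump b r q q' differentiable (at (?l 0))"
    by (rule Ck_differentiable[OF Ck_slab_bump]) simp
  have "(?l has_derivative (\<lambda>t. t *\<^sub>R axis b 1)) (at 0)"
    by (auto intro!: derivative_eq_intros)
  from diff_chain_at[OF this has_derivative_frechet[OF diff]]
  have 1: "((\<lambda>t. slab_bump b r q q' (?l t)) has_derivative (\<lambda>t. ?D (t *\<^sub>R axis b 1))) (at 0)"
    by (simp add: o_def)
  have \<Pi>: "(\<Prod>j\<in>UNIV - {b}. deriv smooth_step ((?l t $ j - q $ j) / r + 1 / 2)) = ?\<Pi>" for t
    by (rule prod.cong) (auto simp: axis_def)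
  have eq: "slab_bump b r q q' (?l t) = r * (smooth_step (?s q t) - smooth_step (?s q' t)) * ?\<Pi>" for t
    unfolding slab_bump_def \<Pi> by (simp add: axis_def)
  have s: "(?s q has_real_derivative 1 / r) (at t)" for q t
    using assms(1) by (auto intro!: derivative_eq_intros)
  have step: "((\<lambda>t. smooth_step (?s q t)) has_real_derivative deriv smooth_step (?s q 0) * (1 / r)) (at 0)" for q
    by (rule DERIV_chain2[OF smooth_step_deriv s])
  have "((\<lambda>t. slab_bump b r q q' (?l t)) has_real_derivative
      r * (deriv smooth_step (?s q 0) * (1 / r) - deriv smooth_step (?s q' 0) * (1 / r)) * ?\<Pi>) (at 0)"
    unfolding eq by (intro DERIV_cmult DERIV_cmult_right DERIV_diff step)
  then have 2: "((\<lambda>t. slab_bump b r q q' (?l t)) has_derivative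
      (*) (r * (deriv smooth_step (?s q 0) * (1 / r) - deriv smooth_step (?s q' 0) * (1 / r)) * ?\<Pi>)) (at 0)"
    by (simp add: has_field_derivative_def)
  have c: "cube_bump r q y = deriv smooth_step (?s q 0) * ?\<Pi>"
    unfolding cube_bump_def by (subst prod.remove[of _ b]) auto
  have "(\<Prod>j\<in>UNIV - {b}. deriv smooth_step ((y $ j - q' $ j) / r + 1 / 2)) = ?\<Pi>"
    by (rule prod.cong) (use assms(2) in auto)
  then have c': "cube_bump r q' y = deriv smooth_step (?s q' 0) * ?\<Pi>"
    unfolding cube_bump_def by (subst prod.remove[of _ b]) auto
  have "?D (axis b 1) = r * (deriv smooth_step (?s q 0) * (1 / r) - deriv smooth_step (?s q' 0) * (1 / r)) * ?\<Pi>"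
    using fun_cong[OF has_derivative_unique[OF 1 2], of 1] by simp
  also have "\<dots> = cube_bump r q y - cube_bump r q' y"
    unfolding c c' using assms(1) by (simp add: field_simps)
  finally show ?thesis .
qed

section \<open>Moving a cube bump inside a box\<close>

context charts_with_partition
begin

lemma is_density_cube_bump:
  assumes G: "C1_in A G" and K: "compact {x \<in> A. G x \<in> cbox a e}" and r: "r > 0"
    and q: "\<And>j. a $ j + r / 2 \<le> q $ j \<and> q $ j \<le> e $ j - r / 2"
  shows "is_density {x \<in> A. G x \<in> cbox a e} (pullback_density A (\<lambda>x. cube_bump r q (G x)) G)"
proof (rule is_density_pullback[OF G _ K])
  show "continuous_on A (\<lambda>x. cube_bump r q (G x))"
    by (rule continuous_on_compose2[OF Ck_continuous_on[OF Ck_cube_bump] C1_in_continuous_on[OF G]]) simp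
  show "cube_bump r q (G x) * jacX G i x = 0" if "x \<in> A" "x \<notin> {x \<in> A. G x \<in> cbox a e}" for i x
  proof -
    have "cube_bump r q (G x) = 0"
    proof (rule ccontr)
      assume *: "cube_bump r q (G x) \<noteq> 0"
      have "a $ j \<le> G x $ j \<and> G x $ j \<le> e $ j" for j
        using cube_bump_support[OF r *, of j] q[of j] unfolding abs_less_iff by (intro conjI; linarith)
      then show False using that by (simp add: mem_box_cart)
    qed
    then show ?thesis by simp
  qed
qed auto

text \<open>\<open>f\<close> carries the primitive: its component \<open>b\<close> is
  \<open>slab_bump\<close> pulled back by \<open>G\<close>, and its Jacobian is the difference of
  the two pulled back bumps. The margin \<open>r / 2\<close> keeps the support of the primitive in
  the box, whose preimage is compact, as \<open>dint_stokes\<close> demands.\<close>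

lemma dint_cube_bump_shift_coordinate:
  assumes G: "C1_in A G" and K: "compact {x \<in> A. G x \<in> cbox a e}" and r: "r > 0"
    and q: "\<And>j. a $ j + r / 2 \<le> q $ j \<and> q $ j \<le> e $ j - r / 2"
    and q': "\<And>j. a $ j + r / 2 \<le> q' $ j \<and> q' $ j \<le> e $ j - r / 2"
    and eq: "\<And>j. j \<noteq> b \<Longrightarrow> q' $ j = q $ j"
  shows "dint (pullback_density A (\<lambda>x. cube_bump r q (G x)) G) =
    dint (pullback_density A (\<lambda>x. cube_bump r q' (G x)) G)"
proof -
  let ?K = "{x \<in> A. G x \<in> cbox a e}" and ?\<Phi> = "slab_bump b r q q'"
  let ?w = "\<lambda>q. pullback_density A (\<lambda>x. cube_bump r q (G x)) G"
  define f where "f x = set_row b (?\<Phi> (G x)) (G x)" for x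
  have "C1_in A (\<lambda>x. ?\<Phi> (G x))"
    by (rule C1_in_compose[OF G Ck_slab_bump open_UNIV]) simp
  then have f: "C1_in A f"
    unfolding f_def[abs_def] by (rule C1_in_set_row[OF _ G])
  have z: "f x $ b = 0" if "x \<in> A" "x \<notin> ?K" for x
    using slab_bump_support[OF r q q', of b "G x"] that by (auto simp: f_def)
  have jac: "jacX f i x = (cube_bump r q (G x) - cube_bump r q' (G x)) * jacX G i x"
    if i: "i \<in> I" "x \<in> U i" "x \<in> A" for i x
  proof -
    have d: "?\<Phi> differentiable (at y)" for y
      by (rule Ck_differentiable[OF Ck_slab_bump]) simp
    have Cs: "Ck (Suc 0) UNIV (\<lambda>y. set_row b (?\<Phi> y) y)"
      by (rule Ck_set_row[OF open_UNIV Ck_slab_bump Ck_bounded_linear[OF bounded_linear_ident]])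
    have ds: "(\<lambda>y. set_row b (?\<Phi> y) y) differentiable (at y)" for y
      by (rule Ck_differentiable[OF Cs]) simp
    have "jacX f i x = jac ((\<lambda>y. set_row b (?\<Phi> y) y) \<circ> (G \<circ> \<psi> i)) (\<phi> i x)"
      by (simp add: jacX_def f_def[abs_def] o_def)
    also have "\<dots> = jac (\<lambda>y. set_row b (?\<Phi> y) y) ((G \<circ> \<psi> i) (\<phi> i x)) * jac (G \<circ> \<psi> i) (\<phi> i x)"
      by (rule jac_compose[OF ds C1_in_differentiable[OF G i]])
    also have "\<dots> = (cube_bump r q (G x) - cube_bump r q' (G x)) * jacX G i x"
      using i by (simp add: jac_set_row_id[OF d] slab_bump_derivative[OF r eq] jacX_def)
    finally show ?thesis .
  qed
  have dens: "is_density ?K (pullback_density A (\<lambda>_. 1) f)"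
  proof (rule is_density_pullback[OF f continuous_on_const K])
    show "1 * jacX f i x = 0" if "i \<in> I" "x \<in> U i" "x \<in> A" "x \<notin> ?K" for i x
      using jacX_zero_component[OF f K z that] by simp
  qed auto
  have "dint (?w q) = dint (\<lambda>i x. pullback_density A (\<lambda>_. 1) f i x + ?w q' i x)"
    by (rule dint_cong) (simp add: pullback_density_def jac algebra_simps)
  also have "\<dots> = dint (pullback_density A (\<lambda>_. 1) f) + dint (?w q')"
    by (rule dint_add[OF dens is_density_cube_bump[OF G K r q']])
  also have "dint (pullback_density A (\<lambda>_. 1) f) = 0"
    by (rule dint_stokes[OF f K _ z]) auto
  finally show ?thesis by simp
qed

text \<open>The coordinates are moved one at a time; \<open>T\<close> collects those already moved.
  The intermediate centres \<open>qq T\<close> keep the margin because it is a condition on each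
  coordinate separately.\<close>

lemma dint_cube_bump_shift:
  assumes G: "C1_in A G" and K: "compact {x \<in> A. G x \<in> cbox a e}" and r: "r > 0"
    and q: "\<And>j. a $ j + r / 2 \<le> q $ j \<and> q $ j \<le> e $ j - r / 2"
    and q': "\<And>j. a $ j + r / 2 \<le> q' $ j \<and> q' $ j \<le> e $ j - r / 2"
  shows "dint (pullback_density A (\<lambda>x. cube_bump r q (G x)) G) =
    dint (pullback_density A (\<lambda>x. cube_bump r q' (G x)) G)"
proof -
  define qq where "qq T = (\<chi> j. if j \<in> T then q' $ j else q $ j)" for T
  have qq: "a $ j + r / 2 \<le> qq T $ j \<and> qq T $ j \<le> e $ j - r / 2" for T j
    using q[of j] q'[of j] by (simp add: qq_def)
  have "dint (pullback_density A (\<lambda>x. cube_bump r q (G x)) G) =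
    dint (pullback_density A (\<lambda>x. cube_bump r (qq T) (G x)) G)" if "finite T" for T
    using that
  proof (induction T rule: finite_induct)
    case empty
    have "qq {} = q" by (simp add: qq_def vec_eq_iff)
    then show ?case by simp
  next
    case (insert b T)
    have "dint (pullback_density A (\<lambda>x. cube_bump r (qq T) (G x)) G) =
      dint (pullback_density A (\<lambda>x. cube_bump r (qq (insert b T)) (G x)) G)"
      by (rule dint_cube_bump_shift_coordinate[OF G K r qq qq, of b]) (auto simp: qq_def)
    with insert.IH show ?case by simp
  qed
  moreover have "qq UNIV = q'" by (simp add: qq_def vec_eq_iff)
  ultimately show ?thesis by (metis finite)
qed

end

section \<open>Counting preimages by integration\<close>

lemma cube_bump_integrable:
  assumes "r > 0"
  shows "cube_bump r q absolutely_integrable_on UNIV"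
proof (rule continuous_compact_support_integrable(1)[OF Ck_continuous_on[OF Ck_cube_bump] compact_cbox])
  fix y assume y: "y \<notin> cbox (q - vec (r / 2)) (q + vec (r / 2))"
  show "cube_bump r q y = 0"
  proof (rule ccontr)
    assume "cube_bump r q y \<noteq> 0"
    then have *: "\<bar>y $ j - q $ j\<bar> < r / 2" for j using cube_bump_support[OF assms] by blast
    have "(q - vec (r / 2)) $ j \<le> y $ j \<and> y $ j \<le> (q + vec (r / 2)) $ j" for j
      using *[of j] unfolding abs_less_iff by (auto simp: vec_def)
    then have "y \<in> cbox (q - vec (r / 2)) (q + vec (r / 2))" by (simp add: mem_box_cart)
    with y show False by simp
  qed
qed

text \<open>All bumps of one width have the same mass, so equal integrals over \<open>X\<close>
  translate into equal counts at different centres.\<close>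

lemma integral_cube_bump_translate:
  fixes q :: "real^'k::{finite,wellorder}"
  assumes "r > 0"
  shows "integral UNIV (cube_bump r q) = integral UNIV (cube_bump r (0 :: real^'k::_))"
proof -
  let ?T = "\<lambda>x. x + q"
  have surj: "range ?T = UNIV" by (metis surj_def diff_add_cancel)
  have eq: "cube_bump r q (x + q) = cube_bump r 0 x" for x
    by (simp add: cube_bump_def)
  have "integral UNIV (\<lambda>x. \<bar>det (matrix (\<lambda>h. h) :: real^'k::_^'k::_)\<bar> * cube_bump r q (?T x)) = integral (range ?T) (cube_bump r q)"
  proof (rule integral_change_of_variables_scalar)
    show "(?T has_derivative (\<lambda>h. h)) (at x within UNIV)" for x
      by (auto intro!: derivative_eq_intros)
    show "cube_bump r q absolutely_integrable_on range ?T"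
      unfolding surj by (rule cube_bump_integrable[OF assms])
  qed auto
  moreover have "(matrix (\<lambda>h. h) :: real^'k::_^'k::_) = mat 1"
    using matrix_id_mat_1 by (simp add: id_def)
  ultimately show ?thesis unfolding surj eq by simp
qed

lemma integral_cube_bump_pos:
  fixes q :: "real^'k::{finite,wellorder}"
  assumes "r > 0"
  shows "integral UNIV (cube_bump r q) > 0"
proof -
  let ?B = "cbox (q - vec 1) (q + vec 1)"
  have cont: "continuous_on ?B (cube_bump r q)"
    using Ck_continuous_on[OF Ck_cube_bump] by (rule continuous_on_subset) simp
  have qB: "q \<in> ?B" "q \<in> box (q - vec 1) (q + vec 1)"
    by (auto simp: mem_box_cart)
  have int: "cube_bump r q integrable_on UNIV"
    using cube_bump_integrable[OF assms] set_lebesgue_integral_eq_integral(1) by blast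
  have "integral ?B (cube_bump r q) \<noteq> 0"
    using integral_cbox_eq_0_iff[OF cont _ cube_bump_nonneg] qB cube_bump_center_pos[of r q]
    by (metis empty_iff less_irrefl)
  moreover have "integral ?B (cube_bump r q) \<ge> 0"
    by (intro integral_nonneg integrable_continuous cont cube_bump_nonneg)
  moreover have "integral ?B (cube_bump r q) \<le> integral UNIV (cube_bump r q)"
    by (intro integral_subset_le int integrable_continuous cont) (auto simp: cube_bump_nonneg)
  ultimately show ?thesis by linarith
qed

lemma finite_disjoint_open_neighbourhoods:
  fixes Z :: "'x::t2_space set"
  assumes "finite Z"
  obtains Q where "\<And>z. z \<in> Z \<Longrightarrow> open (Q z) \<and> z \<in> Q z"
    "\<And>z z'. z \<in> Z \<Longrightarrow> z' \<in> Z \<Longrightarrow> z \<noteq> z' \<Longrightarrow> Q z \<inter> Q z' = {}"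
proof -
  have "\<forall>p :: 'x \<times> 'x. \<exists>AB. fst p \<noteq> snd p \<longrightarrow> open (fst AB) \<and> open (snd AB) \<and> fst p \<in> fst AB \<and> snd p \<in> snd AB \<and>
      fst AB \<inter> snd AB = {}"
  proof
    fix p :: "'x \<times> 'x"
    show "\<exists>AB. fst p \<noteq> snd p \<longrightarrow> open (fst AB) \<and> open (snd AB) \<and> fst p \<in> fst AB \<and> snd p \<in> snd AB \<and>
      fst AB \<inter> snd AB = {}"
    proof (cases "fst p = snd p")
      case False
      then obtain A B where "open A" "open B" "fst p \<in> A" "snd p \<in> B" "A \<inter> B = {}"
        using hausdorff[OF False] by blast
      then show ?thesis by (intro exI[of _ "(A, B)"]) simp
    qed simp
  qed
  from choice[OF this] obtain AB :: "'x \<times> 'x \<Rightarrow> 'x set \<times> 'x set" where AB: "\<And>p. fst p \<noteq> snd p \<Longrightarrow> open (fst (AB p)) \<and> open (snd (AB p)) \<and>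
      fst p \<in> fst (AB p) \<and> snd p \<in> snd (AB p) \<and> fst (AB p) \<inter> snd (AB p) = {}"
    by blast
  \<comment> \<open>The pairs for \<open>(z, z')\<close> and \<open>(z', z)\<close> are chosen
    independently of each other. Intersecting a first component of the one with a second component
    of the other puts \<open>Q z\<close> and \<open>Q z'\<close> on opposite sides of a single
    pair.\<close>
  define Q where "Q z = (\<Inter>z'\<in>Z - {z}. fst (AB (z, z')) \<inter> snd (AB (z', z)))" for z
  show ?thesis
  proof (rule that[of Q])
    fix z assume "z \<in> Z"
    have "open (fst (AB (z, z')) \<inter> snd (AB (z', z)))" "z \<in> fst (AB (z, z')) \<inter> snd (AB (z', z))"
      if "z' \<in> Z - {z}" for z'
      using AB[of "(z, z')"] AB[of "(z', z)"] that by auto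
    then show "open (Q z) \<and> z \<in> Q z"
      unfolding Q_def using assms by (intro conjI open_INT) auto
  next
    fix z z' assume "z \<in> Z" "z' \<in> Z" "z \<noteq> z'"
    then have "Q z \<subseteq> fst (AB (z, z'))" "Q z' \<subseteq> snd (AB (z, z'))"
      unfolding Q_def by blast+
    then show "Q z \<inter> Q z' = {}" using AB[of "(z, z')"] \<open>z \<noteq> z'\<close> by auto
  qed
qed

section \<open>Sheets over a regular value\<close>

lemma C1_local_homeomorphism:
  fixes F :: "real^'k \<Rightarrow> real^'k"
  assumes W: "open W" and F: "Ck (Suc 0) W F" and y: "y \<in> W" and nz: "jac F y \<noteq> 0"
  obtains V where "open V" "V \<subseteq> W" "y \<in> V" "inj_on F V" "open (F ` V)"
proof -
  define F' where "F' x = Blinfun (frechet_derivative F (at x))" for x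
  have bl: "bounded_linear (frechet_derivative F (at x))" if "x \<in> W" for x
    using F that linear_frechet_derivative by (intro linear_conv_bounded_linear[THEN iffD1]) auto
  have F': "blinfun_apply (F' x) = frechet_derivative F (at x)" if "x \<in> W" for x
    unfolding F'_def by (rule bounded_linear_Blinfun_apply[OF bl[OF that]])
  have der: "(F has_derivative blinfun_apply (F' x)) (at x)" if "x \<in> W" for x
    unfolding F'[OF that] using F that by (intro has_derivative_frechet) simp
  have cont: "continuous_on W F'"
  proof (rule continuous_on_blinfun_componentwise)
    fix b :: "real^'k" assume "b \<in> Basis"
    then have "continuous_on W (\<lambda>x. frechet_derivative F (at x) b)" using F by simp
    then show "continuous_on W (\<lambda>x. blinfun_apply (F' x) b)"
      by (rule continuous_on_eq) (simp add: F')
  qed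
  have "inj (frechet_derivative F (at y))"
    using nz det_nz_iff_inj[of "frechet_derivative F (at y)"] bl[OF y]
    by (simp add: jac_def bounded_linear.linear)
  then obtain g where g: "linear g" "g \<circ> frechet_derivative F (at y) = id"
    using linear_injective_left_inverse[OF bounded_linear.linear[OF bl[OF y]]] by blast
  have "bounded_linear g" using g(1) linear_conv_bounded_linear by blast
  then have inv: "Blinfun g o\<^sub>L F' y = id_blinfun"
    using g(2) by (intro blinfun_eqI) (simp add: F'[OF y] bounded_linear_Blinfun_apply pointfree_idE)
  show ?thesis
  proof (rule inverse_function_theorem[OF W der cont y inv])
    fix U' V g0
    assume "open U'" "U' \<subseteq> W" "y \<in> U'" "open V" and hom: "homeomorphism U' V F g0"
    moreover have "inj_on F U'" using hom by (auto simp: homeomorphism_def intro: inj_on_inverseI)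
    moreover have "F ` U' = V" using hom by (simp add: homeomorphism_def)
    ultimately show ?thesis using that by blast
  qed
qed

context oriented_charts
begin

text \<open>The choice of chart is harmless by \<open>jacX_sgn\<close>. A real-valued sign can be
  multiplied with integrals directly.\<close>

definition orientation_sign :: "('x \<Rightarrow> (real, 'k) vec) \<Rightarrow> 'x \<Rightarrow> real" where
  "orientation_sign G x = sgn (jacX G (SOME i. i \<in> I \<and> x \<in> U i) x)"

lemma orientation_sign_eq:
  assumes "C1_in A G" "i \<in> I" "x \<in> U i" "x \<in> A"
  shows "orientation_sign G x = sgn (jacX G i x)"
proof -
  let ?i = "SOME i. i \<in> I \<and> x \<in> U i"
  have "?i \<in> I \<and> x \<in> U ?i" using assms(2,3) by (metis (mono_tags, lifting) someI)
  then show ?thesis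
    unfolding orientation_sign_def using jacX_sgn[OF assms(1), of ?i i x] assms by blast
qed

lemma regular_point_neighbourhood:
  assumes G: "C1_in A G" and z: "i \<in> I" "z \<in> U i" "z \<in> A" and nz: "jacX G i z \<noteq> 0"
    and Q: "open Q" "z \<in> Q"
  obtains N where "openin (top_of_set X) N" "z \<in> N" "N \<subseteq> U i \<inter> A \<inter> Q" "inj_on G N" "open (G ` N)"
    "\<And>x. x \<in> N \<Longrightarrow> sgn (jacX G i x) = sgn (jacX G i z)"
proof -
  let ?F = "G \<circ> \<psi> i"
  have A: "openin (top_of_set X) A" "A \<subseteq> X" using C1_in_openin[OF G] openin_imp_subset by auto
  have AQ: "openin (top_of_set X) (A \<inter> Q)"
    using openin_Int_open[OF A(1) Q(1)] .
  let ?W0 = "\<phi> i ` (U i \<inter> (A \<inter> Q))"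
  have W0: "open ?W0" by (rule chart_image_open[OF z(1) AQ])
  have F: "Ck (Suc 0) ?W0 ?F"
    by (rule Ck_subset[OF C1_in_Ck[OF G z(1)]]) blast
  \<comment> \<open>The product with the Jacobian at \<open>z\<close> is positive exactly where the
    sign is the same as at \<open>z\<close>.\<close>
  define W where "W = ?W0 \<inter> (\<lambda>y. jac ?F y * jacX G i z) -` {0<..}"
  have "continuous_on ?W0 (\<lambda>y. jac ?F y * jacX G i z)"
    by (intro continuous_on_mult continuous_on_jac F continuous_on_const)
  then have W: "open W"
    unfolding W_def by (rule continuous_open_preimage[OF _ W0]) simp
  have zW: "\<phi> i z \<in> W"
    using z Q nz unfolding W_def by (auto simp: jacX_def zero_less_mult_iff linorder_neq_iff)
  have FW: "Ck (Suc 0) W ?F" by (rule Ck_subset[OF F]) (auto simp: W_def)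
  have "jac ?F (\<phi> i z) \<noteq> 0" using nz by (simp add: jacX_def)
  then obtain V where V: "open V" "V \<subseteq> W" "\<phi> i z \<in> V" "inj_on ?F V" "open (?F ` V)"
    using C1_local_homeomorphism[OF W FW zW] by metis
  define N where "N = U i \<inter> \<phi> i -` V"
  have VU: "V \<subseteq> \<phi> i ` U i" using V(2) unfolding W_def by blast
  have \<phi>N: "\<phi> i ` N = V" using VU unfolding N_def by blast
  have "(\<lambda>x. \<psi> i (\<phi> i x)) ` N = (\<lambda>x. x) ` N"
    by (rule image_cong) (use z(1) in \<open>auto simp: N_def\<close>)
  then have N\<psi>: "N = \<psi> i ` V" unfolding \<phi>N[symmetric] image_image by simp
  have "openin (top_of_set (U i)) N"
    unfolding N_def by (rule continuous_openin_preimage_gen[OF chart_continuous[OF z(1)] V(1)])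
  then have op: "openin (top_of_set X) N"
    using chart_openin[OF z(1)] openin_trans by blast
  have sub: "\<exists>x'. x' \<in> U i \<inter> (A \<inter> Q) \<and> \<phi> i x = \<phi> i x'" "jac ?F (\<phi> i x) * jacX G i z > 0" if "x \<in> N" for x
    using that V(2) unfolding N_def W_def by auto
  have NA: "N \<subseteq> U i \<inter> A \<inter> Q"
  proof
    fix x assume x: "x \<in> N"
    then obtain x' where "x' \<in> U i \<inter> (A \<inter> Q)" "\<phi> i x = \<phi> i x'" using sub(1) by blast
    moreover have "x \<in> U i" using x by (simp add: N_def)
    ultimately show "x \<in> U i \<inter> A \<inter> Q" using inj_onD[OF chart_inj[OF z(1)]] by blast
  qed
  show ?thesis
  proof (rule that[OF op _ NA])
    show "z \<in> N" using z V(3) by (simp add: N_def)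
    show "inj_on G N"
    proof (rule inj_onI)
      fix x y assume xy: "x \<in> N" "y \<in> N" "G x = G y"
      then have "x \<in> U i" "y \<in> U i" using NA by blast+
      then have "?F (\<phi> i x) = ?F (\<phi> i y)" using xy(3) z(1) by simp
      then have "\<phi> i x = \<phi> i y" using inj_onD[OF V(4)] xy \<phi>N by blast
      then show "x = y" using inj_onD[OF chart_inj[OF z(1)]] xy NA by blast
    qed
    have "G ` N = ?F ` V" unfolding N\<psi> by (simp add: image_image)
    then show "open (G ` N)" using V(5) by simp
    show "sgn (jacX G i x) = sgn (jacX G i z)" if "x \<in> N" for x
      using sub(2)[OF that] unfolding jacX_def[of _ _ x] by (auto simp: zero_less_mult_iff)
  qed
qed

end

section \<open>Signed counts as integrals of bumps\<close>

context charts_with_partition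
begin

text \<open>Over a small cube around a regular value the preimage consists of disjoint sheets, one
  for each preimage of \<open>q\<close>, on which \<open>G\<close> is injective with Jacobian of
  constant sign. By change of variables each sheet contributes its sign times the mass of the bump.
  Compactness of the preimage of the box makes the fibre finite and excludes further points over a
  small cube.\<close>

lemma dint_cube_bump_count:
  assumes G: "C1_in A G" and K: "compact {x \<in> A. G x \<in> cbox a e}" and q: "q \<in> box a e"
    and reg: "\<And>i x. i \<in> I \<Longrightarrow> x \<in> U i \<Longrightarrow> x \<in> A \<Longrightarrow> G x = q \<Longrightarrow> jacX G i x \<noteq> 0"
  shows "\<exists>\<rho>>0. \<forall>r. 0 < r \<longrightarrow> r < \<rho> \<longrightarrow> dint (pullback_density A (\<lambda>x. cube_bump r q (G x)) G) =
       (\<Sum>x | x \<in> A \<and> G x = q. orientation_sign G x) * integral UNIV (cube_bump r (0 :: (real, 'k) vec))"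
proof -
  let ?K = "{x \<in> A. G x \<in> cbox a e}"
  define Z where "Z = {x. x \<in> A \<and> G x = q}"
  have A: "openin (top_of_set X) A" "A \<subseteq> X" using C1_in_openin[OF G] openin_imp_subset by auto
  have contG: "continuous_on A G" by (rule C1_in_continuous_on[OF G])
  have ZK: "Z \<subseteq> ?K" using q box_subset_cbox unfolding Z_def by blast
  have ex_chart: "\<exists>i. i \<in> I \<and> z \<in> U i" if "z \<in> A" for z using that A(2) cover by blast
  have nbhd: "\<exists>i N. i \<in> I \<and> openin (top_of_set X) N \<and> z \<in> N \<and> N \<subseteq> U i \<inter> A \<inter> Q \<and> inj_on G N \<and> open (G ` N) \<and>
      (\<forall>x\<in>N. sgn (jacX G i x) = sgn (jacX G i z))" if z: "z \<in> Z" and Q: "open Q" "z \<in> Q" for z Q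
  proof -
    have zA: "z \<in> A" "G z = q" using z by (auto simp: Z_def)
    obtain i where i: "i \<in> I" "z \<in> U i" using ex_chart[OF zA(1)] by blast
    have nz: "jacX G i z \<noteq> 0" by (rule reg[OF i zA])
    show ?thesis
      using regular_point_neighbourhood[OF G i zA(1) nz Q] i(1) by metis
  qed
  have finZ: "finite Z"
  proof -
    have "\<exists>S. open S \<and> z \<in> S \<and> Z \<inter> S \<subseteq> {z}" if z: "z \<in> Z" for z
    proof -
      obtain N where N: "openin (top_of_set X) N" "z \<in> N" "inj_on G N"
        using nbhd[OF z open_UNIV] by blast
      then obtain S where S: "open S" "N = X \<inter> S" unfolding openin_open by blast
      have "Z \<inter> S \<subseteq> {z}"
      proof
        fix x assume "x \<in> Z \<inter> S"
        then have "x \<in> N" "G x = G z" using S(2) A(2) z by (auto simp: Z_def)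
        then show "x \<in> {z}" using inj_onD[OF N(3)] N(2) by blast
      qed
      then show ?thesis using S N(2) by blast
    qed
    then obtain S where S: "\<And>z. z \<in> Z \<Longrightarrow> open (S z) \<and> z \<in> S z \<and> Z \<inter> S z \<subseteq> {z}" by metis
    have "closedin (top_of_set ?K) {x \<in> ?K. G x = q}"
      by (rule continuous_closedin_preimage_constant[OF continuous_on_subset[OF contG]]) blast
    moreover have "{x \<in> ?K. G x = q} = Z" using ZK by (auto simp: Z_def)
    ultimately have "compact Z" using K closedin_compact by metis
    then obtain T where T: "T \<subseteq> Z" "finite T" "Z \<subseteq> (\<Union>z\<in>T. S z)"
      by (rule compactE_image[of Z Z S]) (use S in blast)+
    have "Z \<subseteq> T" using S T by blast
    then show ?thesis using T(2) finite_subset by blast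
  qed
  obtain Q where Q: "\<And>z. z \<in> Z \<Longrightarrow> open (Q z) \<and> z \<in> Q z"
    "\<And>z z'. z \<in> Z \<Longrightarrow> z' \<in> Z \<Longrightarrow> z \<noteq> z' \<Longrightarrow> Q z \<inter> Q z' = {}"
    using finite_disjoint_open_neighbourhoods[OF finZ] by metis
  have "\<forall>z\<in>Z. \<exists>i N. i \<in> I \<and> openin (top_of_set X) N \<and> z \<in> N \<and> N \<subseteq> U i \<inter> A \<inter> Q z \<and> inj_on G N \<and> open (G ` N) \<and>
      (\<forall>x\<in>N. sgn (jacX G i x) = sgn (jacX G i z))"
    using nbhd Q(1) by blast
  then obtain ch N where N: "\<And>z. z \<in> Z \<Longrightarrow> ch z \<in> I \<and> openin (top_of_set X) (N z) \<and> z \<in> N z \<and>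
      N z \<subseteq> U (ch z) \<inter> A \<inter> Q z \<and> inj_on G (N z) \<and> open (G ` N z) \<and>
      (\<forall>x\<in>N z. sgn (jacX G (ch z) x) = sgn (jacX G (ch z) z))"
    by metis
  have disj: "N z \<inter> N z' = {}" if "z \<in> Z" "z' \<in> Z" "z \<noteq> z'" for z z'
    using Q(2)[OF that] N[OF that(1)] N[OF that(2)] by blast
  have "\<exists>S. open S \<and> N z = X \<inter> S" if "z \<in> Z" for z
    using N[OF that] unfolding openin_open by blast
  then obtain S where S: "\<And>z. z \<in> Z \<Longrightarrow> open (S z) \<and> N z = X \<inter> S z" by metis
  \<comment> \<open>The part of the preimage of the box outside the sheets. Its image is compact and
    misses \<open>q\<close>, so a whole ball around \<open>q\<close> misses it.\<close>
  define R where "R = ?K - (\<Union>z\<in>Z. S z)"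
  have R: "compact R" unfolding R_def by (rule compact_diff[OF K]) (use S in auto)
  have "compact (G ` R)"
    by (rule compact_continuous_image[OF continuous_on_subset[OF contG] R]) (auto simp: R_def)
  then have op: "open (box a e \<inter> (\<Inter>z\<in>Z. G ` N z) - G ` R)"
    using finZ N by (intro open_Diff open_Int open_INT open_box) (auto simp: compact_imp_closed)
  have "q \<notin> G ` R"
  proof
    assume "q \<in> G ` R"
    then obtain x where x: "x \<in> R" "G x = q" by blast
    then have "x \<in> Z" by (auto simp: R_def Z_def)
    then have "x \<in> S x" using N[of x] S[of x] by blast
    then show False using x(1) \<open>x \<in> Z\<close> by (auto simp: R_def)
  qed
  moreover have "q \<in> G ` N z" if "z \<in> Z" for z
    using N[OF that] that by (auto simp: Z_def image_iff)
  ultimately have "q \<in> box a e \<inter> (\<Inter>z\<in>Z. G ` N z) - G ` R" using q by blast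
  from bspec[OF iffD1[OF open_contains_cball op] this]
  obtain \<epsilon> where \<epsilon>: "\<epsilon> > 0" "cball q \<epsilon> \<subseteq> box a e \<inter> (\<Inter>z\<in>Z. G ` N z) - G ` R"
    by (elim exE conjE)
  show ?thesis
  \<comment> \<open>The norm is at most the sum of \<open>CARD('k)\<close> coordinate deviations,
    each at most \<open>r\<close>. So the cube lies in the ball of radius
    \<open>\<epsilon>\<close>.\<close>
  proof (intro exI[of _ "\<epsilon> / CARD('k)"] conjI allI impI)
    show "\<epsilon> / CARD('k) > 0" using \<epsilon>(1) by simp
    fix r :: real assume r: "0 < r" "r < \<epsilon> / CARD('k)"
    let ?h = "\<lambda>x. cube_bump r q (G x)"
    have supp: "y \<in> cball q \<epsilon>" if "cube_bump r q y \<noteq> 0" for y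
    proof -
      have "norm (y - q) \<le> (\<Sum>j\<in>UNIV. \<bar>(y - q) $ j\<bar>)" by (rule norm_le_l1_cart)
      also have "\<dots> \<le> (\<Sum>j\<in>(UNIV :: 'k set). r)"
      proof (rule sum_mono)
        fix j show "\<bar>(y - q) $ j\<bar> \<le> r"
          using cube_bump_support[OF r(1) that, of j] r(1) by simp
      qed
      also have "\<dots> \<le> \<epsilon>" using r by (simp add: field_simps)
      finally show ?thesis by (simp add: dist_norm norm_minus_commute)
    qed
    define C where "C = {x \<in> ?K. G x \<in> cball q \<epsilon>}"
    have "closedin (top_of_set ?K) (?K \<inter> G -` cball q \<epsilon>)"
      by (rule continuous_closedin_preimage[OF continuous_on_subset[OF contG]]) auto
    moreover have "?K \<inter> G -` cball q \<epsilon> = C" by (auto simp: C_def)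
    ultimately have C: "compact C" using K closedin_compact by metis
    have CN: "C \<subseteq> (\<Union>z\<in>Z. N z)"
    proof
      fix x assume x: "x \<in> C"
      then have "G x \<notin> G ` R" using \<epsilon>(2) by (auto simp: C_def)
      then have "x \<notin> R" by blast
      then obtain z where "z \<in> Z" "x \<in> S z" using x by (auto simp: C_def R_def)
      moreover have "x \<in> X" using x A(2) by (auto simp: C_def)
      ultimately show "x \<in> (\<Union>z\<in>Z. N z)" using S by blast
    qed
    have hC: "x \<in> C" if "x \<in> A" "?h x \<noteq> 0" for x
    proof -
      have "G x \<in> cball q \<epsilon>" using supp that(2) by blast
      moreover then have "G x \<in> cbox a e" using \<epsilon>(2) box_subset_cbox by blast
      ultimately show ?thesis using that(1) by (simp add: C_def)
    qed
    \<comment> \<open>A density needs compact support, but the sheet \<open>N z\<close> is only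
      relatively open. Removing all other sheets from the compact set \<open>C\<close> leaves a
      compact part of \<open>N z\<close>.\<close>
    define D where "D z = C - (\<Union>z'\<in>Z - {z}. S z')" for z
    have D: "compact (D z)" for z unfolding D_def by (rule compact_diff[OF C]) (use S in auto)
    have DN: "D z \<subseteq> N z" if "z \<in> Z" for z
    proof
      fix x assume x: "x \<in> D z"
      then obtain z' where "z' \<in> Z" "x \<in> N z'" using CN by (auto simp: D_def)
      then show "x \<in> N z" using x S[of z'] by (cases "z' = z") (auto simp: D_def)
    qed
    have hD: "x \<in> D z" if z: "z \<in> Z" and x: "x \<in> N z" "?h x \<noteq> 0" for x z
    proof -
      have "x \<in> C" using N[OF z] x by (intro hC) auto
      moreover have "x \<notin> S z'" if "z' \<in> Z - {z}" for z'
      proof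
        assume "x \<in> S z'"
        moreover have "x \<in> X" using x N[OF z] A(2) by blast
        ultimately have "x \<in> N z'" using S[of z'] that by blast
        then show False using disj[of z z'] z that x(1) by blast
      qed
      ultimately show ?thesis by (simp add: D_def)
    qed
    have GN: "C1_in (N z) G" if "z \<in> Z" for z
      using C1_in_subset[OF G] N[OF that] by blast
    have dens: "is_density (D z) (pullback_density (N z) ?h G)" if z: "z \<in> Z" for z
    proof (rule is_density_pullback[OF GN[OF z] _ D DN[OF z]])
      show "continuous_on (N z) ?h"
        by (rule continuous_on_compose2[OF Ck_continuous_on[OF Ck_cube_bump] C1_in_continuous_on[OF GN[OF z]]]) simp
      show "?h x * jacX G i x = 0" if "x \<in> N z" "x \<notin> D z" for i x
        using hD[OF z] that by auto
    qed
    have split: "pullback_density A ?h G i x = (\<Sum>z\<in>Z. pullback_density (N z) ?h G i x)"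
      if "x \<in> U i" for i x
    proof (cases "x \<in> A \<and> ?h x \<noteq> 0")
      case True
      then obtain z where z: "z \<in> Z" "x \<in> N z" using hC CN by blast
      have "(\<Sum>z\<in>Z. pullback_density (N z) ?h G i x) = (\<Sum>z'\<in>Z. if z' = z then ?h x * jacX G i x else 0)"
        by (rule sum.cong[OF refl]) (use z disj in \<open>auto simp: pullback_density_def\<close>)
      then show ?thesis using z(1) finZ True by (simp add: pullback_density_def)
    next
      case False
      have "pullback_density (N z) ?h G i x = 0" if "z \<in> Z" for z
        using False N[OF that] by (auto simp: pullback_density_def)
      then show ?thesis using False by (auto simp: pullback_density_def)
    qed
    have local: "dint (pullback_density (N z) ?h G) = orientation_sign G z * integral UNIV (cube_bump r (0 :: (real, 'k) vec))"
      if z: "z \<in> Z" for z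
    proof -
      let ?i = "ch z" and ?F = "G \<circ> \<psi> (ch z)"
      let ?V = "\<phi> (ch z) ` N z" and ?s = "sgn (jacX G (ch z) z)"
      have i: "?i \<in> I" and NU: "N z \<subseteq> U ?i" and NA: "N z \<subseteq> A" and injN: "inj_on G (N z)" and zN: "z \<in> N z"
        and opG: "open (G ` N z)"
        using N[OF z] by auto
      have sg: "sgn (jacX G ?i x) = ?s" if "x \<in> N z" for x
        using N[OF z] that by blast
      have V: "open ?V"
        using chart_image_open[OF i, of "N z"] N[OF z] NU by (simp add: Int_absorb1)
      have FV: "?F ` ?V = G ` N z"
        unfolding image_image by (rule image_cong) (use NU i in auto)
      have qN: "y \<in> G ` N z" if "cube_bump r q y \<noteq> 0" for y
        using supp[OF that] \<epsilon>(2) z by blast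
      have "dint (pullback_density (N z) ?h G) = chart_integral ?i (pullback_density (N z) ?h G ?i)"
        by (rule dint_local[OF dens[OF z] i]) (use DN[OF z] NU in blast)
      also have "\<dots> = integral UNIV (\<lambda>y. if y \<in> ?V then ?s * (\<bar>det (matrix (frechet_derivative ?F (at y)))\<bar> * cube_bump r q (?F y)) else 0)"
        unfolding chart_integral_def
      proof (rule arg_cong[where f = "integral UNIV"], rule ext)
        fix y
        show "(if y \<in> \<phi> ?i ` U ?i then pullback_density (N z) ?h G ?i (\<psi> ?i y) else 0) =
          (if y \<in> ?V then ?s * (\<bar>det (matrix (frechet_derivative ?F (at y)))\<bar> * cube_bump r q (?F y)) else 0)"
        proof (cases "y \<in> \<phi> ?i ` U ?i")
          case True
          then obtain x where x: "x \<in> U ?i" "y = \<phi> ?i x" by blast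
          have mem: "y \<in> ?V \<longleftrightarrow> x \<in> N z"
            using chart_mem_image[OF i x(1) NU] x(2) by simp
          show ?thesis
          proof (cases "x \<in> N z")
            case True
            \<comment> \<open>The sign, constant on the sheet, is split off; the absolute value that
              remains is what the change of variables formula asks for.\<close>
            have "jacX G ?i x = ?s * \<bar>jacX G ?i x\<bar>"
              using sg[OF True] by (metis mult.commute abs_mult_sgn)
            then have "?h x * jacX G ?i x = ?s * (\<bar>jacX G ?i x\<bar> * ?h x)" by simp
            then show ?thesis
              using x True mem i by (simp add: pullback_density_def jacX_def jac_def)
          qed (use x mem i in \<open>simp add: pullback_density_def\<close>)
        qed (use NU in auto)
      qed
      also have "\<dots> = integral ?V (\<lambda>y. ?s * (\<bar>det (matrix (frechet_derivative ?F (at y)))\<bar> * cube_bump r q (?F y)))"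
        by (rule integral_restrict_UNIV)
      also have "\<dots> = ?s * integral ?V (\<lambda>y. \<bar>det (matrix (frechet_derivative ?F (at y)))\<bar> * cube_bump r q (?F y))"
        by (rule integral_mult_right)
      also have "integral ?V (\<lambda>y. \<bar>det (matrix (frechet_derivative ?F (at y)))\<bar> * cube_bump r q (?F y)) =
          integral (?F ` ?V) (cube_bump r q)"
      proof (rule integral_change_of_variables_scalar)
        show "?V \<in> sets lebesgue" using V by simp
        show "(?F has_derivative frechet_derivative ?F (at y)) (at y within ?V)" if y: "y \<in> ?V" for y
        proof -
          obtain x where x: "x \<in> N z" "y = \<phi> ?i x" using y by blast
          have "?F differentiable (at y)"
            unfolding x(2) by (rule C1_in_differentiable[OF G i]) (use x NU NA in auto)
          then show ?thesis by (rule has_derivative_at_withinI[OF has_derivative_frechet])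
        qed
        show "inj_on ?F ?V"
        proof (rule inj_onI)
          fix u v assume "u \<in> ?V" "v \<in> ?V" and eq: "?F u = ?F v"
          then obtain x y where xy: "x \<in> N z" "u = \<phi> ?i x" "y \<in> N z" "v = \<phi> ?i y" by blast
          then have "x \<in> U ?i" "y \<in> U ?i" using NU by blast+
          then have "G x = G y" using eq i xy by simp
          then have "x = y" using inj_onD[OF injN] xy by blast
          then show "u = v" using xy by simp
        qed
        have "?F ` ?V \<in> sets lebesgue" unfolding FV using opG by simp
        then show "cube_bump r q absolutely_integrable_on ?F ` ?V"
          using set_integrable_subset[OF cube_bump_integrable[OF r(1)]] by simp
      qed
      also have "integral (?F ` ?V) (cube_bump r q) = integral UNIV (\<lambda>y. if y \<in> G ` N z then cube_bump r q y else 0)"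
        unfolding FV by (rule integral_restrict_UNIV[symmetric])
      also have "(\<lambda>y. if y \<in> G ` N z then cube_bump r q y else 0) = cube_bump r q"
        using qN by (auto simp: fun_eq_iff)
      also have "integral UNIV (cube_bump r q) = integral UNIV (cube_bump r (0 :: (real, 'k) vec))"
        by (rule integral_cube_bump_translate[OF r(1)])
      also have "?s = orientation_sign G z"
        by (rule orientation_sign_eq[OF G i, symmetric]) (use zN NU NA in auto)
      finally show ?thesis .
    qed
    have "dint (pullback_density A ?h G) = dint (\<lambda>i x. \<Sum>z\<in>Z. pullback_density (N z) ?h G i x)"
      by (rule dint_cong) (rule split)
    also have "\<dots> = (\<Sum>z\<in>Z. dint (pullback_density (N z) ?h G))"
      by (rule dint_sum[OF finZ dens])
    also have "\<dots> = (\<Sum>z\<in>Z. orientation_sign G z) * integral UNIV (cube_bump r (0 :: (real, 'k) vec))"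
      by (simp add: local sum_distrib_right)
    finally show "dint (pullback_density A ?h G) =
       (\<Sum>x | x \<in> A \<and> G x = q. orientation_sign G x) * integral UNIV (cube_bump r (0 :: (real, 'k) vec))"
      by (simp only: Z_def)
  qed
qed

lemma signed_count_eq_in_box_aux:
  assumes G: "C1_in A G" and K: "compact {x \<in> A. G x \<in> cbox a e}" and q: "q \<in> box a e" and q': "q' \<in> box a e"
    and reg: "\<And>i x. i \<in> I \<Longrightarrow> x \<in> U i \<Longrightarrow> x \<in> A \<Longrightarrow> G x = q \<Longrightarrow> jacX G i x \<noteq> 0"
    and reg': "\<And>i x. i \<in> I \<Longrightarrow> x \<in> U i \<Longrightarrow> x \<in> A \<Longrightarrow> G x = q' \<Longrightarrow> jacX G i x \<noteq> 0"
  shows "(\<Sum>x | x \<in> A \<and> G x = q. orientation_sign G x) = (\<Sum>x | x \<in> A \<and> G x = q'. orientation_sign G x)"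
proof -
  have margin: "\<exists>\<delta>>0. \<forall>j. a $ j + \<delta> \<le> q $ j \<and> q $ j \<le> e $ j - \<delta>" if "q \<in> box a e" for q
  proof -
    let ?m = "\<lambda>j. min (q $ j - a $ j) (e $ j - q $ j)"
    have "Min (range ?m) > 0" using that by (simp add: mem_box_cart)
    moreover have "Min (range ?m) \<le> ?m j" for j by (rule Min_le) auto
    ultimately show ?thesis by (intro exI[of _ "Min (range ?m)"]) (auto simp: min_le_iff_disj le_diff_eq add.commute)
  qed
  obtain \<delta> where \<delta>: "\<delta> > 0" "\<And>j. a $ j + \<delta> \<le> q $ j \<and> q $ j \<le> e $ j - \<delta>" using margin[OF q] by blast
  obtain \<delta>' where \<delta>': "\<delta>' > 0" "\<And>j. a $ j + \<delta>' \<le> q' $ j \<and> q' $ j \<le> e $ j - \<delta>'" using margin[OF q'] by blast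
  let ?J = "\<lambda>r. integral UNIV (cube_bump r (0 :: (real, 'k) vec))"
  let ?D = "\<lambda>r q. dint (pullback_density A (\<lambda>x. cube_bump r q (G x)) G)"
  obtain \<rho> where \<rho>: "\<rho> > 0" "\<And>r. 0 < r \<Longrightarrow> r < \<rho> \<Longrightarrow> ?D r q = (\<Sum>x | x \<in> A \<and> G x = q. orientation_sign G x) * ?J r"
    using dint_cube_bump_count[OF G K q reg] by blast
  obtain \<rho>' where \<rho>': "\<rho>' > 0" "\<And>r. 0 < r \<Longrightarrow> r < \<rho>' \<Longrightarrow> ?D r q' = (\<Sum>x | x \<in> A \<and> G x = q'. orientation_sign G x) * ?J r"
    using dint_cube_bump_count[OF G K q' reg'] by blast
  \<comment> \<open>One width that suits both centres. Halving makes the inequalities with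
    \<open>\<rho>\<close> and \<open>\<rho>'\<close> strict.\<close>
  define r where "r = min (min \<delta> \<delta>') (min \<rho> \<rho>') / 2"
  have r: "0 < r" "r < \<rho>" "r < \<rho>'" "r / 2 \<le> \<delta>" "r / 2 \<le> \<delta>'"
    using \<delta>(1) \<delta>'(1) \<rho>(1) \<rho>'(1) by (auto simp: r_def min_def)
  have "?D r q = ?D r q'"
  proof (rule dint_cube_bump_shift[OF G K r(1)])
    show "a $ j + r / 2 \<le> q $ j \<and> q $ j \<le> e $ j - r / 2" for j using \<delta>(2)[of j] r(4) by auto
    show "a $ j + r / 2 \<le> q' $ j \<and> q' $ j \<le> e $ j - r / 2" for j using \<delta>'(2)[of j] r(5) by auto
  qed
  then show ?thesis
    using \<rho>(2)[OF r(1,2)] \<rho>'(2)[OF r(1,3)] integral_cube_bump_pos[OF r(1), of "0 :: (real, 'k) vec"] by simp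
qed

end

text \<open>The statement does not mention a partition of unity, so any one supplied by
  \<open>partition_of_unity\<close> may be interpreted.\<close>

theorem (in oriented_charts) signed_count_eq_in_box:
  assumes "C1_in A G" "compact {x \<in> A. G x \<in> cbox a e}" "q \<in> box a e" "q' \<in> box a e"
    "\<And>i x. i \<in> I \<Longrightarrow> x \<in> U i \<Longrightarrow> x \<in> A \<Longrightarrow> G x = q \<Longrightarrow> jacX G i x \<noteq> 0"
    "\<And>i x. i \<in> I \<Longrightarrow> x \<in> U i \<Longrightarrow> x \<in> A \<Longrightarrow> G x = q' \<Longrightarrow> jacX G i x \<noteq> 0"
  shows "(\<Sum>x | x \<in> A \<and> G x = q. orientation_sign G x) = (\<Sum>x | x \<in> A \<and> G x = q'. orientation_sign G x)"
proof (rule partition_of_unity)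
  fix P :: "'x set" and c :: "'x \<Rightarrow> 'i" and \<theta> :: "'x \<Rightarrow> 'x \<Rightarrow> real" and L :: "'x \<Rightarrow> 'x set"
  assume *: "finite P" "\<And>p. p \<in> P \<Longrightarrow> c p \<in> I" "\<And>p. p \<in> P \<Longrightarrow> C1_in X (\<theta> p)"
    "\<And>p. p \<in> P \<Longrightarrow> compact (L p) \<and> L p \<subseteq> U (c p)"
    "\<And>p x. p \<in> P \<Longrightarrow> x \<in> X \<Longrightarrow> x \<notin> L p \<Longrightarrow> \<theta> p x = 0"
    "\<And>x. x \<in> X \<Longrightarrow> (\<Sum>p\<in>P. \<theta> p x) = 1"
  interpret charts_with_partition X I U \<phi> \<psi> P c \<theta> L
    by unfold_locales (rule *; assumption)+
  show ?thesis by (rule signed_count_eq_in_box_aux[OF assms])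
qed

section \<open>Oriented atlases\<close>

lemma open_to_vec_image:
  assumes "open S"
  shows "open (to_vec ` S)"
proof -
  have "to_vec ` S = of_vec -` S"
    by (auto simp: image_iff) (metis to_vec_of_vec)
  moreover have "open (of_vec -` S)"
    by (rule open_vimage[OF assms]) (rule linear_continuous_on[OF bounded_linear_of_vec])
  ultimately show ?thesis by simp
qed

lemma Ck_to_vec:
  assumes "open S" "Ck k S f"
  shows "Ck k (to_vec ` S) (to_vec \<circ> f \<circ> of_vec)"
proof -
  have "Ck k (to_vec ` S) (\<lambda>v. f (of_vec v))"
    by (rule Ck_compose[OF open_to_vec_image[OF assms(1)] Ck_bounded_linear[OF bounded_linear_of_vec] assms(2,1)]) auto
  then have "Ck k (to_vec ` S) (\<lambda>v. to_vec (f (of_vec v)))"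
    by (rule Ck_compose[OF open_to_vec_image[OF assms(1)] _ Ck_bounded_linear[OF bounded_linear_to_vec, of k UNIV] open_UNIV]) simp
  then show ?thesis by (simp only: o_def)
qed

lemma jac_to_vec:
  assumes "f differentiable (at y)"
  shows "jac (to_vec \<circ> f \<circ> of_vec) (to_vec y) = endo_det (frechet_derivative f (at y))"
proof -
  have "(f has_derivative frechet_derivative f (at y)) (at (of_vec (to_vec y)))"
    using has_derivative_frechet[OF assms] by simp
  then have "((to_vec \<circ> f \<circ> of_vec) has_derivative (to_vec \<circ> frechet_derivative f (at y) \<circ> of_vec)) (at (to_vec y))"
    by (intro diff_chain_at bounded_linear_imp_has_derivative bounded_linear_of_vec bounded_linear_to_vec)
  then show ?thesis
    unfolding jac_def endo_det_eq_det by (simp add: frechet_derivative_eq)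
qed

lemma smooth_on_open_Ck:
  assumes "open S" "smooth_on S g"
  shows "Ck k S g"
proof (rule Ck_local)
  fix x assume "x \<in> S"
  then obtain U h where h: "x \<in> U" "smooth_on_open U h" "\<forall>y\<in>U \<inter> S. h y = g y"
    using assms(2) unfolding smooth_on_def by blast
  then have U: "open U" "Ck k U h" by (auto simp: smooth_on_open_iff_Ck)
  have "Ck k (U \<inter> S) g"
    by (rule Ck_cong[OF open_Int[OF U(1) assms(1)] _ Ck_subset[OF U(2) Int_lower1]]) (use h(3) in blast)
  then show "\<exists>V. open V \<and> x \<in> V \<and> Ck k V g"
    using U(1) assms(1) h(1) \<open>x \<in> S\<close> by blast
qed

text \<open>More general than \<open>oriented_manifold\<close>: the carrier may be a proper subset
  of the type, as for open intervals, the circle and products with them, and transition maps are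
  only \<open>Ck (Suc 0)\<close>. Chart images are open, which excludes the closed cylinder; its
  points are treated through the open one.\<close>

definition oriented_atlas :: "('a::topological_space, 'e::euclidean_space) atlas \<Rightarrow> bool" where
  "oriented_atlas A \<longleftrightarrow>
     (\<forall>c\<in>A. openin (top_of_set (carrier_of A)) (fst c) \<and> open (snd c ` fst c) \<and>
       homeomorphism (fst c) (snd c ` fst c) (snd c) (inv_into (fst c) (snd c))) \<and>
     (\<forall>c\<in>A. \<forall>d\<in>A. Ck (Suc 0) (snd c ` (fst c \<inter> fst d)) (chart_rep c d (\<lambda>x. x))) \<and>
     (\<forall>c\<in>A. \<forall>d\<in>A. \<forall>x\<in>fst c \<inter> fst d. endo_det (chart_deriv c d (\<lambda>x. x) x) > 0)"

definition C1_map :: "('a::topological_space, 'e::euclidean_space) atlas \<Rightarrow>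
    ('b::topological_space, 'f::euclidean_space) atlas \<Rightarrow> ('a \<Rightarrow> 'b) \<Rightarrow> bool" where
  "C1_map A B F \<longleftrightarrow> F ` carrier_of A \<subseteq> carrier_of B \<and> continuous_on (carrier_of A) F \<and>
     (\<forall>c\<in>A. \<forall>d\<in>B. Ck (Suc 0) (snd c ` (fst c \<inter> F -` fst d)) (chart_rep c d F))"

lemma carrier_of_cover: "x \<in> carrier_of A \<Longrightarrow> \<exists>c\<in>A. x \<in> fst c"
  by (auto simp: carrier_of_def)

lemma oriented_atlasD:
  assumes "oriented_atlas A" "c \<in> A"
  shows "openin (top_of_set (carrier_of A)) (fst c)" "open (snd c ` fst c)"
    "homeomorphism (fst c) (snd c ` fst c) (snd c) (inv_into (fst c) (snd c))"
    "inj_on (snd c) (fst c)" "fst c \<subseteq> carrier_of A"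
proof -
  show *: "openin (top_of_set (carrier_of A)) (fst c)" "open (snd c ` fst c)"
    "homeomorphism (fst c) (snd c ` fst c) (snd c) (inv_into (fst c) (snd c))"
    using assms unfolding oriented_atlas_def by blast+
  show "inj_on (snd c) (fst c)"
    by (rule inj_on_inverseI[of _ "inv_into (fst c) (snd c)"]) (use *(3) in \<open>simp add: homeomorphism_apply1\<close>)
  show "fst c \<subseteq> carrier_of A" using assms(2) by (auto simp: carrier_of_def)
qed

lemma oriented_atlas_transition:
  assumes "oriented_atlas A" "c \<in> A" "d \<in> A"
  shows "Ck (Suc 0) (snd c ` (fst c \<inter> fst d)) (chart_rep c d (\<lambda>x. x))"
    "x \<in> fst c \<Longrightarrow> x \<in> fst d \<Longrightarrow> endo_det (chart_deriv c d (\<lambda>x. x) x) > 0"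
  using assms unfolding oriented_atlas_def by blast+

lemma chart_deriv_open:
  assumes "open (snd c ` fst c)" "x \<in> fst c"
  shows "chart_deriv c d f x = frechet_derivative (chart_rep c d f) (at (snd c x))"
proof -
  have "at (snd c x) within snd c ` fst c = at (snd c x)"
    using assms by (intro at_within_open) blast
  then show ?thesis by (simp only: chart_deriv_def)
qed

lemma oriented_atlas_image_open:
  assumes A: "oriented_atlas A" "c \<in> A" and V: "openin (top_of_set (carrier_of A)) V"
  shows "open (snd c ` (fst c \<inter> V))"
proof -
  note c = oriented_atlasD[OF A]
  have "openin (top_of_set (fst c)) (fst c \<inter> V)"
    using V c(5) by (auto simp: openin_open)
  then have "openin (top_of_set (snd c ` fst c)) (snd c ` (fst c \<inter> V))"
    by (rule homeomorphism_imp_open_map[OF c(3)])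
  then show ?thesis using c(2) by (rule openin_open_trans)
qed

lemma C1_map_vimage_openin:
  assumes "oriented_atlas B" "C1_map A B F" "d \<in> B"
  shows "openin (top_of_set (carrier_of A)) (carrier_of A \<inter> F -` fst d)"
proof -
  have "F ` carrier_of A \<subseteq> carrier_of B" "continuous_on (carrier_of A) F"
    using assms(2) unfolding C1_map_def by blast+
  then show ?thesis
    using oriented_atlasD(1)[OF assms(1,3)]
    by (intro continuous_openin_preimage[of _ _ "carrier_of B"]) (auto simp: image_subset_iff_funcset)
qed

lemma C1_map_image_open:
  assumes "oriented_atlas A" "oriented_atlas B" "C1_map A B F" "c \<in> A" "d \<in> B"
  shows "open (snd c ` (fst c \<inter> F -` fst d))"
proof -
  have "fst c \<inter> F -` fst d = fst c \<inter> (carrier_of A \<inter> F -` fst d)"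
    using oriented_atlasD(5)[OF assms(1,4)] by blast
  then show ?thesis
    using oriented_atlas_image_open[OF assms(1,4) C1_map_vimage_openin[OF assms(2,3,5)]] by simp
qed

lemma C1_map_differentiable:
  assumes "C1_map A B F" "c \<in> A" "d \<in> B" "x \<in> fst c" "F x \<in> fst d"
  shows "chart_rep c d F differentiable (at (snd c x))"
proof -
  have "Ck (Suc 0) (snd c ` (fst c \<inter> F -` fst d)) (chart_rep c d F)"
    using assms unfolding C1_map_def by blast
  then show ?thesis by (rule Ck_differentiable) (use assms in blast)
qed

lemma oriented_atlas_id: "oriented_atlas A \<Longrightarrow> C1_map A A (\<lambda>x. x)"
  unfolding C1_map_def by (auto simp: vimage_def simp del: Ck.simps intro: oriented_atlas_transition(1))

lemma endo_det_chart_change: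
  fixes A :: "('a::topological_space, 'e::euclidean_space) atlas" and B :: "('b::topological_space, 'e) atlas"
  assumes A: "oriented_atlas A" and B: "oriented_atlas B" and F: "C1_map A B F"
    and c: "c \<in> A" "c' \<in> A" "x \<in> fst c" "x \<in> fst c'" and d: "d \<in> B" "d' \<in> B" "F x \<in> fst d" "F x \<in> fst d'"
  shows "endo_det (chart_deriv c' d' F x) =
    endo_det (chart_deriv d d' (\<lambda>x. x) (F x)) * endo_det (chart_deriv c d F x) * endo_det (chart_deriv c' c (\<lambda>x. x) x)"
proof -
  let ?f = "chart_rep c d F" and ?g = "chart_rep d d' (\<lambda>x. x)" and ?h = "chart_rep c' c (\<lambda>x. x)"
  note c1 = oriented_atlasD[OF A c(1)] and c2 = oriented_atlasD[OF A c(2)]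
    and d1 = oriented_atlasD[OF B d(1)] and d2 = oriented_atlasD[OF B d(2)]
  have hx: "?h (snd c' x) = snd c x" using c c2(4) by (simp add: chart_rep_def)
  have fx: "?f (snd c x) = snd d (F x)" using c c1(4) by (simp add: chart_rep_def)
  have dh: "?h differentiable (at (snd c' x))"
    using C1_map_differentiable[OF oriented_atlas_id[OF A] c(2,1)] c by simp
  have df: "?f differentiable (at (?h (snd c' x)))"
    unfolding hx using C1_map_differentiable[OF F c(1) d(1) c(3) d(3)] .
  have dg: "?g differentiable (at (?f (?h (snd c' x))))"
    unfolding hx fx using C1_map_differentiable[OF oriented_atlas_id[OF B] d(1,2)] d by simp
  have op: "open (snd c' ` (fst c' \<inter> (fst c \<inter> (carrier_of A \<inter> F -` fst d) \<inter> (carrier_of A \<inter> F -` fst d'))))"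
    by (rule oriented_atlas_image_open[OF A c(2)])
       (intro openin_Int c1(1) C1_map_vimage_openin[OF B F] d)
  have "frechet_derivative (chart_rep c' d' F) (at (snd c' x)) = frechet_derivative (?g \<circ> (?f \<circ> ?h)) (at (snd c' x))"
  proof (rule frechet_derivative_cong_open[OF op])
    show "snd c' x \<in> snd c' ` (fst c' \<inter> (fst c \<inter> (carrier_of A \<inter> F -` fst d) \<inter> (carrier_of A \<inter> F -` fst d')))"
      using c d c1(5) by blast
    fix y assume "y \<in> snd c' ` (fst c' \<inter> (fst c \<inter> (carrier_of A \<inter> F -` fst d) \<inter> (carrier_of A \<inter> F -` fst d')))"
    then obtain u where u: "u \<in> fst c'" "u \<in> fst c" "F u \<in> fst d" "F u \<in> fst d'" "y = snd c' u" by blast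
    then show "chart_rep c' d' F y = (?g \<circ> (?f \<circ> ?h)) y"
      using c1(4) c2(4) d1(4) d2(4) by (simp add: chart_rep_def)
  qed
  also have "\<dots> = frechet_derivative ?g (at (?f (?h (snd c' x)))) \<circ>
      (frechet_derivative ?f (at (?h (snd c' x))) \<circ> frechet_derivative ?h (at (snd c' x)))"
    by (rule frechet_derivative_eq, intro diff_chain_at has_derivative_frechet dh df)
       (use dg in \<open>auto intro: has_derivative_frechet\<close>)
  finally have "endo_det (frechet_derivative (chart_rep c' d' F) (at (snd c' x))) =
      endo_det (frechet_derivative ?g (at (snd d (F x)))) * (endo_det (frechet_derivative ?f (at (snd c x))) *
      endo_det (frechet_derivative ?h (at (snd c' x))))"
    using dh df dg by (simp add: endo_det_compose linear_frechet_derivative linear_compose hx fx)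
  then show ?thesis
    using c d c1(2) c2(2) d1(2) by (simp add: chart_deriv_open)
qed

lemma endo_det_chart_sign:
  assumes A: "oriented_atlas A" and B: "oriented_atlas B" and F: "C1_map A B F"
    and c: "c \<in> A" "c' \<in> A" "x \<in> fst c" "x \<in> fst c'" and d: "d \<in> B" "d' \<in> B" "F x \<in> fst d" "F x \<in> fst d'"
  shows "sgn (endo_det (chart_deriv c' d' F x)) = sgn (endo_det (chart_deriv c d F x))"
  unfolding endo_det_chart_change[OF assms] sgn_mult
    sgn_pos[OF oriented_atlas_transition(2)[OF A c(2,1,4,3)]] sgn_pos[OF oriented_atlas_transition(2)[OF B d]]
  by simp

text \<open>The definition asks for some pair of charts. As the transition determinants are
  positive, every pair gives the same answer.\<close>

lemma orientation_preserving_at_iff: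
  assumes A: "oriented_atlas A" and B: "oriented_atlas B" and F: "C1_map A B F"
    and c: "c \<in> A" "x \<in> fst c" and d: "d \<in> B" "F x \<in> fst d"
  shows "orientation_preserving_at A B F x \<longleftrightarrow> endo_det (chart_deriv c d F x) > 0"
proof
  assume "orientation_preserving_at A B F x"
  then obtain c' d' where *: "c' \<in> A" "d' \<in> B" "x \<in> fst c'" "F x \<in> fst d'" "endo_det (chart_deriv c' d' F x) > 0"
    unfolding orientation_preserving_at_def by blast
  then show "endo_det (chart_deriv c d F x) > 0"
    using endo_det_chart_sign[OF A B F c(1) *(1) c(2) *(3) d(1) *(2) d(2) *(4)] by (metis sgn_greater)
next
  assume "endo_det (chart_deriv c d F x) > 0"
  then show "orientation_preserving_at A B F x"
    unfolding orientation_preserving_at_def using c d by blast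
qed

lemma linear_chart_deriv:
  assumes "oriented_atlas A" "C1_map A B F" "c \<in> A" "x \<in> fst c" "d \<in> B" "F x \<in> fst d"
  shows "linear (chart_deriv c d F x)"
  unfolding chart_deriv_open[OF oriented_atlasD(2)[OF assms(1,3)] assms(4)]
  by (rule linear_frechet_derivative[OF C1_map_differentiable[OF assms(2,3,5,4,6)]])

text \<open>Two translations in one: surjectivity becomes a nonzero determinant, and the existence
  of suitable charts becomes a condition in all charts.\<close>

lemma regular_value_iff:
  assumes A: "oriented_atlas A" and B: "oriented_atlas B" and F: "C1_map A B F"
  shows "regular_value A B F q \<longleftrightarrow>
    (\<forall>c\<in>A. \<forall>d\<in>B. \<forall>x\<in>fst c. F x = q \<longrightarrow> q \<in> fst d \<longrightarrow> endo_det (chart_deriv c d F x) \<noteq> 0)"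
proof
  assume r: "regular_value A B F q"
  show "\<forall>c\<in>A. \<forall>d\<in>B. \<forall>x\<in>fst c. F x = q \<longrightarrow> q \<in> fst d \<longrightarrow> endo_det (chart_deriv c d F x) \<noteq> 0"
  proof (intro ballI impI)
    fix c d x assume *: "c \<in> A" "d \<in> B" "x \<in> fst c" "F x = q" "q \<in> fst d"
    then have "x \<in> carrier_of A" by (auto simp: carrier_of_def)
    then obtain c' d' where **: "c' \<in> A" "d' \<in> B" "x \<in> fst c'" "q \<in> fst d'" "surj (chart_deriv c' d' F x)"
      using r * unfolding regular_value_def by blast
    have "endo_det (chart_deriv c' d' F x) \<noteq> 0"
      using linear_chart_deriv[OF A F **(1,3,2)] ** * endo_det_nonzero_iff_surj by blast
    then show "endo_det (chart_deriv c d F x) \<noteq> 0"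
      using endo_det_chart_sign[OF A B F *(1) **(1) *(3) **(3) *(2) **(2)] * ** by (metis sgn_zero_iff)
  qed
next
  assume r: "\<forall>c\<in>A. \<forall>d\<in>B. \<forall>x\<in>fst c. F x = q \<longrightarrow> q \<in> fst d \<longrightarrow> endo_det (chart_deriv c d F x) \<noteq> 0"
  show "regular_value A B F q"
    unfolding regular_value_def
  proof (intro ballI impI)
    fix x assume x: "x \<in> carrier_of A" "F x = q"
    then have "q \<in> carrier_of B" using F unfolding C1_map_def by blast
    then obtain c d where cd: "c \<in> A" "x \<in> fst c" "d \<in> B" "q \<in> fst d"
      using carrier_of_cover x(1) by metis
    then have "surj (chart_deriv c d F x)"
      using r x(2) linear_chart_deriv[OF A F cd(1-3)] endo_det_nonzero_iff_surj by blast
    then show "\<exists>c\<in>A. \<exists>d\<in>B. x \<in> fst c \<and> q \<in> fst d \<and> surj (chart_deriv c d F x)"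
      using cd by blast
  qed
qed

lemma oriented_manifold_atlas:
  assumes "oriented_manifold A"
  shows "oriented_atlas A" "carrier_of A = UNIV"
proof -
  have A: "smooth_manifold A" using assms by (simp add: oriented_manifold_def)
  then show carrier: "carrier_of A = UNIV" by (simp add: smooth_manifold_def)
  have ch: "open (fst c) \<and> open (snd c ` fst c) \<and> homeomorphism (fst c) (snd c ` fst c) (snd c) (inv_into (fst c) (snd c))"
    if "c \<in> A" for c
    using A that unfolding smooth_manifold_def by (cases c) auto
  show "oriented_atlas A"
    unfolding oriented_atlas_def carrier
  proof (intro conjI ballI)
    fix c assume c: "c \<in> A"
    show "openin (top_of_set UNIV) (fst c)" "open (snd c ` fst c)"
      "homeomorphism (fst c) (snd c ` fst c) (snd c) (inv_into (fst c) (snd c))"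
      using ch[OF c] by auto
    fix d assume d: "d \<in> A"
    show "Ck (Suc 0) (snd c ` (fst c \<inter> fst d)) (chart_rep c d (\<lambda>x. x))"
    proof (rule smooth_on_open_Ck)
      have "openin (top_of_set (fst c)) (fst c \<inter> fst d)"
        using ch[OF d] by (auto simp: openin_open)
      then have "openin (top_of_set (snd c ` fst c)) (snd c ` (fst c \<inter> fst d))"
        using homeomorphism_imp_open_map ch[OF c] by blast
      then show "open (snd c ` (fst c \<inter> fst d))" using ch[OF c] openin_open_trans by blast
      show "smooth_on (snd c ` (fst c \<inter> fst d)) (chart_rep c d (\<lambda>x. x))"
        using A c d unfolding smooth_manifold_def by blast
    qed
    show "endo_det (chart_deriv c d (\<lambda>x. x) x) > 0" if "x \<in> fst c \<inter> fst d" for x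
      using assms c d that unfolding oriented_manifold_def by blast
  qed
qed

text \<open>Over an open chart image each local smooth extension agrees with the map on an open set,
  so the map itself is \<open>Ck\<close> there.\<close>

lemma smooth_map_C1_map:
  assumes A: "oriented_atlas A" and B: "oriented_atlas B" and F: "smooth_map A B F"
  shows "C1_map A B F"
  unfolding C1_map_def
proof (intro conjI ballI)
  show F1: "F ` carrier_of A \<subseteq> carrier_of B" and F2: "continuous_on (carrier_of A) F"
    using F unfolding smooth_map_def by auto
  fix c d assume c: "c \<in> A" and d: "d \<in> B"
  have "openin (top_of_set (carrier_of A)) (carrier_of A \<inter> F -` fst d)"
    using F1 F2 oriented_atlasD(1)[OF B d]
    by (intro continuous_openin_preimage[of _ _ "carrier_of B"]) (auto simp: image_subset_iff_funcset)
  moreover have "fst c \<inter> F -` fst d = fst c \<inter> (carrier_of A \<inter> F -` fst d)"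
    using oriented_atlasD(5)[OF A c] by blast
  ultimately have "open (snd c ` (fst c \<inter> F -` fst d))"
    using oriented_atlas_image_open[OF A c] by metis
  moreover have "smooth_on (snd c ` (fst c \<inter> F -` fst d)) (chart_rep c d F)"
    using F c d unfolding smooth_map_def by blast
  ultimately show "Ck (Suc 0) (snd c ` (fst c \<inter> F -` fst d)) (chart_rep c d F)"
    by (rule smooth_on_open_Ck)
qed

section \<open>The mapping degree as a signed count\<close>

lemma homeomorphism_to_vec: "homeomorphism T (to_vec ` T) to_vec of_vec"
  unfolding homeomorphism_def
  by (auto intro: linear_continuous_on bounded_linear_to_vec bounded_linear_of_vec simp: image_image)

text \<open>Composing the charts with \<open>to_vec\<close> carries the atlas to
  \<open>real ^ 'k\<close>, where the integration theory takes place.\<close>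

lemma oriented_charts_of_atlas:
  fixes A :: "('x::t2_space, 'e::euclidean_space) atlas"
  assumes A: "oriented_atlas A" and K: "compact (carrier_of A)"
  shows "oriented_charts (carrier_of A) A fst (\<lambda>c. to_vec \<circ> snd c) (\<lambda>c. inv_into (fst c) (snd c) \<circ> of_vec)"
proof (unfold_locales, goal_cases)
  case 1
  show ?case by (rule K)
next
  case 2
  show ?case by (auto simp: carrier_of_def)
next
  case (3 c)
  show ?case by (rule oriented_atlasD(1)[OF A 3])
next
  case (4 c)
  show ?case
    unfolding image_comp[symmetric] by (rule open_to_vec_image[OF oriented_atlasD(2)[OF A 4]])
next
  case (5 c)
  show ?case
    unfolding image_comp[symmetric]
    by (rule homeomorphism_compose[OF oriented_atlasD(3)[OF A 5] homeomorphism_to_vec])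
next
  case (6 c d)
  have "Ck (Suc 0) (to_vec ` snd c ` (fst c \<inter> fst d)) (to_vec \<circ> chart_rep c d (\<lambda>x. x) \<circ> of_vec)"
    by (rule Ck_to_vec[OF oriented_atlas_image_open[OF A 6(1) oriented_atlasD(1)[OF A 6(2)]]
        oriented_atlas_transition(1)[OF A 6]])
  then show ?case by (simp add: chart_rep_def comp_assoc image_comp del: Ck.simps) (simp add: comp_def del: Ck.simps)
next
  case (7 c d x)
  have "jac (to_vec \<circ> chart_rep c d (\<lambda>x. x) \<circ> of_vec) (to_vec (snd c x)) = endo_det (chart_deriv c d (\<lambda>x. x) x)"
    unfolding chart_deriv_open[OF oriented_atlasD(2)[OF A 7(1)] 7(3)]
    by (rule jac_to_vec[OF C1_map_differentiable[OF oriented_atlas_id[OF A] 7]])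
  then show ?case
    using oriented_atlas_transition(2)[OF A 7] by (simp add: chart_rep_def comp_def)
qed

locale degree_setup =
  fixes A :: "('x::t2_space, 'e::euclidean_space) atlas" and B :: "('b::t2_space, 'e) atlas" and F :: "'x \<Rightarrow> 'b"
  assumes A: "oriented_atlas A" and K: "compact (carrier_of A)" and B: "oriented_atlas B" "carrier_of B = UNIV"
    and F: "C1_map A B F"
begin

sublocale oriented_charts "carrier_of A" A fst "\<lambda>c. to_vec \<circ> snd c" "\<lambda>c. inv_into (fst c) (snd c) \<circ> of_vec"
  by (rule oriented_charts_of_atlas[OF A K])

definition domain_over :: "('b, 'e) chart \<Rightarrow> 'x set" where
  "domain_over d = carrier_of A \<inter> F -` fst d"

text \<open>\<open>F\<close> read in one target chart. It takes the place of \<open>G\<close> in the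
  integration theory, on the relatively open set \<open>domain_over d\<close>.\<close>

definition local_map :: "('b, 'e) chart \<Rightarrow> 'x \<Rightarrow> real ^ 'e basis_index" where
  "local_map d = to_vec \<circ> snd d \<circ> F"

lemma F_continuous: "continuous_on (carrier_of A) F"
  using F unfolding C1_map_def by blast

lemma local_map_in_chart:
  "local_map d \<circ> (inv_into (fst c) (snd c) \<circ> of_vec) = to_vec \<circ> chart_rep c d F \<circ> of_vec"
  by (simp add: local_map_def chart_rep_def comp_assoc)

lemma C1_in_local_map:
  assumes d: "d \<in> B"
  shows "C1_in (domain_over d) (local_map d)"
  unfolding C1_in_def local_map_in_chart
proof (intro conjI ballI)
  show "openin (top_of_set (carrier_of A)) (domain_over d)"
    unfolding domain_over_def by (rule C1_map_vimage_openin[OF B(1) F d])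
  fix c assume c: "c \<in> A"
  have "Ck (Suc 0) (to_vec ` snd c ` (fst c \<inter> F -` fst d)) (to_vec \<circ> chart_rep c d F \<circ> of_vec)"
    by (rule Ck_to_vec[OF C1_map_image_open[OF A B(1) F c d]]) (use F c d in \<open>simp add: C1_map_def del: Ck.simps\<close>)
  moreover have "fst c \<inter> domain_over d = fst c \<inter> F -` fst d"
    using oriented_atlasD(5)[OF A c] by (auto simp: domain_over_def)
  ultimately show "Ck (Suc 0) ((to_vec \<circ> snd c) ` (fst c \<inter> domain_over d)) (to_vec \<circ> chart_rep c d F \<circ> of_vec)"
    by (simp add: image_comp del: Ck.simps)
qed

lemma jacX_local_map:
  assumes "c \<in> A" "x \<in> fst c" "d \<in> B" "F x \<in> fst d"
  shows "jacX (local_map d) c x = endo_det (chart_deriv c d F x)"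
  unfolding jacX_def local_map_in_chart chart_deriv_open[OF oriented_atlasD(2)[OF A assms(1)] assms(2)] comp_apply[of to_vec "snd c"]
  by (rule jac_to_vec[OF C1_map_differentiable[OF F assms(1,3,2,4)]])

lemma fibre_local_map:
  assumes "d \<in> B" "q \<in> fst d"
  shows "{x. x \<in> domain_over d \<and> local_map d x = to_vec (snd d q)} = {x. x \<in> carrier_of A \<and> F x = q}"
proof -
  have "F x = q" if "F x \<in> fst d" "to_vec (snd d (F x)) = to_vec (snd d q)" for x
  proof -
    have "snd d (F x) = snd d q" using arg_cong[OF that(2), of of_vec] by simp
    then show ?thesis using inj_onD[OF oriented_atlasD(4)[OF B(1) assms(1)] _ that(1) assms(2)] by blast
  qed
  then show ?thesis using assms(2) by (auto simp: domain_over_def local_map_def)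
qed

lemma regular_local_map:
  assumes d: "d \<in> B" "q \<in> fst d" and r: "regular_value A B F q"
    and x: "c \<in> A" "x \<in> fst c" "x \<in> domain_over d" "local_map d x = to_vec (snd d q)"
  shows "jacX (local_map d) c x \<noteq> 0"
proof -
  have "F x = q" using fibre_local_map[OF d] x by blast
  then show ?thesis
    using r[unfolded regular_value_iff[OF A B(1) F]] jacX_local_map[OF x(1,2) d(1)] d x by auto
qed

lemma signed_count_local_map:
  assumes d: "d \<in> B" "q \<in> fst d" and r: "regular_value A B F q"
  shows "real_of_int (signed_count A B F q) =
    (\<Sum>x | x \<in> domain_over d \<and> local_map d x = to_vec (snd d q). orientation_sign (local_map d) x)"
proof -
  have "real_of_int (signed_count A B F q) =
    (\<Sum>x | x \<in> carrier_of A \<and> F x = q. real_of_int (if orientation_preserving_at A B F x then 1 else -1))"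
    by (simp only: signed_count_def of_int_sum)
  also have "\<dots> = (\<Sum>x | x \<in> carrier_of A \<and> F x = q. orientation_sign (local_map d) x)"
  proof (rule sum.cong[OF refl])
    fix x assume "x \<in> {x. x \<in> carrier_of A \<and> F x = q}"
    then have x: "x \<in> carrier_of A" "F x = q" by auto
    obtain c where c: "c \<in> A" "x \<in> fst c" using carrier_of_cover[OF x(1)] by blast
    have dom: "x \<in> domain_over d" "local_map d x = to_vec (snd d q)"
      using x d(2) by (auto simp: domain_over_def local_map_def)
    have Fx: "F x \<in> fst d" using x d by simp
    have "orientation_sign (local_map d) x = sgn (endo_det (chart_deriv c d F x))"
      using orientation_sign_eq[OF C1_in_local_map[OF d(1)] c dom(1)] jacX_local_map[OF c d(1) Fx] by simp
    moreover have "endo_det (chart_deriv c d F x) \<noteq> 0"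
      using regular_local_map[OF d r c dom] jacX_local_map[OF c d(1) Fx] by simp
    ultimately show "real_of_int (if orientation_preserving_at A B F x then 1 else -1) = orientation_sign (local_map d) x"
      using orientation_preserving_at_iff[OF A B(1) F c d(1) Fx] by (simp add: sgn_real_def)
  qed
  finally show ?thesis by (simp only: fibre_local_map[OF d])
qed

text \<open>\<open>W\<close> is the part of a target chart that corresponds to an open box whose
  closure lies in the chart image. The closed box is then compact in the target, hence its preimage
  is closed in the compact source, and \<open>signed_count_eq_in_box\<close> compares any two
  regular values in \<open>W\<close>.\<close>

lemma signed_count_locally_constant:
  obtains W where "open W" "y \<in> W"
    "\<forall>q\<in>W. \<forall>q'\<in>W. regular_value A B F q \<longrightarrow> regular_value A B F q' \<longrightarrow> signed_count A B F q = signed_count A B F q'"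
proof -
  have "y \<in> carrier_of B" using B(2) by simp
  from carrier_of_cover[OF this] obtain d where d: "d \<in> B" "y \<in> fst d" by blast
  note ch = oriented_atlasD[OF B(1) d(1)]
  have dop: "open (fst d)" using ch(1) B(2) by simp
  let ?\<psi> = "to_vec \<circ> snd d" and ?\<psi>' = "inv_into (fst d) (snd d) \<circ> of_vec"
  have hom: "homeomorphism (fst d) (?\<psi> ` fst d) ?\<psi> ?\<psi>'"
    unfolding image_comp[symmetric] by (rule homeomorphism_compose[OF ch(3) homeomorphism_to_vec])
  have op: "open (?\<psi> ` fst d)"
    unfolding image_comp[symmetric] by (rule open_to_vec_image[OF ch(2)])
  obtain a e where ae: "?\<psi> y \<in> box a e" "cbox a e \<subseteq> ?\<psi> ` fst d"
    using open_contains_cbox[OF op imageI[OF d(2)]] by metis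
  define W where "W = fst d \<inter> ?\<psi> -` box a e"
  have cont: "continuous_on (fst d) ?\<psi>" "continuous_on (?\<psi> ` fst d) ?\<psi>'"
    using hom by (auto simp: homeomorphism_def)
  have W: "open W"
    unfolding W_def by (rule continuous_open_preimage[OF cont(1) dop open_box])
  let ?C = "?\<psi>' ` cbox a e"
  have C: "compact ?C"
    by (rule compact_continuous_image[OF continuous_on_subset[OF cont(2) ae(2)] compact_cbox])
  have memC: "z \<in> ?C \<longleftrightarrow> z \<in> fst d \<and> ?\<psi> z \<in> cbox a e" for z
  proof
    assume "z \<in> ?C"
    then obtain v where v: "v \<in> cbox a e" "z = ?\<psi>' v" by blast
    then obtain u where u: "u \<in> fst d" "v = ?\<psi> u" using ae(2) by blast
    then have "z = u" using v(2) homeomorphism_apply1[OF hom] by simp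
    then show "z \<in> fst d \<and> ?\<psi> z \<in> cbox a e" using u v by simp
  next
    assume "z \<in> fst d \<and> ?\<psi> z \<in> cbox a e"
    then show "z \<in> ?C" using homeomorphism_apply1[OF hom, of z] by (metis imageI)
  qed
  have "{x \<in> domain_over d. local_map d x \<in> cbox a e} = carrier_of A \<inter> F -` ?C"
    unfolding domain_over_def local_map_def using memC by auto
  moreover have "closedin (top_of_set (carrier_of A)) (carrier_of A \<inter> F -` ?C)"
    by (rule continuous_closedin_preimage[OF F_continuous compact_imp_closed[OF C]])
  ultimately have comp: "compact {x \<in> domain_over d. local_map d x \<in> cbox a e}"
    using closedin_compact[OF K] by metis
  show ?thesis
  proof (rule that[OF W])
    show "y \<in> W" using d ae(1) by (simp add: W_def)
    show "\<forall>q\<in>W. \<forall>q'\<in>W. regular_value A B F q \<longrightarrow> regular_value A B F q' \<longrightarrow> signed_count A B F q = signed_count A B F q'"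
    proof (intro ballI impI)
      fix q q' assume q: "q \<in> W" "q' \<in> W" and r: "regular_value A B F q" "regular_value A B F q'"
      have qd: "q \<in> fst d" "q' \<in> fst d" "to_vec (snd d q) \<in> box a e" "to_vec (snd d q') \<in> box a e"
        using q by (auto simp: W_def)
      have "real_of_int (signed_count A B F q) = real_of_int (signed_count A B F q')"
        unfolding signed_count_local_map[OF d(1) qd(1) r(1)] signed_count_local_map[OF d(1) qd(2) r(2)]
        by (rule signed_count_eq_in_box[OF C1_in_local_map[OF d(1)] comp qd(3,4)])
           (use regular_local_map[OF d(1) qd(1) r(1)] regular_local_map[OF d(1) qd(2) r(2)] in blast)+
      then show "signed_count A B F q = signed_count A B F q'" by simp
    qed
  qed
qed

text \<open>Sard's theorem chart by chart. Compactness leaves finitely many source charts, so the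
  critical values in one target chart form a negligible set, which cannot contain the nonempty open
  image of \<open>W\<close>.\<close>

lemma regular_value_dense:
  assumes W: "open W" "W \<noteq> {}"
  obtains q where "q \<in> W" "regular_value A B F q"
proof -
  obtain y where y: "y \<in> W" using W(2) by blast
  have "y \<in> carrier_of B" using B(2) by simp
  from carrier_of_cover[OF this] obtain d where d: "d \<in> B" "y \<in> fst d" by blast
  note ch = oriented_atlasD[OF B(1) d(1)]
  let ?\<psi> = "to_vec \<circ> snd d"
  have "open (snd d ` (fst d \<inter> W))"
    by (rule oriented_atlas_image_open[OF B(1) d(1)]) (use W(1) B(2) in simp)
  then have op: "open (?\<psi> ` (fst d \<inter> W))"
    unfolding image_comp[symmetric] by (rule open_to_vec_image)
  have "\<forall>c\<in>A. \<exists>S. open S \<and> fst c = carrier_of A \<inter> S"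
    using oriented_atlasD(1)[OF A] unfolding openin_open by blast
  then obtain S where S: "\<And>c. c \<in> A \<Longrightarrow> open (S c) \<and> fst c = carrier_of A \<inter> S c" by metis
  obtain T where T: "T \<subseteq> A" "finite T" "carrier_of A \<subseteq> (\<Union>c\<in>T. S c)"
  proof (rule compactE_image[OF K, of A S])
    show "carrier_of A \<subseteq> (\<Union>c\<in>A. S c)"
    proof
      fix x assume "x \<in> carrier_of A"
      from carrier_of_cover[OF this] obtain c where "c \<in> A" "x \<in> fst c" by blast
      then show "x \<in> (\<Union>c\<in>A. S c)" using S[of c] by blast
    qed
  qed (use S in auto)
  let ?G = "local_map d" and ?O = "domain_over d"
  let ?g = "\<lambda>c. ?G \<circ> (inv_into (fst c) (snd c) \<circ> of_vec)"
  define crit where "crit c = {v \<in> (to_vec \<circ> snd c) ` (fst c \<inter> ?O). jac (?g c) v = 0}" for c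
  have neg: "negligible (?g c ` crit c)" if c: "c \<in> A" for c
  proof (rule baby_Sard)
    show "(?g c has_derivative frechet_derivative (?g c) (at v)) (at v within crit c)" if "v \<in> crit c" for v
    proof (rule has_derivative_at_withinI[OF has_derivative_frechet])
      show "?g c differentiable at v"
        by (rule Ck_differentiable[OF C1_in_Ck[OF C1_in_local_map[OF d(1)] c]]) (use that in \<open>auto simp: crit_def\<close>)
    qed
    show "rank (matrix (frechet_derivative (?g c) (at v))) < CARD('e basis_index)" if "v \<in> crit c" for v
      using that by (simp add: crit_def jac_def det_eq_0_rank)
  qed simp
  have "negligible (\<Union>c\<in>T. ?g c ` crit c)"
    using T neg by (intro negligible_Union finite_imageI) auto
  moreover have "\<not> negligible (?\<psi> ` (fst d \<inter> W))"
    using open_not_negligible[OF op] y d(2) by blast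
  ultimately obtain v where v: "v \<in> ?\<psi> ` (fst d \<inter> W)" "v \<notin> (\<Union>c\<in>T. ?g c ` crit c)"
    using negligible_subset by blast
  then obtain q where q: "q \<in> fst d" "q \<in> W" "v = to_vec (snd d q)" by auto
  have "regular_value A B F q"
    unfolding regular_value_iff[OF A B(1) F]
  proof (intro ballI impI)
    fix c d' x assume c: "c \<in> A" "d' \<in> B" "x \<in> fst c" "F x = q" "q \<in> fst d'"
    have x: "x \<in> carrier_of A" using c oriented_atlasD(5)[OF A c(1)] by blast
    then obtain c' where c': "c' \<in> T" "x \<in> S c'" using T(3) by blast
    then have c'A: "c' \<in> A" "x \<in> fst c'" using T(1) S[of c'] x by blast+
    have xO: "x \<in> ?O" using x c q by (simp add: domain_over_def)
    have "?g c' ((to_vec \<circ> snd c') x) = v"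
      using inv_chart[OF c'A] c q by (simp add: local_map_def)
    then have "(to_vec \<circ> snd c') x \<notin> crit c'" using v(2) c'(1) by blast
    then have "jac (?g c') ((to_vec \<circ> snd c') x) \<noteq> 0"
      using c'A(2) xO by (auto simp: crit_def)
    then have "endo_det (chart_deriv c' d F x) \<noteq> 0"
      using jacX_local_map[OF c'A d(1)] c q by (simp add: jacX_def)
    then show "endo_det (chart_deriv c d' F x) \<noteq> 0"
      using endo_det_chart_sign[OF A B(1) F c'A(1) c(1) c'A(2) c(3) d(1) c(2)] c q by (metis sgn_zero_iff)
  qed
  with q(2) show ?thesis by (rule that)
qed

text \<open>\<open>S\<close> consists of the points near which all regular values have the count of
  \<open>q\<close>. Overlapping neighbourhoods share a regular value by density, so a neighbourhood
  with constant count that meets \<open>S\<close> lies in \<open>S\<close>; hence the complement is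
  open too.\<close>

theorem signed_count_regular_values_eq:
  assumes conn: "connected (UNIV :: 'b set)" and r: "regular_value A B F q" "regular_value A B F q'"
  shows "signed_count A B F q = signed_count A B F q'"
proof -
  define S where "S = {y. \<exists>W. open W \<and> y \<in> W \<and> (\<forall>z\<in>W. regular_value A B F z \<longrightarrow> signed_count A B F z = signed_count A B F q)}"
  have opS: "open S"
    unfolding S_def by (subst open_subopen) blast
  have opC: "open (- S)"
  proof (subst open_subopen, rule ballI)
    fix y assume y: "y \<in> - S"
    obtain W where W: "open W" "y \<in> W"
      "\<forall>q\<in>W. \<forall>q'\<in>W. regular_value A B F q \<longrightarrow> regular_value A B F q' \<longrightarrow> signed_count A B F q = signed_count A B F q'"
      by (rule signed_count_locally_constant)
    have "W \<inter> S = {}"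
    proof (rule ccontr)
      assume "W \<inter> S \<noteq> {}"
      then obtain y' W' where W': "y' \<in> W" "open W'" "y' \<in> W'"
        "\<forall>z\<in>W'. regular_value A B F z \<longrightarrow> signed_count A B F z = signed_count A B F q"
        unfolding S_def by blast
      obtain z where z: "z \<in> W \<inter> W'" "regular_value A B F z"
        using regular_value_dense[OF open_Int[OF W(1) W'(2)]] W' by blast
      have "\<forall>u\<in>W. regular_value A B F u \<longrightarrow> signed_count A B F u = signed_count A B F q"
        using W(3) W'(4) z by (metis IntD1 IntD2)
      then have "y \<in> S" unfolding S_def using W by blast
      with y show False by simp
    qed
    then show "\<exists>T. open T \<and> y \<in> T \<and> T \<subseteq> - S" using W by blast
  qed
  obtain W where "open W" "q \<in> W"
      "\<forall>z\<in>W. \<forall>z'\<in>W. regular_value A B F z \<longrightarrow> regular_value A B F z' \<longrightarrow> signed_count A B F z = signed_count A B F z'"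
    by (rule signed_count_locally_constant)
  then have "q \<in> S" unfolding S_def using r(1) by blast
  then have "S = UNIV"
    using conn opS opC connectedD[OF conn opS opC] by blast
  then have "q' \<in> S" by simp
  then show ?thesis unfolding S_def using r(2) by auto
qed

text \<open>If the target is not compact, the compact image misses some \<open>z\<close>. This is a
  regular value with empty fibre, so the count is \<open>0\<close>, in accordance with the
  convention in \<open>mapping_degree\<close>.\<close>

theorem mapping_degree_eq_signed_count:
  assumes conn: "connected (UNIV :: 'b set)" and r: "regular_value A B F q"
  shows "mapping_degree A B F = signed_count A B F q"
proof (cases "compact (UNIV :: 'b set)")
  case True
  have "(THE k. \<forall>q\<in>UNIV. regular_value A B F q \<longrightarrow> signed_count A B F q = k) = signed_count A B F q"
    using r signed_count_regular_values_eq[OF conn] by (intro the_equality) blast+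
  then show ?thesis using True by (simp add: mapping_degree_def B(2))
next
  case False
  have "compact (F ` carrier_of A)"
    by (rule compact_continuous_image[OF F_continuous K])
  then obtain z where z: "z \<notin> F ` carrier_of A" using False by (metis UNIV_eq_I)
  then have "regular_value A B F z" by (auto simp: regular_value_def)
  then have "signed_count A B F q = signed_count A B F z"
    by (rule signed_count_regular_values_eq[OF conn r])
  also have "{x. x \<in> carrier_of A \<and> F x = z} = {}" using z by blast
  then have "signed_count A B F z = 0" by (simp only: signed_count_def sum.empty)
  finally show ?thesis using False by (simp add: mapping_degree_def B(2))
qed

end

section \<open>Products, intervals and the circle\<close>

definition pair_chart :: "('a, 'e) chart \<Rightarrow> ('b, 'f) chart \<Rightarrow> ('a \<times> 'b, 'e \<times> 'f) chart" where
  "pair_chart a b = (fst a \<times> fst b, map_prod (snd a) (snd b))"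

lemma prod_atlas_eq: "prod_atlas A B = {pair_chart a b | a b. a \<in> A \<and> b \<in> B}"
  by (force simp: prod_atlas_def pair_chart_def)

lemma pair_chart_in_prod_atlas: "a \<in> A \<Longrightarrow> b \<in> B \<Longrightarrow> pair_chart a b \<in> prod_atlas A B"
  unfolding prod_atlas_eq by blast

lemma prod_atlasE:
  assumes "c \<in> prod_atlas A B"
  obtains a b where "a \<in> A" "b \<in> B" "c = pair_chart a b"
  using assms unfolding prod_atlas_eq by blast

lemma fst_pair_chart [simp]: "fst (pair_chart a b) = fst a \<times> fst b"
  by (simp add: pair_chart_def)

lemma carrier_of_prod_atlas [simp]: "carrier_of (prod_atlas A B) = carrier_of A \<times> carrier_of B"
proof (intro equalityI subsetI)
  fix x assume "x \<in> carrier_of (prod_atlas A B)"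
  then obtain c where "c \<in> prod_atlas A B" "x \<in> fst c" unfolding carrier_of_def by blast
  then obtain a b where "a \<in> A" "b \<in> B" "x \<in> fst a \<times> fst b" by (metis prod_atlasE fst_pair_chart)
  then show "x \<in> carrier_of A \<times> carrier_of B" unfolding carrier_of_def by blast
next
  fix x assume "x \<in> carrier_of A \<times> carrier_of B"
  then obtain a b where "a \<in> A" "b \<in> B" "x \<in> fst (pair_chart a b)" unfolding carrier_of_def by auto
  then show "x \<in> carrier_of (prod_atlas A B)"
    using pair_chart_in_prod_atlas[of a A b B] unfolding carrier_of_def by blast
qed

lemma snd_pair_chart [simp]: "snd (pair_chart a b) (u, v) = (snd a u, snd b v)"
  by (simp add: pair_chart_def)

lemma inj_on_pair_chart:
  "inj_on (snd a) (fst a) \<Longrightarrow> inj_on (snd b) (fst b) \<Longrightarrow> inj_on (snd (pair_chart a b)) (fst a \<times> fst b)"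
  by (auto simp: inj_on_def)

lemma image_pair_chart: "snd (pair_chart a b) ` (U \<times> V) = snd a ` U \<times> snd b ` V"
  by (auto simp: pair_chart_def image_iff)

lemma chart_rep_pair_chart:
  assumes "inj_on (snd a) (fst a)" "inj_on (snd b) (fst b)" "u \<in> fst a" "v \<in> fst b"
  shows "chart_rep (pair_chart a b) d F (snd a u, snd b v) = snd d (F (u, v))"
proof -
  have "inv_into (fst a \<times> fst b) (snd (pair_chart a b)) (snd (pair_chart a b) (u, v)) = (u, v)"
    by (rule inv_into_f_f[OF inj_on_pair_chart]) (use assms in auto)
  then show ?thesis by (simp add: chart_rep_def)
qed

section \<open>Products of oriented atlases\<close>

lemma endo_det_real: "endo_det (K :: real \<Rightarrow> real) = K 1"
  by (simp add: endo_det_def permutes_sing)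

lemma endo_det_product:
  fixes L :: "'e::euclidean_space \<Rightarrow> 'e" and K :: "real \<Rightarrow> real"
  assumes "linear L" "linear K"
  shows "endo_det (\<lambda>h. (L (fst h), K (snd h))) = endo_det L * endo_det K"
proof -
  let ?P = "\<lambda>(y, s :: real). (L y, s)"
  have P: "linear ?P"
    by (rule linearI) (auto simp: linear_add[OF assms(1)] linear_cmul[OF assms(1)])
  define k where "k = K 1"
  have K: "K s = k * s" for s
    using linear_cmul[OF assms(2), of s 1] by (simp add: k_def)
  have "(\<lambda>h. (L (fst h), K (snd h))) = ?P \<circ> (\<lambda>(y, s). (y, k * s))"
    by (auto simp: fun_eq_iff K)
  then show ?thesis
    using endo_det_scale_snd[OF P, of k] endo_det_map_prod_id[OF assms(1)] by (simp add: endo_det_real k_def)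
qed

lemma homeomorphism_pair_chart:
  assumes "homeomorphism (fst a) (snd a ` fst a) (snd a) (inv_into (fst a) (snd a))"
    "homeomorphism (fst b) (snd b ` fst b) (snd b) (inv_into (fst b) (snd b))"
    "inj_on (snd a) (fst a)" "inj_on (snd b) (fst b)"
  shows "homeomorphism (fst (pair_chart a b)) (snd (pair_chart a b) ` fst (pair_chart a b)) (snd (pair_chart a b))
    (inv_into (fst (pair_chart a b)) (snd (pair_chart a b)))"
proof -
  have inj: "inj_on (snd (pair_chart a b)) (fst (pair_chart a b))"
    using inj_on_pair_chart assms(3,4) by simp
  have inv: "inv_into (fst (pair_chart a b)) (snd (pair_chart a b)) p =
      (inv_into (fst a) (snd a) (fst p), inv_into (fst b) (snd b) (snd p))"
    if p: "p \<in> snd a ` fst a \<times> snd b ` fst b" for p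
  proof -
    obtain u v where uv: "u \<in> fst a" "v \<in> fst b" "p = snd (pair_chart a b) (u, v)" using p by auto
    then show ?thesis using inv_into_f_f[OF inj, of "(u, v)"] assms(3,4) by simp
  qed
  note cont = homeomorphism_cont1[OF assms(1)] homeomorphism_cont1[OF assms(2)]
    homeomorphism_cont2[OF assms(1)] homeomorphism_cont2[OF assms(2)]
  have 1: "continuous_on (fst a \<times> fst b) (\<lambda>p. (snd a (fst p), snd b (snd p)))"
    by (rule continuous_on_Pair[OF continuous_on_compose2[OF cont(1) continuous_on_fst[OF continuous_on_id]]
        continuous_on_compose2[OF cont(2) continuous_on_snd[OF continuous_on_id]]]) auto
  have 2: "continuous_on (snd a ` fst a \<times> snd b ` fst b)
      (\<lambda>p. (inv_into (fst a) (snd a) (fst p), inv_into (fst b) (snd b) (snd p)))"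
    by (rule continuous_on_Pair[OF continuous_on_compose2[OF cont(3) continuous_on_fst[OF continuous_on_id]]
        continuous_on_compose2[OF cont(4) continuous_on_snd[OF continuous_on_id]]]) auto
  show ?thesis
    unfolding homeomorphism_def
  proof (intro conjI ballI)
    show "continuous_on (fst (pair_chart a b)) (snd (pair_chart a b))"
      using continuous_on_eq[OF 1] by (simp add: pair_chart_def map_prod_def case_prod_beta')
    show "continuous_on (snd (pair_chart a b) ` fst (pair_chart a b)) (inv_into (fst (pair_chart a b)) (snd (pair_chart a b)))"
      unfolding fst_pair_chart image_pair_chart
      by (rule continuous_on_eq[OF 2]) (use inv in simp)
    show "inv_into (fst (pair_chart a b)) (snd (pair_chart a b)) ` snd (pair_chart a b) ` fst (pair_chart a b) = fst (pair_chart a b)"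
      using inv_into_f_f[OF inj] by (force simp: image_iff)
  qed (use inv_into_f_f[OF inj] in \<open>auto simp: f_inv_into_f\<close>)
qed

text \<open>Transition maps of the product are products of transition maps. Their derivatives are
  block diagonal, and the determinant is a product of two positive ones.\<close>

lemma oriented_atlas_prod:
  fixes A :: "('a::topological_space, 'e::euclidean_space) atlas" and B :: "('b::topological_space, real) atlas"
  assumes A: "oriented_atlas A" and B: "oriented_atlas B"
  shows "oriented_atlas (prod_atlas A B)"
proof -
  have top: "openin (top_of_set (carrier_of A \<times> carrier_of B)) (fst a \<times> fst b)"
      "open (snd (pair_chart a b) ` (fst a \<times> fst b))"
    if ab: "a \<in> A" "b \<in> B" for a b
  proof -
    obtain S T where "open S" "fst a = carrier_of A \<inter> S" "open T" "fst b = carrier_of B \<inter> T"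
      using oriented_atlasD(1)[OF A ab(1)] oriented_atlasD(1)[OF B ab(2)] unfolding openin_open by blast
    then show "openin (top_of_set (carrier_of A \<times> carrier_of B)) (fst a \<times> fst b)"
      unfolding openin_open by (intro exI[of _ "S \<times> T"]) (auto simp: open_Times)
    show "open (snd (pair_chart a b) ` (fst a \<times> fst b))"
      unfolding image_pair_chart
      by (intro open_Times oriented_atlasD(2)[OF A ab(1)] oriented_atlasD(2)[OF B ab(2)])
  qed
  have trans: "Ck (Suc 0) (snd (pair_chart a b) ` (fst (pair_chart a b) \<inter> fst (pair_chart a' b')))
        (chart_rep (pair_chart a b) (pair_chart a' b') (\<lambda>x. x))"
      (is ?Ck)
    "x \<in> fst (pair_chart a b) \<inter> fst (pair_chart a' b') \<Longrightarrow>
       endo_det (chart_deriv (pair_chart a b) (pair_chart a' b') (\<lambda>x. x) x) > 0"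
    if a: "a \<in> A" "a' \<in> A" and b: "b \<in> B" "b' \<in> B" for a a' b b' x
  proof -
    let ?f = "chart_rep a a' (\<lambda>x. x)" and ?g = "chart_rep b b' (\<lambda>x. x)"
    let ?R = "chart_rep (pair_chart a b) (pair_chart a' b') (\<lambda>x. x)"
    let ?SA = "snd a ` (fst a \<inter> fst a')" and ?SB = "snd b ` (fst b \<inter> fst b')"
    have inj: "inj_on (snd a) (fst a)" "inj_on (snd b) (fst b)"
      using oriented_atlasD(4) A B a b by blast+
    have dom: "snd (pair_chart a b) ` (fst (pair_chart a b) \<inter> fst (pair_chart a' b')) = ?SA \<times> ?SB"
      by (simp add: Times_Int_Times image_pair_chart)
    have op: "open ?SA" "open ?SB"
      using oriented_atlas_image_open[OF A a(1) oriented_atlasD(1)[OF A a(2)]]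
        oriented_atlas_image_open[OF B b(1) oriented_atlasD(1)[OF B b(2)]] .
    have opS: "open (?SA \<times> ?SB)" using op by (rule open_Times)
    have eq: "(?f (fst p), ?g (snd p)) = ?R p" if p: "p \<in> ?SA \<times> ?SB" for p
    proof -
      obtain u v where uv: "u \<in> fst a" "u \<in> fst a'" "v \<in> fst b" "v \<in> fst b'" "p = (snd a u, snd b v)"
        using p by auto
      then show ?thesis using chart_rep_pair_chart[OF inj uv(1,3), of "pair_chart a' b'" "\<lambda>x. x"] inj
        by (simp add: chart_rep_def)
    qed
    have C: "Ck (Suc 0) (?SA \<times> ?SB) (\<lambda>p. (?f (fst p), ?g (snd p)))"
      by (intro Ck_Pair opS Ck_compose[OF opS Ck_bounded_linear[OF bounded_linear_fst] oriented_atlas_transition(1)[OF A a] op(1)]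
          Ck_compose[OF opS Ck_bounded_linear[OF bounded_linear_snd] oriented_atlas_transition(1)[OF B b] op(2)]) auto
    show ?Ck unfolding dom by (rule Ck_cong[OF opS eq C])
    show "endo_det (chart_deriv (pair_chart a b) (pair_chart a' b') (\<lambda>x. x) x) > 0"
      if x: "x \<in> fst (pair_chart a b) \<inter> fst (pair_chart a' b')"
    proof -
      obtain u v where uv: "x = (u, v)" "u \<in> fst a" "u \<in> fst a'" "v \<in> fst b" "v \<in> fst b'" using x by auto
      have df: "?f differentiable (at (snd a u))" and dg: "?g differentiable (at (snd b v))"
        using C1_map_differentiable[OF oriented_atlas_id[OF A] a uv(2,3)]
          C1_map_differentiable[OF oriented_atlas_id[OF B] b uv(4,5)] .
      have 1: "((\<lambda>p. ?f (fst p)) has_derivative (\<lambda>h. frechet_derivative ?f (at (snd a u)) (fst h))) (at (snd a u, snd b v))"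
        using diff_chain_at[OF bounded_linear_imp_has_derivative[OF bounded_linear_fst], of ?f _ "(snd a u, snd b v)"]
          has_derivative_frechet[OF df] by (simp add: o_def)
      have 2: "((\<lambda>p. ?g (snd p)) has_derivative (\<lambda>h. frechet_derivative ?g (at (snd b v)) (snd h))) (at (snd a u, snd b v))"
        using diff_chain_at[OF bounded_linear_imp_has_derivative[OF bounded_linear_snd], of ?g _ "(snd a u, snd b v)"]
          has_derivative_frechet[OF dg] by (simp add: o_def)
      have mem: "(snd a u, snd b v) \<in> ?SA \<times> ?SB" using uv by blast
      have "chart_deriv (pair_chart a b) (pair_chart a' b') (\<lambda>x. x) x = frechet_derivative ?R (at (snd a u, snd b v))"
        using chart_deriv_open[of "pair_chart a b" x] top(2)[OF a(1) b(1)] uv by simp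
      also have "\<dots> = frechet_derivative (\<lambda>p. (?f (fst p), ?g (snd p))) (at (snd a u, snd b v))"
        by (rule frechet_derivative_cong_open[OF opS mem eq[symmetric]])
      also have "\<dots> = (\<lambda>h. (frechet_derivative ?f (at (snd a u)) (fst h), frechet_derivative ?g (at (snd b v)) (snd h)))"
        by (rule frechet_derivative_eq[OF has_derivative_Pair[OF 1 2]])
      finally have "endo_det (chart_deriv (pair_chart a b) (pair_chart a' b') (\<lambda>x. x) x) =
          endo_det (\<lambda>h. (frechet_derivative ?f (at (snd a u)) (fst h), frechet_derivative ?g (at (snd b v)) (snd h)))"
        by (rule arg_cong)
      also have "\<dots> = endo_det (frechet_derivative ?f (at (snd a u))) * endo_det (frechet_derivative ?g (at (snd b v)))"
        by (rule endo_det_product[OF linear_frechet_derivative[OF df] linear_frechet_derivative[OF dg]])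
      also have "\<dots> > 0"
        using oriented_atlas_transition(2)[OF A a uv(2,3)] oriented_atlas_transition(2)[OF B b uv(4,5)]
        by (simp add: chart_deriv_open[OF oriented_atlasD(2)[OF A a(1)] uv(2)]
            chart_deriv_open[OF oriented_atlasD(2)[OF B b(1)] uv(4)])
      finally show ?thesis .
    qed
  qed
  show ?thesis
    unfolding oriented_atlas_def carrier_of_prod_atlas
  proof (intro conjI ballI)
    fix c assume "c \<in> prod_atlas A B"
    then obtain a b where ab: "a \<in> A" "b \<in> B" "c = pair_chart a b" by (rule prod_atlasE)
    show "openin (top_of_set (carrier_of A \<times> carrier_of B)) (fst c)" "open (snd c ` fst c)"
      using top[OF ab(1,2)] unfolding ab(3) by simp_all
    show "homeomorphism (fst c) (snd c ` fst c) (snd c) (inv_into (fst c) (snd c))"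
      unfolding ab(3)
      by (rule homeomorphism_pair_chart[OF oriented_atlasD(3)[OF A ab(1)] oriented_atlasD(3)[OF B ab(2)]
          oriented_atlasD(4)[OF A ab(1)] oriented_atlasD(4)[OF B ab(2)]])
    fix d assume "d \<in> prod_atlas A B"
    then obtain a' b' where ab': "a' \<in> A" "b' \<in> B" "d = pair_chart a' b'" by (rule prod_atlasE)
    show "Ck (Suc 0) (snd c ` (fst c \<inter> fst d)) (chart_rep c d (\<lambda>x. x))"
      unfolding ab(3) ab'(3) by (rule trans(1)[OF ab(1) ab'(1) ab(2) ab'(2)])
    show "endo_det (chart_deriv c d (\<lambda>x. x) x) > 0" if "x \<in> fst c \<inter> fst d" for x
      using that unfolding ab(3) ab'(3) by (rule trans(2)[OF ab(1) ab'(1) ab(2) ab'(2)])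
  qed
qed

text \<open>Intervals and the circle have transition maps that are locally translations, hence
  smooth with derivative \<open>1\<close>.\<close>

lemma oriented_atlas_1I:
  fixes B :: "('b::topological_space, real) atlas"
  assumes top: "\<And>c. c \<in> B \<Longrightarrow> openin (top_of_set (carrier_of B)) (fst c) \<and> open (snd c ` fst c) \<and>
       homeomorphism (fst c) (snd c ` fst c) (snd c) (inv_into (fst c) (snd c))"
    and trans: "\<And>c d x. c \<in> B \<Longrightarrow> d \<in> B \<Longrightarrow> x \<in> fst c \<inter> fst d \<Longrightarrow>
      \<exists>V \<delta>. open V \<and> snd c x \<in> V \<and> (\<forall>s\<in>V. chart_rep c d (\<lambda>x. x) s = s + \<delta>)"
  shows "oriented_atlas B"
  unfolding oriented_atlas_def
proof (intro conjI ballI)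
  fix c assume c: "c \<in> B"
  show "openin (top_of_set (carrier_of B)) (fst c)" "open (snd c ` fst c)"
    "homeomorphism (fst c) (snd c ` fst c) (snd c) (inv_into (fst c) (snd c))"
    using top[OF c] by blast+
  fix d assume d: "d \<in> B"
  show "Ck (Suc 0) (snd c ` (fst c \<inter> fst d)) (chart_rep c d (\<lambda>x. x))"
  proof (rule Ck_local)
    fix s assume "s \<in> snd c ` (fst c \<inter> fst d)"
    then obtain x where x: "x \<in> fst c \<inter> fst d" "s = snd c x" by blast
    from trans[OF c d x(1)] obtain V \<delta> where V: "open V" "snd c x \<in> V" "\<forall>s\<in>V. chart_rep c d (\<lambda>x. x) s = s + \<delta>"
      by blast
    have "Ck (Suc 0) V (chart_rep c d (\<lambda>x. x))"
      by (rule Ck_cong[OF V(1) _ Ck_add[OF V(1) Ck_bounded_linear[OF bounded_linear_ident] Ck_const[of _ _ \<delta>]]])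
         (use V(3) in simp)
    then show "\<exists>V. open V \<and> s \<in> V \<and> Ck (Suc 0) V (chart_rep c d (\<lambda>x. x))" using V x by blast
  qed
  show "endo_det (chart_deriv c d (\<lambda>x. x) x) > 0" if x: "x \<in> fst c \<inter> fst d" for x
  proof -
    from trans[OF c d x] obtain V \<delta> where V: "open V" "snd c x \<in> V" "\<forall>s\<in>V. chart_rep c d (\<lambda>x. x) s = s + \<delta>"
      by blast
    have "frechet_derivative (chart_rep c d (\<lambda>x. x)) (at (snd c x)) = frechet_derivative (\<lambda>s. s + \<delta>) (at (snd c x))"
      by (rule frechet_derivative_cong_open[OF V(1,2)]) (use V(3) in blast)
    also have "\<dots> = (\<lambda>h. h)"
      by (rule frechet_derivative_eq) (auto intro!: derivative_eq_intros)
    finally show ?thesis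
      using chart_deriv_open[of c x d "\<lambda>x. x"] top[OF c] x by (simp add: endo_det_real)
  qed
qed

lemma oriented_atlas_interval:
  assumes "open J"
  shows "oriented_atlas (interval_atlas J)"
proof (rule oriented_atlas_1I)
  have inv: "inv_into J (\<lambda>t. t) s = s" if "s \<in> J" for s :: real
    using that by simp
  fix c :: "(real, real) chart" assume "c \<in> interval_atlas J"
  then have c: "c = (J, \<lambda>t. t)" by (simp add: interval_atlas_def)
  have "continuous_on J (inv_into J (\<lambda>t. t))"
    by (rule continuous_on_eq[OF continuous_on_id]) (simp add: inv)
  then show "openin (top_of_set (carrier_of (interval_atlas J))) (fst c) \<and> open (snd c ` fst c) \<and>
       homeomorphism (fst c) (snd c ` fst c) (snd c) (inv_into (fst c) (snd c))"
    using assms unfolding c by (auto simp: carrier_of_def interval_atlas_def homeomorphism_def inv)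
  fix d :: "(real, real) chart" assume "d \<in> interval_atlas J"
  then have d: "d = (J, \<lambda>t. t)" by (simp add: interval_atlas_def)
  show "\<exists>V \<delta>. open V \<and> snd c x \<in> V \<and> (\<forall>s\<in>V. chart_rep c d (\<lambda>x. x) s = s + \<delta>)" if "x \<in> fst c \<inter> fst d" for x
    using assms that unfolding c d by (intro exI[of _ J] exI[of _ 0]) (auto simp: chart_rep_def inv)
qed

text \<open>An explicit inverse of \<open>cis\<close> on an arc. The rotation by
  \<open>- a - pi\<close> moves the angles between \<open>a\<close> and \<open>a + 2 * pi\<close> to
  those between \<open>- pi\<close> and \<open>pi\<close>, where \<open>Arg\<close> is
  continuous.\<close>

definition arc_angle :: "real \<Rightarrow> complex \<Rightarrow> real" where
  "arc_angle a z = Arg (z * cis (- a - pi)) + a + pi"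

lemma arc_angle_cis: "a < t \<Longrightarrow> t < a + 2 * pi \<Longrightarrow> arc_angle a (cis t) = t"
  unfolding arc_angle_def by (simp add: cis_mult Arg_cis)

lemma inj_on_cis_arc: "inj_on cis {a<..<a + 2 * pi}"
  by (rule inj_on_inverseI[of _ "arc_angle a"]) (simp add: arc_angle_cis)

lemma cis_image_arc: "cis ` {a<..<a + 2 * pi} = sphere 0 1 - {cis a}"
proof (intro equalityI subsetI)
  fix z assume "z \<in> cis ` {a<..<a + 2 * pi}"
  then obtain t where t: "a < t" "t < a + 2 * pi" "z = cis t" by auto
  have "cis t \<noteq> cis a"
  proof
    assume "cis t = cis a"
    then have "arc_angle a (cis t) = arc_angle a (cis a)" by simp
    also have "arc_angle a (cis a) = Arg (cis (- pi)) + a + pi" by (simp add: arc_angle_def cis_mult)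
    also have "cis (- pi) = cis pi" by (simp add: complex_eq_iff)
    also have "Arg (cis pi) = pi" by (rule Arg_cis) auto
    finally show False using t by (simp add: arc_angle_cis)
  qed
  then show "z \<in> sphere 0 1 - {cis a}" using t by simp
next
  fix z assume z: "z \<in> sphere 0 1 - {cis a}"
  let ?w = "z * cis (- a - pi)"
  have w: "norm ?w = 1" using z by (simp add: norm_mult)
  then have "?w \<noteq> 0" by (metis norm_zero zero_neq_one)
  then have wc: "cis (Arg ?w) = ?w" using cis_Arg[of ?w] w by (simp add: sgn_div_norm)
  have zc: "cis (arc_angle a z) = z"
  proof -
    have "cis (arc_angle a z) = cis (Arg ?w) * cis (a + pi)" by (simp add: arc_angle_def cis_mult add.assoc)
    also have "\<dots> = z * (cis (- a - pi) * cis (a + pi))" unfolding wc by (simp add: mult.assoc)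
    also have "cis (- a - pi) * cis (a + pi) = 1" by (simp add: cis_mult)
    finally show ?thesis by simp
  qed
  have "a < arc_angle a z" "arc_angle a z \<le> a + 2 * pi"
    using mpi_less_Arg[of ?w] Arg_le_pi[of ?w] by (auto simp: arc_angle_def)
  moreover have "arc_angle a z \<noteq> a + 2 * pi"
  proof
    assume "arc_angle a z = a + 2 * pi"
    then have "z = cis (a + 2 * pi)" using zc by simp
    then show False using z by (simp add: cis_mult[symmetric])
  qed
  ultimately show "z \<in> cis ` {a<..<a + 2 * pi}" using zc by (intro image_eqI[of _ _ "arc_angle a z"]) auto
qed

lemma continuous_on_arc_angle: "continuous_on (sphere 0 1 - {cis a}) (arc_angle a)"
proof -
  have "z * cis (- a - pi) \<notin> \<real>\<^sub>\<le>\<^sub>0" if z: "z \<in> sphere 0 1 - {cis a}" for z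
  proof -
    obtain t where t: "a < t" "t < a + 2 * pi" "z = cis t" using z unfolding cis_image_arc[symmetric] by auto
    have "Arg (cis (t - a - pi)) = t - a - pi" by (rule Arg_cis) (use t in auto)
    then have "Arg (z * cis (- a - pi)) \<noteq> pi" using t by (simp add: cis_mult algebra_simps)
    moreover have "z * cis (- a - pi) \<noteq> 0" using t by simp
    ultimately show ?thesis
      by (metis Arg_eq_pi complex_nonpos_Reals_iff complex_is_Real_iff complex_eq_iff less_eq_real_def zero_complex.sel)
  qed
  then show ?thesis
    unfolding arc_angle_def by (intro continuous_intros) auto
qed

lemma carrier_of_circle_atlas: "carrier_of circle_atlas = sphere 0 1"
proof -
  have "cis 0 \<noteq> cis pi" by (simp add: complex_eq_iff)
  then have "z \<in> sphere 0 1 - {cis 0} \<or> z \<in> sphere 0 1 - {cis pi}" if "z \<in> sphere 0 1" for z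
    using that by auto
  then have "(\<Union>a. sphere 0 1 - {cis a}) = sphere 0 1" by blast
  moreover have "carrier_of circle_atlas = (\<Union>a. cis ` {a<..<a + 2 * pi})"
    by (simp add: carrier_of_def circle_atlas_def full_SetCompr_eq image_image)
  ultimately show ?thesis by (simp only: cis_image_arc)
qed

lemma inv_into_cis: "a < t \<Longrightarrow> t < a + 2 * pi \<Longrightarrow> inv_into {a<..<a + 2 * pi} cis (cis t) = t"
  by (rule inv_into_f_f[OF inj_on_cis_arc]) simp

lemma inv_into_angle:
  "a < t \<Longrightarrow> t < a + 2 * pi \<Longrightarrow> inv_into (cis ` {a<..<a + 2 * pi}) (inv_into {a<..<a + 2 * pi} cis) t = cis t"
proof -
  assume t: "a < t" "t < a + 2 * pi"
  have "inj_on (inv_into {a<..<a + 2 * pi} cis) (cis ` {a<..<a + 2 * pi})"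
    by (rule inj_on_inv_into) simp
  from inv_into_f_f[OF this, of "cis t"] show ?thesis using t by (simp add: inv_into_cis)
qed

lemma angle_image: "inv_into {a<..<a + 2 * pi} cis ` cis ` {a<..<a + 2 * pi} = {a<..<a + 2 * pi}"
  by (rule inv_into_image_cancel[OF inj_on_cis_arc]) simp

lemma oriented_atlas_circle: "oriented_atlas circle_atlas"
proof (rule oriented_atlas_1I)
  fix c :: "(complex, real) chart" assume "c \<in> circle_atlas"
  then obtain a where c: "c = (cis ` {a<..<a + 2 * pi}, inv_into {a<..<a + 2 * pi} cis)"
    by (auto simp: circle_atlas_def)
  have "openin (top_of_set (sphere 0 1)) (sphere 0 1 - {cis a})"
    unfolding Diff_eq by (intro openin_open_Int open_Compl closed_singleton)
  moreover have "continuous_on (sphere 0 1 - {cis a}) (inv_into {a<..<a + 2 * pi} cis)"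
  proof (rule continuous_on_eq[OF continuous_on_arc_angle])
    fix z assume "z \<in> sphere 0 1 - {cis a}"
    then obtain t where "a < t" "t < a + 2 * pi" "z = cis t" unfolding cis_image_arc[symmetric] by auto
    then show "arc_angle a z = inv_into {a<..<a + 2 * pi} cis z" by (simp add: arc_angle_cis inv_into_cis)
  qed
  moreover have "continuous_on {a<..<a + 2 * pi} (inv_into (cis ` {a<..<a + 2 * pi}) (inv_into {a<..<a + 2 * pi} cis))"
    by (rule continuous_on_eq[of _ cis]) (auto intro!: continuous_intros simp: inv_into_angle)
  ultimately show "openin (top_of_set (carrier_of circle_atlas)) (fst c) \<and> open (snd c ` fst c) \<and>
       homeomorphism (fst c) (snd c ` fst c) (snd c) (inv_into (fst c) (snd c))"
    unfolding c carrier_of_circle_atlas homeomorphism_def fst_conv snd_conv angle_image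
    by (simp add: cis_image_arc[symmetric] angle_image) (force simp: inv_into_cis inv_into_angle image_iff)
  fix d :: "(complex, real) chart" assume "d \<in> circle_atlas"
  then obtain b where d: "d = (cis ` {b<..<b + 2 * pi}, inv_into {b<..<b + 2 * pi} cis)"
    by (auto simp: circle_atlas_def)
  fix x assume x: "x \<in> fst c \<inter> fst d"
  then obtain s0 t0 where s: "a < s0" "s0 < a + 2 * pi" "x = cis s0" and t: "b < t0" "t0 < b + 2 * pi" "x = cis t0"
    unfolding c d by auto
  \<comment> \<open>The two angles of \<open>x\<close> differ by a multiple of
    \<open>2 * pi\<close>, and this difference is the translation near \<open>x\<close>.\<close>
  have cis1: "cis (t0 - s0) = 1" using s(3) t(3) by (simp add: cis_divide[symmetric])
  show "\<exists>V \<delta>. open V \<and> snd c x \<in> V \<and> (\<forall>s\<in>V. chart_rep c d (\<lambda>x. x) s = s + \<delta>)"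
  proof (intro exI conjI ballI)
    show "open ({a<..<a + 2 * pi} \<inter> {b - (t0 - s0)<..<b + 2 * pi - (t0 - s0)})" by (intro open_Int open_greaterThanLessThan)
    show "snd c x \<in> {a<..<a + 2 * pi} \<inter> {b - (t0 - s0)<..<b + 2 * pi - (t0 - s0)}"
      unfolding c using s t by (simp add: inv_into_cis)
    fix r assume r: "r \<in> {a<..<a + 2 * pi} \<inter> {b - (t0 - s0)<..<b + 2 * pi - (t0 - s0)}"
    have "cis r = cis (r + (t0 - s0))" using cis_mult[of r "t0 - s0"] cis1 by simp
    then show "chart_rep c d (\<lambda>x. x) r = r + (t0 - s0)"
      unfolding c d chart_rep_def using r by (simp add: inv_into_angle inv_into_cis)
  qed
qed

section \<open>Reparametrised maps on cylinders\<close>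

lemma continuous_on_openin_local:
  fixes f :: "'a::t2_space \<Rightarrow> 'b::topological_space"
  assumes "\<And>x. x \<in> S \<Longrightarrow> \<exists>T. openin (top_of_set S) T \<and> x \<in> T \<and> continuous_on T f"
  shows "continuous_on S f"
  unfolding continuous_on_eq_continuous_within
proof
  fix x assume x: "x \<in> S"
  obtain T where T: "openin (top_of_set S) T" "x \<in> T" "continuous_on T f" using assms[OF x] by blast
  then obtain U where U: "open U" "T = S \<inter> U" unfolding openin_open by blast
  have "at x within T = at x within S"
    by (rule at_within_nhd[of x U]) (use U T(2) in auto)
  then show "continuous (at x within S) f"
    using T(2,3) by (metis continuous_on_eq_continuous_within)
qed

definition unit_chart :: "real set \<Rightarrow> (real, real) chart" where
  "unit_chart J = (J, \<lambda>t. t)"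

lemma unit_chart_simps [simp]: "fst (unit_chart J) = J" "snd (unit_chart J) t = t" "inj_on (snd (unit_chart J)) A"
  by (simp_all add: unit_chart_def inj_on_def)

lemma interval_atlas_eq: "interval_atlas J = {unit_chart J}"
  by (simp add: interval_atlas_def unit_chart_def)

lemma carrier_of_interval_atlas [simp]: "carrier_of (interval_atlas J) = J"
  by (simp add: carrier_of_def interval_atlas_eq)

lemma prod_interval_atlasE:
  assumes "c \<in> prod_atlas A (interval_atlas J)"
  obtains a where "a \<in> A" "c = pair_chart a (unit_chart J)"
  using assms by (auto simp: interval_atlas_eq elim: prod_atlasE)

lemma pair_unit_chart_in: "a \<in> A \<Longrightarrow> pair_chart a (unit_chart J) \<in> prod_atlas A (interval_atlas J)"
  by (rule pair_chart_in_prod_atlas) (simp_all add: interval_atlas_eq)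

text \<open>A single gluing principle for affine changes of time, concatenations and loops: near
  each parameter \<open>v\<close> the map \<open>C\<close> has to be some smooth \<open>G\<close>
  after a change \<open>r\<close> of the chart coordinate. As \<open>r\<close> is smooth on the
  whole line, extensions of \<open>G\<close> across the boundary pull back to extensions of
  \<open>C\<close>. The map \<open>G\<close> and the interval \<open>J\<close> may depend on
  \<open>v\<close>.\<close>

theorem smooth_map_reparam:
  fixes N :: "('n::t2_space, 'e::euclidean_space) atlas" and B :: "('b::t2_space, real) atlas"
    and M :: "('m::topological_space, 'f::euclidean_space) atlas" and C :: "'n \<times> 'b \<Rightarrow> 'm"
  assumes N: "oriented_atlas N"
    and B: "\<And>b. b \<in> B \<Longrightarrow> inj_on (snd b) (fst b) \<and> continuous_on (fst b) (snd b) \<and> openin (top_of_set (carrier_of B)) (fst b)"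
    and loc: "\<And>b v. b \<in> B \<Longrightarrow> v \<in> fst b \<Longrightarrow> \<exists>G J \<delta> r. smooth_map (prod_atlas N (interval_atlas J)) M G \<and> \<delta> > 0 \<and>
       (\<forall>k. Ck k UNIV r) \<and> (\<forall>v'\<in>fst b. \<bar>snd b v' - snd b v\<bar> < \<delta> \<longrightarrow> r (snd b v') \<in> J \<and>
         (\<forall>n\<in>carrier_of N. C (n, v') = G (n, r (snd b v'))))"
  shows "smooth_map (prod_atlas N B) M C"
  unfolding smooth_map_def carrier_of_prod_atlas
proof (intro conjI ballI)
  show "C ` (carrier_of N \<times> carrier_of B) \<subseteq> carrier_of M"
  proof
    fix y assume "y \<in> C ` (carrier_of N \<times> carrier_of B)"
    then obtain n v where nv: "n \<in> carrier_of N" "v \<in> carrier_of B" "y = C (n, v)" by blast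
    obtain b where b: "b \<in> B" "v \<in> fst b" using carrier_of_cover[OF nv(2)] by blast
    obtain G J \<delta> r where G': "smooth_map (prod_atlas N (interval_atlas J)) M G" "\<delta> > 0"
      "\<forall>v'\<in>fst b. \<bar>snd b v' - snd b v\<bar> < \<delta> \<longrightarrow> r (snd b v') \<in> J \<and>
         (\<forall>n\<in>carrier_of N. C (n, v') = G (n, r (snd b v')))"
      using loc[OF b] by blast
    have "\<bar>snd b v - snd b v\<bar> < \<delta>" using G'(2) by simp
    then have G: "smooth_map (prod_atlas N (interval_atlas J)) M G" "\<delta> > 0"
      "r (snd b v) \<in> J" "C (n, v) = G (n, r (snd b v))"
      using G' b(2) nv(1) by blast+
    have "G (n, r (snd b v)) \<in> carrier_of M"
      using G(1,3) nv(1) unfolding smooth_map_def by auto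
    then show "y \<in> carrier_of M" using nv(3) G(4) by simp
  qed
next
  show "continuous_on (carrier_of N \<times> carrier_of B) C"
  proof (rule continuous_on_openin_local)
    fix x assume "x \<in> carrier_of N \<times> carrier_of B"
    then obtain n v where nv: "n \<in> carrier_of N" "v \<in> carrier_of B" "x = (n, v)" by blast
    obtain b where b: "b \<in> B" "v \<in> fst b" using carrier_of_cover[OF nv(2)] by blast
    obtain G J \<delta> r where G: "smooth_map (prod_atlas N (interval_atlas J)) M G" "\<delta> > 0" "\<And>k. Ck k UNIV r"
      "\<forall>v'\<in>fst b. \<bar>snd b v' - snd b v\<bar> < \<delta> \<longrightarrow> r (snd b v') \<in> J \<and>
         (\<forall>n\<in>carrier_of N. C (n, v') = G (n, r (snd b v')))"
      using loc[OF b] by blast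
    note Bb = B[OF b(1)]
    define V where "V = fst b \<inter> snd b -` ball (snd b v) \<delta>"
    have "openin (top_of_set (fst b)) V"
      unfolding V_def using Bb by (intro continuous_openin_preimage_gen) auto
    then have Vop: "openin (top_of_set (carrier_of B)) V"
      using Bb openin_trans by blast
    have V: "r (snd b v') \<in> J" "\<forall>n\<in>carrier_of N. C (n, v') = G (n, r (snd b v'))" if "v' \<in> V" for v'
      using G(4) that by (auto simp: V_def dist_real_def abs_minus_commute)
    show "\<exists>T. openin (top_of_set (carrier_of N \<times> carrier_of B)) T \<and> x \<in> T \<and> continuous_on T C"
    proof (intro exI conjI)
      obtain S where "open S" "V = carrier_of B \<inter> S" using Vop unfolding openin_open by blast
      then show "openin (top_of_set (carrier_of N \<times> carrier_of B)) (carrier_of N \<times> V)"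
        unfolding openin_open by (intro exI[of _ "UNIV \<times> S"]) (auto simp: open_Times)
      show "x \<in> carrier_of N \<times> V" using nv b(2) G(2) by (simp add: V_def)
      have c1: "continuous_on (carrier_of N \<times> V) (\<lambda>p. snd b (snd p))"
        by (rule continuous_on_compose2[OF _ continuous_on_snd[OF continuous_on_id]]) (use Bb in \<open>auto simp: V_def\<close>)
      have c2: "continuous_on (carrier_of N \<times> V) (\<lambda>p. r (snd b (snd p)))"
        by (rule continuous_on_compose2[OF Ck_continuous_on[OF G(3)] c1]) simp
      have c3: "continuous_on (carrier_of N \<times> V) (\<lambda>p. (fst p, r (snd b (snd p))))"
        by (rule continuous_on_Pair[OF continuous_on_fst[OF continuous_on_id] c2])
      have "continuous_on (carrier_of N \<times> J) G"
        using G(1) unfolding smooth_map_def by simp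
      then have "continuous_on (carrier_of N \<times> V) (\<lambda>p. G (fst p, r (snd b (snd p))))"
        by (rule continuous_on_compose2[OF _ c3]) (use V in auto)
      then show "continuous_on (carrier_of N \<times> V) C"
        by (rule continuous_on_eq) (use V in auto)
    qed
  qed
next
  fix c d assume "c \<in> prod_atlas N B" and d: "d \<in> M"
  then obtain a b where ab: "a \<in> N" "b \<in> B" "c = pair_chart a b" by (blast elim: prod_atlasE)
  have inj: "inj_on (snd a) (fst a)" "inj_on (snd b) (fst b)"
    using oriented_atlasD(4)[OF N ab(1)] B[OF ab(2)] by auto
  show "smooth_on (snd c ` (fst c \<inter> C -` fst d)) (chart_rep c d C)"
    unfolding smooth_on_def
  proof
    fix x assume "x \<in> snd c ` (fst c \<inter> C -` fst d)"
    then obtain u v where uv: "u \<in> fst a" "v \<in> fst b" "C (u, v) \<in> fst d" "x = (snd a u, snd b v)"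
      unfolding ab(3) by auto
    obtain G J \<delta> r where G: "smooth_map (prod_atlas N (interval_atlas J)) M G" "\<delta> > 0" "\<And>k. Ck k UNIV r"
      "\<forall>v'\<in>fst b. \<bar>snd b v' - snd b v\<bar> < \<delta> \<longrightarrow> r (snd b v') \<in> J \<and>
         (\<forall>n\<in>carrier_of N. C (n, v') = G (n, r (snd b v')))"
      using loc[OF ab(2) uv(2)] by blast
    have aN: "fst a \<subseteq> carrier_of N" by (rule oriented_atlasD(5)[OF N ab(1)])
    let ?c = "pair_chart a (unit_chart J)" and ?s = "snd b v"
    have Gc: "smooth_on (snd ?c ` (fst ?c \<inter> G -` fst d)) (chart_rep ?c d G)"
      using G(1) pair_unit_chart_in[OF ab(1)] d unfolding smooth_map_def by blast
    have memG: "(snd a u', r (snd b v')) \<in> snd ?c ` (fst ?c \<inter> G -` fst d)"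
      and repG: "chart_rep ?c d G (snd a u', r (snd b v')) = snd d (C (u', v'))"
      if "u' \<in> fst a" "v' \<in> fst b" "\<bar>snd b v' - ?s\<bar> < \<delta>" "C (u', v') \<in> fst d" for u' v'
    proof -
      have r: "r (snd b v') \<in> J" "C (u', v') = G (u', r (snd b v'))"
        using G(4) that aN by blast+
      show "(snd a u', r (snd b v')) \<in> snd ?c ` (fst ?c \<inter> G -` fst d)"
        using r that by (intro image_eqI[of _ _ "(u', r (snd b v'))"]) auto
      show "chart_rep ?c d G (snd a u', r (snd b v')) = snd d (C (u', v'))"
        using chart_rep_pair_chart[of a "unit_chart J" u' "r (snd b v')" d G] inj(1) r that by simp
    qed
    have "(snd a u, r ?s) \<in> snd ?c ` (fst ?c \<inter> G -` fst d)"
      by (rule memG) (use uv G(2) in auto)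
    then obtain \<Omega> h where h: "(snd a u, r ?s) \<in> \<Omega>" "smooth_on_open \<Omega> h"
      "\<forall>y\<in>\<Omega> \<inter> snd ?c ` (fst ?c \<inter> G -` fst d). h y = chart_rep ?c d G y"
      using Gc unfolding smooth_on_def by blast
    \<comment> \<open>The change of time in charts; the local extension \<open>h\<close> of
      \<open>G\<close> composed with \<open>?R\<close> will be the local extension of
      \<open>C\<close>.\<close>
    let ?R = "\<lambda>q :: 'e \<times> real. (fst q, r (snd q))"
    have CR: "Ck k UNIV ?R" for k
      by (intro Ck_Pair open_UNIV Ck_bounded_linear bounded_linear_fst
          Ck_compose[OF open_UNIV Ck_bounded_linear[OF bounded_linear_snd] G(3) open_UNIV]) auto
    define \<Omega>' where "\<Omega>' = ?R -` \<Omega> \<inter> (UNIV \<times> ball ?s \<delta>)"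
    have \<Omega>: "open \<Omega>" "\<And>k. Ck k \<Omega> h" using h(2) by (auto simp: smooth_on_open_iff_Ck)
    have op: "open \<Omega>'"
      unfolding \<Omega>'_def by (intro open_Int open_vimage \<Omega> Ck_continuous_on[OF CR[of 0]] open_Times) auto
    have "Ck k \<Omega>' (\<lambda>q. h (?R q))" for k
      by (rule Ck_compose[OF op Ck_subset[OF CR subset_UNIV] \<Omega>(2,1)]) (auto simp: \<Omega>'_def)
    then have "smooth_on_open \<Omega>' (\<lambda>q. h (?R q))" using op by (simp add: smooth_on_open_iff_Ck)
    moreover have "x \<in> \<Omega>'" using uv(4) h(1) G(2) by (simp add: \<Omega>'_def)
    moreover have "h (?R y) = chart_rep c d C y" if y: "y \<in> \<Omega>' \<inter> snd c ` (fst c \<inter> C -` fst d)" for y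
    proof -
      obtain u' v' where u': "u' \<in> fst a" "v' \<in> fst b" "C (u', v') \<in> fst d" "y = (snd a u', snd b v')"
        using y unfolding ab(3) by auto
      have \<delta>: "\<bar>snd b v' - ?s\<bar> < \<delta>" using y u'(4) by (simp add: \<Omega>'_def dist_real_def abs_minus_commute)
      have "?R y \<in> \<Omega>" using y by (auto simp: \<Omega>'_def)
      then have "h (?R y) = snd d (C (u', v'))"
        using h(3) memG[OF u'(1,2) \<delta> u'(3)] repG[OF u'(1,2) \<delta> u'(3)] u'(4) by simp
      also have "\<dots> = chart_rep c d C y"
        unfolding ab(3) u'(4) by (rule chart_rep_pair_chart[OF inj u'(1,2), symmetric])
      finally show ?thesis .
    qed
    ultimately show "\<exists>U h. x \<in> U \<and> smooth_on_open U h \<and> (\<forall>y\<in>U \<inter> snd c ` (fst c \<inter> C -` fst d). h y = chart_rep c d C y)"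
      by blast
  qed
qed

lemma Ck_affine_real: "Ck k UNIV (\<lambda>t :: real. a + b * t)"
  by (intro Ck_add Ck_mult Ck_const open_UNIV Ck_bounded_linear bounded_linear_ident)

lemma interval_atlas_chart_props:
  "b \<in> interval_atlas J \<Longrightarrow> inj_on (snd b) (fst b) \<and> continuous_on (fst b) (snd b) \<and>
    openin (top_of_set (carrier_of (interval_atlas J))) (fst b)"
  by (auto simp: interval_atlas_eq unit_chart_def inj_on_def carrier_of_def)

lemma smooth_map_interval_reparam:
  fixes N :: "('n::t2_space, 'e::euclidean_space) atlas"
    and M :: "('m::topological_space, 'f::euclidean_space) atlas"
  assumes N: "oriented_atlas N" and G: "smooth_map (prod_atlas N (interval_atlas J)) M G"
    and r: "\<And>k. Ck k UNIV r" "\<And>s. s \<in> J' \<Longrightarrow> r s \<in> J"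
    and C: "\<And>n s. n \<in> carrier_of N \<Longrightarrow> s \<in> J' \<Longrightarrow> C (n, s) = G (n, r s)"
  shows "smooth_map (prod_atlas N (interval_atlas J')) M C"
proof (rule smooth_map_reparam[OF N interval_atlas_chart_props])
  fix b v assume "b \<in> interval_atlas J'" "v \<in> fst b"
  then have b: "b = unit_chart J'" by (simp add: interval_atlas_eq)
  show "\<exists>G J \<delta> r. smooth_map (prod_atlas N (interval_atlas J)) M G \<and> \<delta> > 0 \<and>
       (\<forall>k. Ck k UNIV r) \<and> (\<forall>v'\<in>fst b. \<bar>snd b v' - snd b v\<bar> < \<delta> \<longrightarrow> r (snd b v') \<in> J \<and>
         (\<forall>n\<in>carrier_of N. C (n, v') = G (n, r (snd b v'))))"
    using G r C unfolding b by (intro exI[of _ G] exI[of _ J] exI[of _ 1] exI[of _ r]) auto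
qed

lemma smooth_map_interval_subset:
  fixes N :: "('n::t2_space, 'e::euclidean_space) atlas"
  assumes "oriented_atlas N" "smooth_map (prod_atlas N (interval_atlas J)) M G" "J' \<subseteq> J"
  shows "smooth_map (prod_atlas N (interval_atlas J')) M G"
  by (rule smooth_map_interval_reparam[OF assms(1,2), of "\<lambda>s. s"])
     (use assms(3) in \<open>auto intro!: Ck_bounded_linear bounded_linear_ident simp del: Ck.simps\<close>)

text \<open>At a time in the open set \<open>J'\<close> the derivative within the larger cylinder is
  the ordinary derivative. This carries regularity and signs from the closed cylinder to the open
  one, to which \<open>oriented_atlas\<close> applies.\<close>

lemma chart_deriv_interval_subset:
  assumes a: "inj_on (snd a) (fst a)" "open (snd a ` fst a)" and J: "open J'" "J' \<subseteq> J" and x: "n \<in> fst a" "t \<in> J'"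
  shows "chart_deriv (pair_chart a (unit_chart J)) d F (n, t) = chart_deriv (pair_chart a (unit_chart J')) d F (n, t)"
proof -
  have img: "snd (pair_chart a (unit_chart K)) ` (fst a \<times> K) = snd a ` fst a \<times> K" for K
    by (simp add: image_pair_chart)
  have op: "open (snd a ` fst a \<times> J')" using a(2) J(1) by (rule open_Times)
  have "(snd a n, t) \<in> interior (snd a ` fst a \<times> J)"
    by (rule interiorI[OF op]) (use x J(2) in auto)
  then have "at (snd a n, t) within snd a ` fst a \<times> J = at (snd a n, t)"
    by (rule at_within_interior)
  moreover have "at (snd a n, t) within snd a ` fst a \<times> J' = at (snd a n, t)"
    by (rule at_within_open[OF _ op]) (use x in auto)
  moreover have "frechet_derivative (chart_rep (pair_chart a (unit_chart J)) d F) (at (snd a n, t)) =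
      frechet_derivative (chart_rep (pair_chart a (unit_chart J')) d F) (at (snd a n, t))"
  proof (rule frechet_derivative_cong_open[OF op])
    show "(snd a n, t) \<in> snd a ` fst a \<times> J'" using x by auto
    fix y assume "y \<in> snd a ` fst a \<times> J'"
    then obtain u s where us: "u \<in> fst a" "s \<in> J'" "y = (snd a u, s)" by auto
    show "chart_rep (pair_chart a (unit_chart J)) d F y = chart_rep (pair_chart a (unit_chart J')) d F y"
      using chart_rep_pair_chart[of a "unit_chart J" u s d F] chart_rep_pair_chart[of a "unit_chart J'" u s d F] a(1) us J(2)
      by auto
  qed
  ultimately show ?thesis by (simp add: chart_deriv_def img)
qed

lemma regular_value_interval_subset:
  assumes N: "oriented_atlas N" and J: "open J'" "J' \<subseteq> J"
    and r: "regular_value (prod_atlas N (interval_atlas J)) M F p"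
  shows "regular_value (prod_atlas N (interval_atlas J')) M F p"
  unfolding regular_value_def
proof (intro ballI impI)
  fix x assume x: "x \<in> carrier_of (prod_atlas N (interval_atlas J'))" "F x = p"
  then obtain n t where nt: "x = (n, t)" "n \<in> carrier_of N" "t \<in> J'" by auto
  then have "x \<in> carrier_of (prod_atlas N (interval_atlas J))" using J(2) by auto
  then obtain c d where c: "c \<in> prod_atlas N (interval_atlas J)" "d \<in> M" "x \<in> fst c" "p \<in> fst d" "surj (chart_deriv c d F x)"
    using r x(2) unfolding regular_value_def by blast
  obtain a where a: "a \<in> N" "c = pair_chart a (unit_chart J)" using c(1) by (rule prod_interval_atlasE)
  have na: "n \<in> fst a" using c(3) a(2) nt(1) by simp
  have "chart_deriv c d F x = chart_deriv (pair_chart a (unit_chart J')) d F x"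
    unfolding a(2) nt(1)
    by (rule chart_deriv_interval_subset[OF oriented_atlasD(4)[OF N a(1)] oriented_atlasD(2)[OF N a(1)] J na nt(3)])
  then show "\<exists>c\<in>prod_atlas N (interval_atlas J'). \<exists>d\<in>M. x \<in> fst c \<and> p \<in> fst d \<and> surj (chart_deriv c d F x)"
    using c(2,4,5) na nt pair_unit_chart_in[OF a(1), of J'] by (intro bexI[of _ "pair_chart a (unit_chart J')"] bexI[of _ d]) auto
qed

lemma orientation_preserving_at_interval_subset:
  assumes N: "oriented_atlas N" and J: "open J'" "J' \<subseteq> J" and t: "t \<in> J'"
  shows "orientation_preserving_at (prod_atlas N (interval_atlas J)) M F (n, t) \<longleftrightarrow>
    orientation_preserving_at (prod_atlas N (interval_atlas J')) M F (n, t)"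
proof -
  have op: "orientation_preserving_at (prod_atlas N (interval_atlas K)) M F (n, t) \<longleftrightarrow>
     (\<exists>a\<in>N. \<exists>d\<in>M. n \<in> fst a \<and> t \<in> K \<and> F (n, t) \<in> fst d \<and> endo_det (chart_deriv (pair_chart a (unit_chart K)) d F (n, t)) > 0)"
    (is "?l \<longleftrightarrow> ?r") for K
  proof
    assume ?l
    then obtain c d where c: "c \<in> prod_atlas N (interval_atlas K)" "d \<in> M" "(n, t) \<in> fst c" "F (n, t) \<in> fst d"
      "endo_det (chart_deriv c d F (n, t)) > 0" unfolding orientation_preserving_at_def by blast
    obtain a where "a \<in> N" "c = pair_chart a (unit_chart K)" using c(1) by (rule prod_interval_atlasE)
    then show ?r using c by auto
  next
    assume ?r
    then show ?l unfolding orientation_preserving_at_def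
      using pair_unit_chart_in[of _ N K] by (metis SigmaI fst_pair_chart unit_chart_simps(1))
  qed
  have eq: "endo_det (chart_deriv (pair_chart a (unit_chart J)) d F (n, t)) = endo_det (chart_deriv (pair_chart a (unit_chart J')) d F (n, t))"
    if "a \<in> N" "n \<in> fst a" for a d
    using chart_deriv_interval_subset[OF oriented_atlasD(4)[OF N that(1)] oriented_atlasD(2)[OF N that(1)] J that(2) t] by metis
  have "t \<in> J" using t J(2) by blast
  then show ?thesis
    unfolding op by (intro bex_cong refl) (use t eq in auto)
qed

lemma signed_count_interval_subset:
  assumes N: "oriented_atlas N" and J: "open J'" "J' \<subseteq> J"
    and fib: "\<And>n t. n \<in> carrier_of N \<Longrightarrow> t \<in> J \<Longrightarrow> F (n, t) = p \<Longrightarrow> t \<in> J'"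
  shows "signed_count (prod_atlas N (interval_atlas J)) M F p = signed_count (prod_atlas N (interval_atlas J')) M F p"
  unfolding signed_count_def
proof (rule sum.cong)
  show "{x. x \<in> carrier_of (prod_atlas N (interval_atlas J)) \<and> F x = p} =
    {x. x \<in> carrier_of (prod_atlas N (interval_atlas J')) \<and> F x = p}"
    using fib J(2) by auto
  fix x assume "x \<in> {x. x \<in> carrier_of (prod_atlas N (interval_atlas J')) \<and> F x = p}"
  then obtain n t where x: "x = (n, t)" "t \<in> J'" by auto
  then show "(if orientation_preserving_at (prod_atlas N (interval_atlas J)) M F x then 1 else - 1) =
    (if orientation_preserving_at (prod_atlas N (interval_atlas J')) M F x then 1 else - 1 :: int)"
    by (simp only: x(1) orientation_preserving_at_interval_subset[OF N J x(2)])
qed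

section \<open>Signed counts under reparametrisation\<close>

text \<open>An injective linear map satisfies \<open>norm (L h) \<ge> B * norm h\<close> with
  \<open>B > 0\<close>. Where the error of the linear approximation is at most half of this bound,
  the value at \<open>y\<close> cannot recur.\<close>

lemma injective_derivative_isolated:
  fixes f :: "'a::euclidean_space \<Rightarrow> 'b::euclidean_space"
  assumes f: "(f has_derivative L) (at y)" and L: "inj L"
  obtains \<delta> where "\<delta> > 0" "\<And>y'. norm (y' - y) < \<delta> \<Longrightarrow> y' \<noteq> y \<Longrightarrow> f y' \<noteq> f y"
proof -
  have lin: "linear L" using f has_derivative_linear by blast
  obtain B where B: "B > 0" "\<And>h. B * norm h \<le> norm (L h)"
    using linear_inj_bounded_below_pos[OF lin L] by metis
  have "\<exists>\<delta>>0. \<forall>y'. norm (y' - y) < \<delta> \<longrightarrow> norm (f y' - f y - L (y' - y)) \<le> (B / 2) * norm (y' - y)"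
    using f B(1) unfolding has_derivative_at_alt by (meson half_gt_zero)
  then obtain \<delta> where \<delta>: "\<delta> > 0"
    "\<And>y'. norm (y' - y) < \<delta> \<Longrightarrow> norm (f y' - f y - L (y' - y)) \<le> (B / 2) * norm (y' - y)"
    by blast
  show ?thesis
  proof (rule that[OF \<delta>(1)])
    fix y' assume y': "norm (y' - y) < \<delta>" "y' \<noteq> y"
    show "f y' \<noteq> f y"
    proof
      assume "f y' = f y"
      then have "norm (L (y' - y)) \<le> (B / 2) * norm (y' - y)"
        using \<delta>(2)[OF y'(1)] by simp
      with B(2)[of "y' - y"] have "B * norm (y' - y) \<le> (B / 2) * norm (y' - y)" by linarith
      moreover have "norm (y' - y) > 0" using y'(2) by simp
      ultimately show False using B(1) by (simp add: field_simps)
    qed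
  qed
qed

lemma regular_fibre_isolated:
  fixes A :: "('a::topological_space, 'e::euclidean_space) atlas" and B :: "('b::topological_space, 'e) atlas"
  assumes A: "oriented_atlas A" and B: "oriented_atlas B" and F: "C1_map A B F"
    and r: "regular_value A B F q" and x: "x \<in> carrier_of A" "F x = q"
  obtains T where "openin (top_of_set (carrier_of A)) T" "x \<in> T" "\<And>x'. x' \<in> T \<Longrightarrow> F x' = q \<Longrightarrow> x' = x"
proof -
  obtain c where c: "c \<in> A" "x \<in> fst c" using carrier_of_cover[OF x(1)] by blast
  have "q \<in> carrier_of B" using F x unfolding C1_map_def by blast
  then obtain d where d: "d \<in> B" "q \<in> fst d" using carrier_of_cover by metis
  note ch = oriented_atlasD[OF A c(1)]
  let ?f = "chart_rep c d F" and ?L = "frechet_derivative (chart_rep c d F) (at (snd c x))"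
  have df: "?f differentiable (at (snd c x))"
    using C1_map_differentiable[OF F c(1) d(1) c(2)] x(2) d(2) by simp
  have "endo_det (chart_deriv c d F x) \<noteq> 0"
    using r c d x(2) unfolding regular_value_iff[OF A B F] by blast
  then have "surj ?L"
    using endo_det_nonzero_iff_surj[OF linear_frechet_derivative[OF df]] chart_deriv_open[OF ch(2) c(2)] by metis
  then have "inj ?L"
    using linear_surjective_imp_injective[OF linear_frechet_derivative[OF df]] by blast
  from injective_derivative_isolated[OF has_derivative_frechet[OF df] this]
  obtain \<delta> where \<delta>: "\<delta> > 0" "\<And>y'. norm (y' - snd c x) < \<delta> \<Longrightarrow> y' \<noteq> snd c x \<Longrightarrow> ?f y' \<noteq> ?f (snd c x)"
    by metis
  let ?T = "fst c \<inter> snd c -` ball (snd c x) \<delta>"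
  have "openin (top_of_set (fst c)) ?T"
    by (rule continuous_openin_preimage_gen[OF homeomorphism_cont1[OF ch(3)] open_ball])
  then have op: "openin (top_of_set (carrier_of A)) ?T"
    using ch(1) openin_trans by blast
  show ?thesis
  proof (rule that[OF op])
    show "x \<in> ?T" using c(2) \<delta>(1) by simp
    fix x' assume x': "x' \<in> ?T" "F x' = q"
    then have "norm (snd c x' - snd c x) < \<delta>" by (simp add: dist_norm norm_minus_commute)
    moreover have "?f (snd c x') = ?f (snd c x)"
      using x' c(2) x(2) ch(4) by (simp add: chart_rep_def)
    ultimately have "snd c x' = snd c x" using \<delta>(2) by blast
    then show "x' = x" using inj_onD[OF ch(4)] x' c(2) by blast
  qed
qed

text \<open>The fibre is compact and discrete. Finiteness matters because
  \<open>signed_count\<close> is a \<open>sum\<close>, which is \<open>0\<close> by default on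
  infinite sets and would not split along a concatenation.\<close>

lemma finite_isolated_fibre:
  fixes F :: "'a::t2_space \<Rightarrow> 'b::t2_space"
  assumes K: "compact K" and F: "continuous_on K F"
    and iso: "\<And>x. x \<in> K \<Longrightarrow> F x = q \<Longrightarrow> \<exists>T. open T \<and> x \<in> T \<and> (\<forall>x'\<in>T \<inter> K. F x' = q \<longrightarrow> x' = x)"
  shows "finite {x \<in> K. F x = q}"
proof -
  let ?Z = "{x \<in> K. F x = q}"
  have "closedin (top_of_set K) ?Z" by (rule continuous_closedin_preimage_constant[OF F])
  then have Z: "compact ?Z" using K closedin_compact by blast
  obtain T where T: "\<And>x. x \<in> ?Z \<Longrightarrow> open (T x) \<and> x \<in> T x \<and> (\<forall>x'\<in>T x \<inter> K. F x' = q \<longrightarrow> x' = x)"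
    using iso by (metis (mono_tags, lifting) mem_Collect_eq)
  obtain S where S: "S \<subseteq> ?Z" "finite S" "?Z \<subseteq> (\<Union>x\<in>S. T x)"
    by (rule compactE_image[OF Z, of ?Z T]) (use T in blast)+
  have "?Z \<subseteq> S"
  proof
    fix z assume z: "z \<in> ?Z"
    then obtain x where x: "x \<in> S" "z \<in> T x" using S(3) by blast
    then have "z = x" using T[of x] S(1) z by blast
    then show "z \<in> S" using x by simp
  qed
  then show ?thesis using S(2) finite_subset by blast
qed

definition local_sign :: "('a, 'e::euclidean_space) atlas \<Rightarrow> ('b, 'e) atlas \<Rightarrow> ('a \<Rightarrow> 'b) \<Rightarrow> 'a \<Rightarrow> int" where
  "local_sign A B F x = (if orientation_preserving_at A B F x then 1 else -1)"

lemma signed_count_eq_sum: "signed_count A B F q = (\<Sum>x | x \<in> carrier_of A \<and> F x = q. local_sign A B F x)"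
  by (simp only: signed_count_def local_sign_def)

text \<open>In charts \<open>C\<close> is locally \<open>G\<close> after
  \<open>(y, s) \<mapsto> (y, r s)\<close>, whose derivative multiplies the last direction by
  \<open>\<rho>\<close>; so \<open>endo_det_scale_snd\<close> applies.\<close>

lemma endo_det_reparam:
  fixes N :: "('n::topological_space, 'e::euclidean_space) atlas" and B :: "('b::topological_space, real) atlas"
    and M :: "('m::topological_space, 'e \<times> real) atlas"
  assumes N: "oriented_atlas N" and B: "oriented_atlas B" and J: "open J"
    and G: "C1_map (prod_atlas N (interval_atlas J)) M G"
    and b: "b \<in> B" "v \<in> fst b" and \<delta>: "\<delta> > 0" and r: "(r has_real_derivative \<rho>) (at (snd b v))" "r (snd b v) \<in> J"
    and C: "\<And>n v'. n \<in> carrier_of N \<Longrightarrow> v' \<in> fst b \<Longrightarrow> \<bar>snd b v' - snd b v\<bar> < \<delta> \<Longrightarrow> C (n, v') = G (n, r (snd b v'))"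
    and a: "a \<in> N" "n \<in> fst a" and d: "d \<in> M" "C (n, v) \<in> fst d"
  shows "endo_det (chart_deriv (pair_chart a b) d C (n, v)) =
    \<rho> * endo_det (chart_deriv (pair_chart a (unit_chart J)) d G (n, r (snd b v)))"
proof -
  let ?s = "snd b v" and ?g = "chart_rep (pair_chart a (unit_chart J)) d G"
  let ?R = "\<lambda>q :: 'e \<times> real. (fst q, r (snd q))"
  note ach = oriented_atlasD[OF N a(1)] and bch = oriented_atlasD[OF B b(1)]
  have nN: "n \<in> carrier_of N" using a(2) ach(5) by blast
  have Cn: "C (n, v) = G (n, r ?s)" using C[OF nN b(2)] \<delta> by simp
  have "isCont r ?s" using r(1) by (rule DERIV_isCont)
  then obtain \<delta>' where \<delta>': "\<delta>' > 0" "\<And>s. \<bar>s - ?s\<bar> < \<delta>' \<Longrightarrow> r s \<in> J"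
    using J r(2) unfolding continuous_at_open
    by (metis (no_types, opaque_lifting) open_real abs_minus_commute)
  define S where "S = snd a ` fst a \<times> (snd b ` fst b \<inter> ball ?s (min \<delta> \<delta>'))"
  have S: "open S" unfolding S_def by (intro open_Times open_Int open_ball ach(2) bch(2))
  have mem: "(snd a n, ?s) \<in> S" unfolding S_def using a b \<delta> \<delta>'(1) by simp
  have eq: "chart_rep (pair_chart a b) d C y = (?g \<circ> ?R) y" if y: "y \<in> S" for y
  proof -
    obtain u v' where uv: "u \<in> fst a" "v' \<in> fst b" "y = (snd a u, snd b v')" "\<bar>snd b v' - ?s\<bar> < min \<delta> \<delta>'"
      using y unfolding S_def by (auto simp: dist_real_def abs_minus_commute)
    have "r (snd b v') \<in> J" using \<delta>'(2) uv(4) by simp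
    moreover have "C (u, v') = G (u, r (snd b v'))"
      using C[of u v'] uv ach(5) by auto
    ultimately show ?thesis
      using chart_rep_pair_chart[OF ach(4) bch(4) uv(1,2), of d C]
        chart_rep_pair_chart[of a "unit_chart J" u "r (snd b v')" d G] ach(4) uv by simp
  qed
  have "?g differentiable (at (snd (pair_chart a (unit_chart J)) (n, r ?s)))"
    by (rule C1_map_differentiable[OF G pair_unit_chart_in[OF a(1)] d(1)]) (use a(2) r(2) d(2) Cn in auto)
  then have dg: "?g differentiable (at (snd a n, r ?s))" by simp
  have "((\<lambda>q. r (snd q)) has_derivative (\<lambda>h. \<rho> * snd h)) (at (snd a n, ?s))"
  proof -
    have "(r has_derivative (*) \<rho>) (at (snd (snd a n, ?s)))"
      using r(1) by (simp add: has_field_derivative_def)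
    from diff_chain_at[OF bounded_linear_imp_has_derivative[OF bounded_linear_snd] this]
    show ?thesis by (simp add: o_def)
  qed
  from has_derivative_Pair[OF bounded_linear_imp_has_derivative[OF bounded_linear_fst] this]
  have dR: "(?R has_derivative (\<lambda>(y, s). (y, \<rho> * s))) (at (snd a n, ?s))" by (simp add: case_prod_beta')
  have "frechet_derivative (chart_rep (pair_chart a b) d C) (at (snd a n, ?s)) = frechet_derivative (?g \<circ> ?R) (at (snd a n, ?s))"
    by (rule frechet_derivative_cong_open[OF S mem eq])
  also have "\<dots> = frechet_derivative ?g (at (snd a n, r ?s)) \<circ> (\<lambda>(y, s). (y, \<rho> * s))"
    by (rule frechet_derivative_eq, rule diff_chain_at[OF dR]) (use has_derivative_frechet[OF dg] in simp)
  finally have fd: "frechet_derivative (chart_rep (pair_chart a b) d C) (at (snd a n, ?s)) = \<dots>" .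
  have op: "open (snd (pair_chart a b) ` fst (pair_chart a b))"
    "open (snd (pair_chart a (unit_chart J)) ` fst (pair_chart a (unit_chart J)))"
    using open_Times[OF ach(2) bch(2)] open_Times[OF ach(2) J] by (simp_all add: image_pair_chart)
  have "chart_deriv (pair_chart a b) d C (n, v) = frechet_derivative ?g (at (snd a n, r ?s)) \<circ> (\<lambda>(y, s). (y, \<rho> * s))"
    using chart_deriv_open[OF op(1), of "(n, v)" d C] a b fd by simp
  moreover have "chart_deriv (pair_chart a (unit_chart J)) d G (n, r ?s) = frechet_derivative ?g (at (snd a n, r ?s))"
    using chart_deriv_open[OF op(2), of "(n, r ?s)" d G] a r(2) by simp
  ultimately show ?thesis
    using endo_det_scale_snd[OF linear_frechet_derivative[OF dg], of \<rho>] by simp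
qed

text \<open>\<open>e\<close> is the sign of the derivative of the change of time: a decreasing one
  reverses the product orientation and with it every sign. The sum runs over a part \<open>V\<close>
  of the parameters so that the halves of a concatenation and the circle without a point can be
  treated.\<close>

theorem signed_sum_reparam:
  fixes N :: "('n::topological_space, 'e::euclidean_space) atlas" and B :: "('b::topological_space, real) atlas"
    and M :: "('m::topological_space, 'e \<times> real) atlas"
  assumes N: "oriented_atlas N" and B: "oriented_atlas B" and M: "oriented_atlas M" and J: "open J"
    and G: "C1_map (prod_atlas N (interval_atlas J)) M G"
    and reg: "regular_value (prod_atlas N (interval_atlas J)) M G p"
    and C: "C1_map (prod_atlas N B) M C"
    and V: "V \<subseteq> carrier_of B" "bij_betw \<tau> V J" and e: "e = 1 \<or> e = (-1 :: int)"
    and loc: "\<And>v. v \<in> V \<Longrightarrow> \<exists>b\<in>B. v \<in> fst b \<and> (\<exists>\<delta>>0. \<exists>r \<rho>. (r has_real_derivative \<rho>) (at (snd b v)) \<and>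
       \<rho> * of_int e > 0 \<and> r (snd b v) = \<tau> v \<and>
       (\<forall>v'\<in>fst b. \<bar>snd b v' - snd b v\<bar> < \<delta> \<longrightarrow> (\<forall>n\<in>carrier_of N. C (n, v') = G (n, r (snd b v')))))"
  shows "(\<Sum>x | x \<in> carrier_of N \<times> V \<and> C x = p. local_sign (prod_atlas N B) M C x) =
      e * signed_count (prod_atlas N (interval_atlas J)) M G p" (is ?sum)
    and "\<And>n v. n \<in> carrier_of N \<Longrightarrow> v \<in> V \<Longrightarrow> C (n, v) = p \<Longrightarrow>
      \<exists>c\<in>prod_atlas N B. \<exists>d\<in>M. (n, v) \<in> fst c \<and> p \<in> fst d \<and> surj (chart_deriv c d C (n, v))"
proof -
  let ?A = "prod_atlas N (interval_atlas J)" and ?B = "prod_atlas N B"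
  have A: "oriented_atlas ?A" and B': "oriented_atlas ?B"
    by (intro oriented_atlas_prod oriented_atlas_interval N B J)+
  have \<tau>J: "\<tau> v \<in> J" if "v \<in> V" for v using V(2) that by (auto simp: bij_betw_def)
  have pt: "C (n, v) = G (n, \<tau> v)" if "n \<in> carrier_of N" "v \<in> V" for n v
    using loc[OF that(2)] that(1) by fastforce
  have main: "\<exists>c\<in>?B. \<exists>d\<in>M. (n, v) \<in> fst c \<and> p \<in> fst d \<and> surj (chart_deriv c d C (n, v))"
    "local_sign ?B M C (n, v) = e * local_sign ?A M G (n, \<tau> v)"
    if nv: "n \<in> carrier_of N" "v \<in> V" and Cp: "C (n, v) = p" for n v
  proof -
    obtain b \<delta> r \<rho> where b: "b \<in> B" "v \<in> fst b" and \<delta>: "\<delta> > 0" and r: "(r has_real_derivative \<rho>) (at (snd b v))"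
      "\<rho> * of_int e > 0" "r (snd b v) = \<tau> v"
      "\<And>n v'. n \<in> carrier_of N \<Longrightarrow> v' \<in> fst b \<Longrightarrow> \<bar>snd b v' - snd b v\<bar> < \<delta> \<Longrightarrow> C (n, v') = G (n, r (snd b v'))"
      using loc[OF nv(2)] by blast
    obtain a where a: "a \<in> N" "n \<in> fst a" using carrier_of_cover[OF nv(1)] by blast
    have "p \<in> carrier_of M" using C nv V(1) Cp unfolding C1_map_def by auto
    then obtain d where d: "d \<in> M" "p \<in> fst d" using carrier_of_cover by metis
    let ?c = "pair_chart a b" and ?c' = "pair_chart a (unit_chart J)"
    have c: "?c \<in> ?B" "(n, v) \<in> fst ?c" using pair_chart_in_prod_atlas[OF a(1) b(1)] a b by auto
    have c': "?c' \<in> ?A" "(n, \<tau> v) \<in> fst ?c'" using pair_unit_chart_in[OF a(1)] a \<tau>J[OF nv(2)] by auto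
    have Gp: "G (n, \<tau> v) = p" using pt[OF nv] Cp by simp
    have rJ: "r (snd b v) \<in> J" using \<tau>J[OF nv(2)] r(3) by simp
    have Cd: "C (n, v) \<in> fst d" "G (n, \<tau> v) \<in> fst d" using Cp Gp d by simp_all
    have det: "endo_det (chart_deriv ?c d C (n, v)) = \<rho> * endo_det (chart_deriv ?c' d G (n, \<tau> v))"
      using endo_det_reparam[OF N B J G b \<delta> r(1) rJ r(4) a d(1) Cd(1)] r(3) by simp
    have nz: "endo_det (chart_deriv ?c' d G (n, \<tau> v)) \<noteq> 0"
      using reg c' d Gp unfolding regular_value_iff[OF A M G] by blast
    have \<rho>: "\<rho> \<noteq> 0" using r(2) by auto
    have "surj (chart_deriv ?c d C (n, v))"
      using endo_det_nonzero_iff_surj[OF linear_chart_deriv[OF B' C c d(1) Cd(1)]] det nz \<rho> by simp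
    then show "\<exists>c\<in>?B. \<exists>d\<in>M. (n, v) \<in> fst c \<and> p \<in> fst d \<and> surj (chart_deriv c d C (n, v))"
      using c d by blast
    have "orientation_preserving_at ?B M C (n, v) \<longleftrightarrow> \<rho> * endo_det (chart_deriv ?c' d G (n, \<tau> v)) > 0"
      using orientation_preserving_at_iff[OF B' M C c d(1) Cd(1)] det by simp
    moreover have "orientation_preserving_at ?A M G (n, \<tau> v) \<longleftrightarrow> endo_det (chart_deriv ?c' d G (n, \<tau> v)) > 0"
      by (rule orientation_preserving_at_iff[OF A M G c' d(1) Cd(2)])
    ultimately show "local_sign ?B M C (n, v) = e * local_sign ?A M G (n, \<tau> v)"
      using e r(2) nz by (auto simp: local_sign_def zero_less_mult_iff)
  qed
  show "\<exists>c\<in>?B. \<exists>d\<in>M. (n, v) \<in> fst c \<and> p \<in> fst d \<and> surj (chart_deriv c d C (n, v))"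
    if "n \<in> carrier_of N" "v \<in> V" "C (n, v) = p" for n v
    by (rule main(1)[OF that])
  let ?h = "\<lambda>x. (fst x, \<tau> (snd x))"
  let ?S = "{x. x \<in> carrier_of N \<times> V \<and> C x = p}" and ?T = "{x. x \<in> carrier_of N \<times> J \<and> G x = p}"
  have bij: "bij_betw ?h ?S ?T"
  proof (rule bij_betw_imageI)
    show "inj_on ?h ?S"
      using V(2) by (auto simp: inj_on_def bij_betw_def)
    show "?h ` ?S = ?T"
    proof (intro equalityI subsetI)
      fix y assume "y \<in> ?h ` ?S"
      then show "y \<in> ?T" using pt \<tau>J by auto
    next
      fix y assume y: "y \<in> ?T"
      obtain n t where nt: "y = (n, t)" "n \<in> carrier_of N" "t \<in> J" using y by auto
      obtain v where "v \<in> V" "t = \<tau> v" using V(2) nt(3) by (auto simp: bij_betw_def)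
      then show "y \<in> ?h ` ?S" using y nt pt[of n v] by (intro image_eqI[of _ _ "(n, v)"]) auto
    qed
  qed
  have "(\<Sum>x\<in>?S. local_sign ?B M C x) = (\<Sum>x\<in>?S. e * local_sign ?A M G (?h x))"
    by (rule sum.cong[OF refl]) (use main(2) in auto)
  also have "\<dots> = e * (\<Sum>x\<in>?T. local_sign ?A M G x)"
    by (simp only: sum_distrib_left[symmetric] sum.reindex_bij_betw[OF bij, of "local_sign ?A M G"])
  finally show ?sum
    by (simp add: signed_count_eq_sum)
qed

section \<open>Good homotopies\<close>

text \<open>The fibre condition confines all points over \<open>p\<close> to the open set
  \<open>J'\<close> of times, where both cylinders give the same derivative.\<close>

lemma regular_value_interval_superset:
  assumes N: "oriented_atlas N" and J: "open J'" "J' \<subseteq> J"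
    and fib: "\<And>n t. n \<in> carrier_of N \<Longrightarrow> t \<in> J \<Longrightarrow> F (n, t) = p \<Longrightarrow> t \<in> J'"
    and r: "regular_value (prod_atlas N (interval_atlas J')) M F p"
  shows "regular_value (prod_atlas N (interval_atlas J)) M F p"
  unfolding regular_value_def
proof (intro ballI impI)
  fix x assume x: "x \<in> carrier_of (prod_atlas N (interval_atlas J))" "F x = p"
  then obtain n t where nt: "x = (n, t)" "n \<in> carrier_of N" "t \<in> J" by auto
  then have t: "t \<in> J'" using fib x(2) by blast
  then have "x \<in> carrier_of (prod_atlas N (interval_atlas J'))" using nt by auto
  then obtain c d where c: "c \<in> prod_atlas N (interval_atlas J')" "d \<in> M" "x \<in> fst c" "p \<in> fst d" "surj (chart_deriv c d F x)"
    using r x(2) unfolding regular_value_def by blast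
  obtain a where a: "a \<in> N" "c = pair_chart a (unit_chart J')" using c(1) by (rule prod_interval_atlasE)
  have na: "n \<in> fst a" using c(3) a(2) nt(1) by simp
  have "chart_deriv (pair_chart a (unit_chart J)) d F x = chart_deriv c d F x"
    unfolding a(2) nt(1)
    by (rule chart_deriv_interval_subset[OF oriented_atlasD(4)[OF N a(1)] oriented_atlasD(2)[OF N a(1)] J na t])
  then show "\<exists>c\<in>prod_atlas N (interval_atlas J). \<exists>d\<in>M. x \<in> fst c \<and> p \<in> fst d \<and> surj (chart_deriv c d F x)"
    using c(2,4,5) na nt pair_unit_chart_in[OF a(1), of J] by (intro bexI[of _ "pair_chart a (unit_chart J)"] bexI[of _ d]) auto
qed

lemma signed_sum_interval_reparam:
  fixes N :: "('n::topological_space, 'e::euclidean_space) atlas"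
    and M :: "('m::topological_space, 'e \<times> real) atlas"
  assumes N: "oriented_atlas N" and M: "oriented_atlas M" and J: "open J" "open J'"
    and G: "C1_map (prod_atlas N (interval_atlas J)) M G"
    and reg: "regular_value (prod_atlas N (interval_atlas J)) M G p"
    and C: "C1_map (prod_atlas N (interval_atlas J')) M C"
    and V: "open V" "V \<subseteq> J'" "bij_betw \<tau> V J" and e: "e = 1 \<or> e = (-1 :: int)"
    and \<tau>: "\<And>v. v \<in> V \<Longrightarrow> (\<tau> has_real_derivative \<tau>' v) (at v)" "\<And>v. v \<in> V \<Longrightarrow> \<tau>' v * of_int e > 0"
    and eq: "\<And>n v. n \<in> carrier_of N \<Longrightarrow> v \<in> V \<Longrightarrow> C (n, v) = G (n, \<tau> v)"
  shows "(\<Sum>x | x \<in> carrier_of N \<times> V \<and> C x = p. local_sign (prod_atlas N (interval_atlas J')) M C x) =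
      e * signed_count (prod_atlas N (interval_atlas J)) M G p" (is ?sum)
    and "\<And>n v. n \<in> carrier_of N \<Longrightarrow> v \<in> V \<Longrightarrow> C (n, v) = p \<Longrightarrow>
      \<exists>c\<in>prod_atlas N (interval_atlas J'). \<exists>d\<in>M. (n, v) \<in> fst c \<and> p \<in> fst d \<and> surj (chart_deriv c d C (n, v))"
proof -
  have V': "V \<subseteq> carrier_of (interval_atlas J')" using V(2) by simp
  have loc: "\<exists>b\<in>interval_atlas J'. v \<in> fst b \<and> (\<exists>\<delta>>0. \<exists>r \<rho>. (r has_real_derivative \<rho>) (at (snd b v)) \<and>
       \<rho> * of_int e > 0 \<and> r (snd b v) = \<tau> v \<and>
       (\<forall>v'\<in>fst b. \<bar>snd b v' - snd b v\<bar> < \<delta> \<longrightarrow> (\<forall>n\<in>carrier_of N. C (n, v') = G (n, r (snd b v')))))"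
    if v: "v \<in> V" for v
  proof -
    obtain \<delta> where \<delta>: "\<delta> > 0" "\<And>v'. \<bar>v' - v\<bar> < \<delta> \<Longrightarrow> v' \<in> V"
      using V(1) v unfolding open_real by blast
    show ?thesis
    proof (intro bexI[of _ "unit_chart J'"] conjI exI)
      show "\<forall>v'\<in>fst (unit_chart J'). \<bar>snd (unit_chart J') v' - snd (unit_chart J') v\<bar> < \<delta> \<longrightarrow>
        (\<forall>n\<in>carrier_of N. C (n, v') = G (n, \<tau> (snd (unit_chart J') v')))"
        using \<delta>(2) eq by simp
    qed (use \<tau> v V(2) \<delta>(1) in \<open>auto simp: interval_atlas_eq\<close>)
  qed
  note * = signed_sum_reparam[OF N oriented_atlas_interval[OF J(2)] M J(1) G reg C V' V(3) e loc]
  show ?sum by (rule *(1))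
  show "\<exists>c\<in>prod_atlas N (interval_atlas J'). \<exists>d\<in>M. (n, v) \<in> fst c \<and> p \<in> fst d \<and> surj (chart_deriv c d C (n, v))"
    if "n \<in> carrier_of N" "v \<in> V" "C (n, v) = p" for n v
    by (rule *(2)[OF _ that])
qed

abbreviation open_cylinder :: "('n, 'e::euclidean_space) atlas \<Rightarrow> ('n \<times> real, 'e \<times> real) atlas" where
  "open_cylinder N \<equiv> prod_atlas N (interval_atlas {0<..<1})"

abbreviation closed_cylinder :: "('n, 'e::euclidean_space) atlas \<Rightarrow> ('n \<times> real, 'e \<times> real) atlas" where
  "closed_cylinder N \<equiv> prod_atlas N (interval_atlas {0..1})"

locale winding_setup =
  fixes N :: "('n::t2_space, 'e::euclidean_space) atlas" and M :: "('m::t2_space, 'e \<times> real) atlas" and p :: 'm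
  assumes N: "oriented_atlas N" and carrier_N [simp]: "carrier_of N = UNIV" and compact_N: "compact (UNIV :: 'n set)"
    and M: "oriented_atlas M" and carrier_M [simp]: "carrier_of M = UNIV" and connected_M: "connected (UNIV :: 'm set)"
begin

lemma oriented_atlas_cylinder: "open J \<Longrightarrow> oriented_atlas (prod_atlas N (interval_atlas J))"
  by (intro oriented_atlas_prod oriented_atlas_interval N)

lemma C1_map_cylinder:
  assumes F: "smooth_map (prod_atlas N (interval_atlas J)) M F" and J: "open J'" "J' \<subseteq> J"
  shows "C1_map (prod_atlas N (interval_atlas J')) M F"
  by (rule smooth_map_C1_map[OF oriented_atlas_cylinder[OF J(1)] M smooth_map_interval_subset[OF N F J(2)]])

lemma good_homotopyI:
  assumes "smooth_map (closed_cylinder N) M F" "regular_value (open_cylinder N) M F p"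
    and "\<And>n. F (n, 0) = f n" "\<And>n. F (n, 1) = g n" "p \<notin> range f" "p \<notin> range g"
  shows "good_homotopy N M p f g F"
proof -
  have ends: "F (n, 0) \<noteq> p" "F (n, 1) \<noteq> p" for n using assms(3-6) by auto
  have "regular_value (closed_cylinder N) M F p"
  proof (rule regular_value_interval_superset[OF N _ _ _ assms(2)])
    fix n t assume "t \<in> {0..1}" "F (n, t) = p"
    then show "t \<in> {0<..<1::real}" using ends[of n] by (cases "t = 0 \<or> t = 1") auto
  qed auto
  then show ?thesis
    unfolding good_homotopy_def using assms ends by auto
qed

text \<open>Since \<open>p\<close> is missed at the times \<open>0\<close> and \<open>1\<close>, the
  whole fibre lies in the open cylinder and can be counted there. Finiteness still has to come from
  the closed cylinder, which is compact.\<close>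

lemma good_homotopyD:
  assumes "good_homotopy N M p f g F"
  shows "smooth_map (closed_cylinder N) M F" "C1_map (open_cylinder N) M F" "regular_value (open_cylinder N) M F p"
    "F (n, 0) = f n" "F (n, 1) = g n" "p \<notin> range f" "p \<notin> range g"
    "Delta N M p F = signed_count (open_cylinder N) M F p"
    "finite {x \<in> UNIV \<times> {0<..<1}. F x = p}"
proof -
  have good: "p \<notin> F ` (UNIV \<times> {0, 1})" "regular_value (closed_cylinder N) M F p"
    "\<And>n. F (n, 0) = f n" "\<And>n. F (n, 1) = g n"
    using assms by (auto simp: good_homotopy_def)
  show F: "smooth_map (closed_cylinder N) M F" using assms by (simp add: good_homotopy_def)
  show "F (n, 0) = f n" "F (n, 1) = g n" by (rule good)+
  have ends: "F (n, 0) \<noteq> p" "F (n, 1) \<noteq> p" for n using good(1) by auto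
  then show "p \<notin> range f" "p \<notin> range g" using good(3,4) by auto
  have sub: "open {0<..<1::real}" "{0<..<1} \<subseteq> {0..1::real}" by auto
  show C1: "C1_map (open_cylinder N) M F" by (rule C1_map_cylinder[OF F sub])
  show reg: "regular_value (open_cylinder N) M F p"
    by (rule regular_value_interval_subset[OF N sub good(2)])
  have fib: "t \<in> {0<..<1}" if "t \<in> {0..1}" "F (n, t) = p" for n t
    using that ends[of n] by (cases "t = 0 \<or> t = 1") auto
  show "Delta N M p F = signed_count (open_cylinder N) M F p"
    unfolding Delta_def by (rule signed_count_interval_subset[OF N sub fib])
  have "finite {x \<in> UNIV \<times> {0..1}. F x = p}"
  proof (rule finite_isolated_fibre)
    show "compact (UNIV \<times> {0..1} :: ('n \<times> real) set)" by (intro compact_Times compact_N compact_Icc)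
    show "continuous_on (UNIV \<times> {0..1}) F" using F by (simp add: smooth_map_def)
    fix x :: "'n \<times> real" assume x: "x \<in> UNIV \<times> {0..1}" "F x = p"
    then have "x \<in> UNIV \<times> {0<..<1}" using fib[of "snd x" "fst x"] by (cases x) auto
    then have xc: "x \<in> carrier_of (open_cylinder N)" by simp
    obtain T where T: "openin (top_of_set (carrier_of (open_cylinder N))) T" "x \<in> T"
      "\<forall>x'. x' \<in> T \<longrightarrow> F x' = p \<longrightarrow> x' = x"
      using regular_fibre_isolated[OF oriented_atlas_cylinder[OF sub(1)] M C1 reg xc x(2)] by metis
    have "open (carrier_of (open_cylinder N))" by (simp add: open_Times)
    then have "open T" using T(1) openin_open_eq by blast
    then show "\<exists>T. open T \<and> x \<in> T \<and> (\<forall>x'\<in>T \<inter> UNIV \<times> {0..1}. F x' = p \<longrightarrow> x' = x)"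
      using T(2,3) by blast
  qed
  then show "finite {x \<in> UNIV \<times> {0<..<1}. F x = p}"
    by (rule rev_finite_subset) auto
qed

text \<open>Affine changes of time serve two purposes: with \<open>b > 0\<close> a piece of a front
  becomes a homotopy over the unit interval, with \<open>b = -1\<close> a homotopy is reversed.
  \<open>G\<close> is smooth over \<open>J'\<close>, and the count refers to the open interval
  \<open>J\<close>.\<close>

lemma good_homotopy_reparam:
  assumes G: "smooth_map (prod_atlas N (interval_atlas J')) M G" and J: "open J" "J \<subseteq> J'"
    and reg: "regular_value (prod_atlas N (interval_atlas J)) M G p"
    and bij: "bij_betw (\<lambda>s. a + b * s) {0<..<1} J" and img: "\<And>s. s \<in> {0..1} \<Longrightarrow> a + b * s \<in> J'"
    and e: "e = 1 \<or> e = (-1 :: int)" "b * of_int e > 0"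
    and ends: "p \<notin> range (\<lambda>n. G (n, a))" "p \<notin> range (\<lambda>n. G (n, a + b))"
  defines "C \<equiv> \<lambda>(n, s). G (n, a + b * s)"
  shows "good_homotopy N M p (\<lambda>n. G (n, a)) (\<lambda>n. G (n, a + b)) C"
    and "Delta N M p C = e * signed_count (prod_atlas N (interval_atlas J)) M G p"
proof -
  have C: "smooth_map (closed_cylinder N) M C"
    by (rule smooth_map_interval_reparam[OF N G Ck_affine_real[of _ a b]]) (use img in \<open>auto simp: C_def\<close>)
  have sub: "open {0<..<1::real}" "{0<..<1} \<subseteq> {0..1::real}" by auto
  have C1: "C1_map (open_cylinder N) M C" by (rule C1_map_cylinder[OF C sub])
  have G1: "C1_map (prod_atlas N (interval_atlas J)) M G" by (rule C1_map_cylinder[OF G J])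
  have der: "((\<lambda>s. a + b * s) has_real_derivative b) (at v)" for v
    by (auto intro!: derivative_eq_intros)
  have eq: "C (n, v) = G (n, a + b * v)" for n v by (simp add: C_def)
  note * = signed_sum_interval_reparam[OF N M J(1) sub(1) G1 reg C1 sub(1) order_refl bij e(1) der e(2) eq]
  have "regular_value (open_cylinder N) M C p"
    unfolding regular_value_def using *(2) by auto
  then show good: "good_homotopy N M p (\<lambda>n. G (n, a)) (\<lambda>n. G (n, a + b)) C"
    by (intro good_homotopyI C ends) (simp_all add: C_def)
  show "Delta N M p C = e * signed_count (prod_atlas N (interval_atlas J)) M G p"
    unfolding good_homotopyD(8)[OF good] signed_count_eq_sum[of "open_cylinder N"] using *(1) by simp
qed

lemma good_homotopy_reverse:
  assumes F: "good_homotopy N M p f g F"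
  obtains C where "good_homotopy N M p g f C" "Delta N M p C = - Delta N M p F"
proof -
  have bij: "bij_betw (\<lambda>s. 1 + (-1) * s) {0<..<1} {0<..<1::real}"
    by (rule bij_betw_byWitness[where f' = "\<lambda>s. 1 - s"]) auto
  let ?C = "\<lambda>(n, s). F (n, 1 + (-1) * s)"
  note FD = good_homotopyD[OF F]
  have eqs: "(\<lambda>n. F (n, 1)) = g" "(\<lambda>n. F (n, 1 + (-1))) = f" using FD(4,5) by auto
  have e: "-1 = (1::int) \<or> -1 = (-1::int)" "(-1) * of_int (-1) > (0::real)" by auto
  have sub: "open {0<..<1::real}" "{0<..<1} \<subseteq> {0..1::real}" by auto
  have img: "1 + (-1) * s \<in> {0..1}" if "s \<in> {0..1}" for s :: real using that by auto
  note * = good_homotopy_reparam[OF FD(1) sub FD(3) bij img e, unfolded eqs, OF _ FD(7,6)]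
  show ?thesis
  proof (rule that)
    show "good_homotopy N M p g f ?C" by (rule *(1))
    show "Delta N M p ?C = - Delta N M p F" using *(2) FD(8) by simp
  qed
qed

end

section \<open>Concatenation, loops and uniqueness\<close>

lemma Ck_smooth_step_affine: "Ck k UNIV (\<lambda>s. smooth_step (5 * s - c))"
proof (rule Ck_compose[OF open_UNIV _ Ck_smooth_step open_UNIV])
  show "Ck k UNIV (\<lambda>s. 5 * s - c)" using Ck_affine_real[of k "-c" 5] by simp
qed auto

lemma smooth_step_affine_bij: "bij_betw (\<lambda>s. smooth_step (5 * s - c)) {c / 5<..<(c + 1) / 5} {0<..<1}"
proof -
  have "bij_betw (\<lambda>s. 5 * s - c) {c / 5<..<(c + 1) / 5} {0<..<1}"
    by (rule bij_betw_byWitness[where f' = "\<lambda>s. (s + c) / 5"]) (auto simp: field_simps)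
  from bij_betw_trans[OF this smooth_step_bij] show ?thesis by (simp add: o_def)
qed

lemma smooth_step_affine_deriv:
  "((\<lambda>s. smooth_step (5 * s - c)) has_real_derivative deriv smooth_step (5 * v - c) * 5) (at v)"
  by (rule DERIV_chain2[OF smooth_step_deriv]) (auto intro!: derivative_eq_intros)

context winding_setup begin

text \<open>Running both halves through \<open>smooth_step\<close> makes the concatenation constant near the ends and
  near the middle, hence smooth; the collars at the ends are what lets a loop close up smoothly.\<close>

lemma good_homotopy_concat:
  assumes F: "good_homotopy N M p f g F" and H: "good_homotopy N M p g h H"
  obtains C where "good_homotopy N M p f h C" "Delta N M p C = Delta N M p F + Delta N M p H"
    "\<And>n s. s \<le> 1/5 \<Longrightarrow> C (n, s) = f n" "\<And>n s. s \<ge> 4/5 \<Longrightarrow> C (n, s) = h n"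
proof -
  note FD = good_homotopyD[OF F] and HD = good_homotopyD[OF H]
  \<comment> \<open>\<open>F\<close> is run through on [1/5, 2/5] and \<open>H\<close> on
    [3/5, 4/5]; on the other three fifths \<open>C\<close> rests at \<open>f\<close>,
    \<open>g\<close> and \<open>h\<close>.\<close>
  define C where "C = (\<lambda>(n, s). if s \<le> 1/2 then F (n, smooth_step (5 * s - 1)) else H (n, smooth_step (5 * s - 3)))"
  have C1: "C (n, s) = F (n, smooth_step (5 * s - 1))" if "s \<le> 3/5" for n s
    using that FD(5) HD(4) by (cases "s \<le> 1/2") (simp_all add: C_def)
  have C2: "C (n, s) = H (n, smooth_step (5 * s - 3))" if "s \<ge> 2/5" for n s
    using that FD(5) HD(4) by (cases "s \<le> 1/2") (simp_all add: C_def)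
  have Cf: "C (n, s) = f n" if "s \<le> 1/5" for n s
    using that C1[of s n] FD(4) by simp
  have Cg: "C (n, s) = g n" if "2/5 \<le> s" "s \<le> 3/5" for n s
    using that C1[of s n] FD(5) by simp
  have Ch: "C (n, s) = h n" if "s \<ge> 4/5" for n s
    using that C2[of s n] HD(5) by simp
  let ?I = "{0<..<1::real}" and ?V1 = "{1/5<..<(1 + 1)/5::real}" and ?V2 = "{3/5<..<(3 + 1)/5::real}"
  have smooth: "smooth_map (closed_cylinder N) M C"
  proof (rule smooth_map_reparam[OF N interval_atlas_chart_props])
    fix b v assume "b \<in> interval_atlas {0..1::real}" "v \<in> fst b"
    then have b: "b = unit_chart {0..1}" by (simp add: interval_atlas_eq)
    \<comment> \<open>Both formulas are valid between 2/5 and 3/5, so a radius of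
      \<open>1/10\<close> keeps each side of \<open>1/2\<close> in the domain of its own
      formula.\<close>
    have near: "v' \<le> 1/2 + 1/10" if "v \<le> 1/2" "\<bar>v' - v\<bar> < 1/10" for v' using that by linarith
    have near': "v' \<ge> 1/2 - 1/10" if "\<not> v \<le> 1/2" "\<bar>v' - v\<bar> < 1/10" for v' using that by linarith
    show "\<exists>G J \<delta> r. smooth_map (prod_atlas N (interval_atlas J)) M G \<and> \<delta> > 0 \<and>
       (\<forall>k. Ck k UNIV r) \<and> (\<forall>v'\<in>fst b. \<bar>snd b v' - snd b v\<bar> < \<delta> \<longrightarrow> r (snd b v') \<in> J \<and>
         (\<forall>n\<in>carrier_of N. C (n, v') = G (n, r (snd b v'))))"
    proof (cases "v \<le> 1/2")
      case True
      then show ?thesis unfolding b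
        by (intro exI[of _ F] exI[of _ "{0..1}"] exI[of _ "1/10"] exI[of _ "\<lambda>s. smooth_step (5 * s - 1)"]
            conjI allI ballI impI Ck_smooth_step_affine FD(1)) (use near in \<open>auto simp: smooth_step_bounds intro!: C1\<close>)
    next
      case False
      then show ?thesis unfolding b
        by (intro exI[of _ H] exI[of _ "{0..1}"] exI[of _ "1/10"] exI[of _ "\<lambda>s. smooth_step (5 * s - 3)"]
            conjI allI ballI impI Ck_smooth_step_affine HD(1)) (use near' in \<open>auto simp: smooth_step_bounds intro!: C2\<close>)
    qed
  qed
  have sub: "open ?I" "?I \<subseteq> {0..1}" by auto
  have CC: "C1_map (open_cylinder N) M C" by (rule C1_map_cylinder[OF smooth sub])
  have p1: "deriv smooth_step (5 * v - 1) * 5 * of_int 1 > 0" if "v \<in> ?V1" for v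
    using deriv_smooth_step_pos[of "5 * v - 1"] that by simp
  have p2: "deriv smooth_step (5 * v - 3) * 5 * of_int 1 > 0" if "v \<in> ?V2" for v
    using deriv_smooth_step_pos[of "5 * v - 3"] that by simp
  have V: "open ?V1" "?V1 \<subseteq> ?I" "open ?V2" "?V2 \<subseteq> ?I" by auto
  have e: "1 = (1::int) \<or> 1 = (-1 :: int)" by simp
  have eq1: "C (n, v) = F (n, smooth_step (5 * v - 1))" if "v \<in> ?V1" for n v using C1 that by simp
  have eq2: "C (n, v) = H (n, smooth_step (5 * v - 3))" if "v \<in> ?V2" for n v using C2 that by simp
  note s1 = signed_sum_interval_reparam[OF N M sub(1) sub(1) FD(2,3) CC V(1,2) smooth_step_affine_bij e
      smooth_step_affine_deriv p1 eq1]
  note s2 = signed_sum_interval_reparam[OF N M sub(1) sub(1) HD(2,3) CC V(3,4) smooth_step_affine_bij e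
      smooth_step_affine_deriv p2 eq2]
  \<comment> \<open>On the resting fifths the values are those of \<open>f\<close>, \<open>g\<close>
    or \<open>h\<close>, all of which miss \<open>p\<close>.\<close>
  have fib: "s \<in> ?V1 \<or> s \<in> ?V2" if "C (n, s) = p" for n s
  proof -
    have "\<not> s \<le> 1/5" using Cf[of s n] that FD(6) by auto
    moreover have "\<not> (2/5 \<le> s \<and> s \<le> 3/5)" using Cg[of s n] that FD(7) by auto
    moreover have "\<not> s \<ge> 4/5" using Ch[of s n] that HD(7) by auto
    ultimately show ?thesis by auto
  qed
  have "regular_value (open_cylinder N) M C p"
    unfolding regular_value_def using s1(2) s2(2) fib by auto metis+
  then have good: "good_homotopy N M p f h C"
    by (intro good_homotopyI smooth) (use Cf Ch FD(6) HD(7) in auto)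
  note CD = good_homotopyD[OF good]
  let ?S = "\<lambda>V. {x. x \<in> UNIV \<times> V \<and> C x = p}"
  have S: "?S ?I = ?S ?V1 \<union> ?S ?V2" using fib by fastforce
  have fin: "finite (?S ?V1)" "finite (?S ?V2)"
    using CD(9) S by (metis (no_types, lifting) finite_Un)+
  have "Delta N M p C = (\<Sum>x\<in>?S ?V1. local_sign (open_cylinder N) M C x) + (\<Sum>x\<in>?S ?V2. local_sign (open_cylinder N) M C x)"
    unfolding CD(8) signed_count_eq_sum carrier_of_prod_atlas carrier_N carrier_of_interval_atlas S
    by (rule sum.union_disjoint[OF fin]) auto
  then have "Delta N M p C = Delta N M p F + Delta N M p H"
    using s1(1) s2(1) FD(8) HD(8) by simp
  with good show ?thesis using Cf Ch by (rule that)
qed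

end

text \<open>The angle as a fraction of a full turn. It jumps at the point \<open>1\<close>; a
  homotopy that rests at the same map near both ends does not notice the jump.\<close>

definition turn :: "complex \<Rightarrow> real" where
  "turn z = (if z = 1 then 0 else inv_into {0<..<0 + 2 * pi} cis z / (2 * pi))"

lemma turn_cis: "0 \<le> t \<Longrightarrow> t < 2 * pi \<Longrightarrow> turn (cis t) = t / (2 * pi)"
proof (cases "t = 0")
  case False
  assume t: "0 \<le> t" "t < 2 * pi"
  then have "cis t \<in> sphere 0 1 - {cis 0}" using False unfolding cis_image_arc[symmetric] by auto
  then have "cis t \<noteq> 1" by simp
  then show ?thesis using inv_into_cis[of 0 t] t False by (simp add: turn_def)
qed (simp add: turn_def)

lemma turn_bij: "bij_betw turn (sphere 0 1 - {1}) {0<..<1}"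
proof -
  have "bij_betw cis {0<..<0 + 2 * pi} (sphere 0 1 - {1})"
    using inj_on_cis_arc[of 0] cis_image_arc[of 0] by (simp add: bij_betw_def)
  moreover have "bij_betw (turn \<circ> cis) {0<..<0 + 2 * pi} {0<..<1}"
  proof (rule bij_betw_byWitness[where f' = "\<lambda>s. 2 * pi * s"])
    show "\<forall>t\<in>{0<..<0 + 2 * pi}. 2 * pi * (turn \<circ> cis) t = t" by (auto simp: turn_cis)
    show "(turn \<circ> cis) ` {0<..<0 + 2 * pi} \<subseteq> {0<..<1}" by (auto simp: turn_cis field_simps)
  qed (auto simp: turn_cis)
  ultimately show ?thesis using bij_betw_comp_iff by blast
qed

lemma circle_chartE:
  assumes "b \<in> circle_atlas" "v \<in> fst b"
  obtains "v = cis (snd b v)"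
proof -
  obtain a where "b = (cis ` {a<..<a + 2 * pi}, inv_into {a<..<a + 2 * pi} cis)"
    using assms(1) by (auto simp: circle_atlas_def)
  then have "cis (snd b v) = v" using f_inv_into_f[of v cis] assms(2) by simp
  then show ?thesis using that by simp
qed

lemma turn_in_chart:
  assumes b: "b \<in> circle_atlas" "v \<in> fst b" and v: "v \<noteq> 1"
  shows "\<exists>\<delta>>0. \<exists>c. \<forall>v'\<in>fst b. \<bar>snd b v' - snd b v\<bar> < \<delta> \<longrightarrow>
    turn v' = c + 1 / (2 * pi) * snd b v' \<and> turn v' \<in> {0<..<1}"
proof -
  have cv: "cis (snd b v) = v" using b circle_chartE by metis
  then have "v \<in> sphere 0 1 - {cis 0}" using v by (metis DiffI cis_zero mem_sphere_0 norm_cis singletonD)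
  then obtain t where t: "0 < t" "t < 2 * pi" "v = cis t" unfolding cis_image_arc[symmetric] by auto
  have one: "cis (t - snd b v) = 1" using cv t(3) by (metis cis_divide cis_neq_zero divide_self)
  show ?thesis
  \<comment> \<open>The distance of the angle \<open>t\<close> from both ends of the interval from
    \<open>0\<close> to \<open>2 * pi\<close>, so the shifted angle of a nearby point stays
    inside.\<close>
  proof (rule exI[of _ "min t (2 * pi - t)"], rule conjI)
    show "min t (2 * pi - t) > 0" using t by simp
    show "\<exists>c. \<forall>v'\<in>fst b. \<bar>snd b v' - snd b v\<bar> < min t (2 * pi - t) \<longrightarrow>
      turn v' = c + 1 / (2 * pi) * snd b v' \<and> turn v' \<in> {0<..<1}"
    proof (rule exI[of _ "(t - snd b v) / (2 * pi)"], intro ballI impI)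
    fix v' assume v': "v' \<in> fst b" "\<bar>snd b v' - snd b v\<bar> < min t (2 * pi - t)"
    let ?u = "snd b v' + (t - snd b v)"
    have "v' = cis ?u" using circle_chartE[OF b(1) v'(1)] one cis_mult by (metis mult.right_neutral)
    moreover have u: "0 < ?u" "?u < 2 * pi" using v'(2) by linarith+
    ultimately have "turn v' = ?u / (2 * pi)" using turn_cis[of ?u] by simp
    moreover have "?u / (2 * pi) \<in> {0<..<1}" using u by simp
    ultimately show "turn v' = (t - snd b v) / (2 * pi) + 1 / (2 * pi) * snd b v' \<and> turn v' \<in> {0<..<1}"
      by (simp add: add_divide_distrib)
    qed
  qed
qed

text \<open>An angle below \<open>2 * pi / 5\<close> is less than a fifth of a turn, which is the
  width of the collars left by \<open>good_homotopy_concat\<close>.\<close>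

lemma turn_near_one:
  assumes b: "b \<in> circle_atlas" "1 \<in> fst b" and v: "v' \<in> fst b" "\<bar>snd b v' - snd b 1\<bar> < 2 * pi / 5"
  shows "turn v' \<le> 1/5 \<or> turn v' \<ge> 4/5"
proof -
  have c1: "cis (snd b 1) = 1" using b circle_chartE by metis
  let ?u = "snd b v' - snd b 1"
  have v': "v' = cis ?u" using circle_chartE[OF b(1) v(1)] c1 by (metis cis_divide div_by_1)
  show ?thesis
  proof (cases "?u \<ge> 0")
    case True
    then have "turn v' = ?u / (2 * pi)" using v(2) v' turn_cis[of ?u] pi_gt_zero by simp
    moreover have "?u \<le> 1 / 5 * (2 * pi)" using v(2) by linarith
    ultimately show ?thesis by (simp add: pos_divide_le_eq)
  next
    case False
    have "v' = cis (?u + 2 * pi)" using v' cis_mult[of ?u "2 * pi"] by simp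
    moreover have "0 \<le> ?u + 2 * pi" "?u + 2 * pi < 2 * pi" using False v(2) pi_gt_zero by linarith+
    ultimately have "turn v' = (?u + 2 * pi) / (2 * pi)" using turn_cis by metis
    moreover have "?u + 2 * pi \<ge> 4 / 5 * (2 * pi)" using v(2) by linarith
    ultimately show ?thesis by (simp add: pos_le_divide_eq)
  qed
qed

section \<open>Loops, the indeterminacy subgroup and uniqueness\<close>

context winding_setup begin

text \<open>The loop is \<open>K\<close> run along \<open>turn\<close>. Over the point
  \<open>1\<close> it is \<open>\<epsilon>\<close>, which lies in \<open>\<N>\<close> and misses
  \<open>p\<close>; so the fibre lies over the rest of the circle, where \<open>turn\<close> is an
  increasing change of time. Hence the signed count of the loop is that of \<open>K\<close>, and it
  is the degree of the loop because \<open>p\<close> is a regular value.\<close>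

theorem Delta_loop_in_indeterminacy_subgroup:
  assumes K: "good_homotopy N M p \<epsilon> \<epsilon> K"
    and collar: "\<And>n s. s \<le> 1/5 \<Longrightarrow> K (n, s) = \<epsilon> n" "\<And>n s. s \<ge> 4/5 \<Longrightarrow> K (n, s) = \<epsilon> n"
    and \<epsilon>: "\<epsilon> \<in> \<N>"
  shows "Delta N M p K \<in> indeterminacy_subgroup N M \<N>"
proof -
  note KD = good_homotopyD[OF K]
  let ?A = "prod_atlas N circle_atlas" and ?V = "sphere 0 1 - {1 :: complex}"
  define \<mu> where "\<mu> = (\<lambda>(n, z). K (n, turn z))"
  have \<mu>1: "\<mu> (n, 1) = \<epsilon> n" for n using collar(1)[of 0] by (simp add: \<mu>_def turn_def)
  note B = oriented_atlasD[OF oriented_atlas_circle]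
  have A: "oriented_atlas ?A" by (intro oriented_atlas_prod N oriented_atlas_circle)
  have carrier: "carrier_of ?A = UNIV \<times> sphere 0 1" by (simp add: carrier_of_circle_atlas)
  have smooth: "smooth_map ?A M \<mu>"
  proof (rule smooth_map_reparam[OF N])
    fix b :: "(complex, real) chart" assume b: "b \<in> circle_atlas"
    show "inj_on (snd b) (fst b) \<and> continuous_on (fst b) (snd b) \<and> openin (top_of_set (carrier_of circle_atlas)) (fst b)"
      using B(1)[OF b] B(4)[OF b] homeomorphism_cont1[OF B(3)[OF b]] by blast
    fix v assume v: "v \<in> fst b"
    show "\<exists>G J \<delta> r. smooth_map (prod_atlas N (interval_atlas J)) M G \<and> \<delta> > 0 \<and>
       (\<forall>k. Ck k UNIV r) \<and> (\<forall>v'\<in>fst b. \<bar>snd b v' - snd b v\<bar> < \<delta> \<longrightarrow> r (snd b v') \<in> J \<and>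
         (\<forall>n\<in>carrier_of N. \<mu> (n, v') = G (n, r (snd b v'))))"
    proof (cases "v = 1")
      case True
      \<comment> \<open>Near the point \<open>1\<close> the loop is constant in the circle variable,
        so the constant change of time \<open>0\<close> describes it.\<close>
      have "\<mu> (n, v') = K (n, 0)" if "v' \<in> fst b" "\<bar>snd b v' - snd b v\<bar> < 2 * pi / 5" for n v'
        using turn_near_one[OF b _ that(1)] that(2) v True collar[of "turn v'" n] KD(4) by (auto simp: \<mu>_def)
      then show ?thesis
        using KD(1) by (intro exI[of _ K] exI[of _ "{0..1}"] exI[of _ "2 * pi / 5"] exI[of _ "\<lambda>_. 0"])
          (auto simp: Ck_const simp del: Ck.simps)
    next
      case False
      obtain \<delta> c where \<delta>: "\<delta> > 0" "\<And>v'. v' \<in> fst b \<Longrightarrow> \<bar>snd b v' - snd b v\<bar> < \<delta> \<Longrightarrow>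
          turn v' = c + 1 / (2 * pi) * snd b v' \<and> turn v' \<in> {0<..<1}"
        using turn_in_chart[OF b v False] by blast
      show ?thesis
      proof (intro exI conjI ballI impI allI)
        show "smooth_map (prod_atlas N (interval_atlas {0..1})) M K" by (rule KD(1))
        show "\<delta> > 0" by (rule \<delta>(1))
        show "Ck k UNIV (\<lambda>s. c + 1 / (2 * pi) * s)" for k by (rule Ck_affine_real)
        fix v' assume v': "v' \<in> fst b" "\<bar>snd b v' - snd b v\<bar> < \<delta>"
        then have eq: "c + 1 / (2 * pi) * snd b v' = turn v'" "turn v' \<in> {0<..<1}" using \<delta>(2) by metis+
        show "c + 1 / (2 * pi) * snd b v' \<in> {0..1}" unfolding eq(1) using eq(2) by simp
        show "\<mu> (n, v') = K (n, c + 1 / (2 * pi) * snd b v')" for n unfolding eq(1) by (simp add: \<mu>_def)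
      qed
    qed
  qed
  have C1: "C1_map ?A M \<mu>" by (rule smooth_map_C1_map[OF A M smooth])
  have loc: "\<exists>b\<in>circle_atlas. v \<in> fst b \<and> (\<exists>\<delta>>0. \<exists>r \<rho>. (r has_real_derivative \<rho>) (at (snd b v)) \<and>
       \<rho> * of_int 1 > 0 \<and> r (snd b v) = turn v \<and>
       (\<forall>v'\<in>fst b. \<bar>snd b v' - snd b v\<bar> < \<delta> \<longrightarrow> (\<forall>n\<in>carrier_of N. \<mu> (n, v') = K (n, r (snd b v')))))"
    if v: "v \<in> ?V" for v
  proof -
    have "v \<in> carrier_of circle_atlas" using v by (simp add: carrier_of_circle_atlas)
    then obtain b where b: "b \<in> circle_atlas" "v \<in> fst b" using carrier_of_cover by metis
    have v1: "v \<noteq> 1" using v by simp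
    obtain \<delta> c where \<delta>: "\<delta> > 0" "\<And>v'. v' \<in> fst b \<Longrightarrow> \<bar>snd b v' - snd b v\<bar> < \<delta> \<Longrightarrow>
        turn v' = c + 1 / (2 * pi) * snd b v' \<and> turn v' \<in> {0<..<1}"
      using turn_in_chart[OF b v1] by blast
    show ?thesis
    proof (intro bexI[OF _ b(1)] exI conjI ballI impI)
      show "v \<in> fst b" "\<delta> > 0" by (rule b \<delta>)+
      show "((\<lambda>s. c + 1 / (2 * pi) * s) has_real_derivative 1 / (2 * pi)) (at (snd b v))"
        by (auto intro!: derivative_eq_intros)
      show "c + 1 / (2 * pi) * snd b v = turn v" using \<delta>(2)[OF b(2)] \<delta>(1) by simp
      fix n v' assume "v' \<in> fst b" "\<bar>snd b v' - snd b v\<bar> < \<delta>"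
      then have "turn v' = c + 1 / (2 * pi) * snd b v'" using \<delta>(2) by blast
      then show "\<mu> (n, v') = K (n, c + 1 / (2 * pi) * snd b v')" by (simp add: \<mu>_def)
    qed simp
  qed
  have V: "?V \<subseteq> carrier_of circle_atlas" by (auto simp: carrier_of_circle_atlas)
  have e: "1 = (1::int) \<or> 1 = (-1 :: int)" by simp
  have J: "open {0<..<1::real}" by simp
  note s = signed_sum_reparam[OF N oriented_atlas_circle M J KD(2,3) C1 V turn_bij e loc]
  have fib: "z \<in> ?V" if "z \<in> sphere 0 1" "\<mu> (n, z) = p" for n z
    using that \<mu>1[of n] KD(6) by auto
  have reg: "regular_value ?A M \<mu> p"
    unfolding regular_value_def carrier using s(2) fib by fastforce
  have S: "{x. x \<in> UNIV \<times> sphere 0 1 \<and> \<mu> x = p} = {x. x \<in> UNIV \<times> ?V \<and> \<mu> x = p}"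
    using fib by fastforce
  have sc: "signed_count ?A M \<mu> p = Delta N M p K"
    using s(1) unfolding signed_count_eq_sum[of ?A] carrier S KD(8) by simp
  interpret degree_setup ?A M \<mu>
  proof
    show "compact (carrier_of ?A)" unfolding carrier by (intro compact_Times compact_N compact_sphere)
  qed (use A M C1 in simp_all)
  have "mapping_degree ?A M \<mu> = Delta N M p K"
    using mapping_degree_eq_signed_count[OF connected_M reg] sc by simp
  moreover have "\<exists>z\<in>sphere 0 1. (\<lambda>n. \<mu> (n, z)) \<in> \<N>"
    by (rule bexI[of _ 1]) (use \<mu>1 \<epsilon> in simp_all)
  ultimately show ?thesis
    unfolding indeterminacy_subgroup_def using smooth by (metis (mono_tags, lifting) mem_Collect_eq)
qed

lemma Delta_unique:
  assumes ind: "indeterminacy_subgroup N M \<N> = {0}" and \<epsilon>: "\<epsilon> \<in> \<N>"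
    and F: "good_homotopy N M p \<epsilon> f F" and G: "good_homotopy N M p \<epsilon> f G"
  shows "Delta N M p F = Delta N M p G"
proof -
  obtain G' where G': "good_homotopy N M p f \<epsilon> G'" "Delta N M p G' = - Delta N M p G"
    by (rule good_homotopy_reverse[OF G])
  obtain K where K: "good_homotopy N M p \<epsilon> \<epsilon> K" "Delta N M p K = Delta N M p F + Delta N M p G'"
    "\<And>n s. s \<le> 1/5 \<Longrightarrow> K (n, s) = \<epsilon> n" "\<And>n s. s \<ge> 4/5 \<Longrightarrow> K (n, s) = \<epsilon> n"
    by (rule good_homotopy_concat[OF F G'(1)]) blast
  from Delta_loop_in_indeterminacy_subgroup[OF K(1,3,4) \<epsilon>] show ?thesis using ind K(2) G'(2) by simp
qed

text \<open>Once a good homotopy exists, \<open>Delta_unique\<close> makes its count the only value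
  that fits the description in \<open>awin\<close>.\<close>

lemma awin_eq:
  assumes "indeterminacy_subgroup N M \<N> = {0}" "\<epsilon> \<in> \<N>" "good_homotopy N M p \<epsilon> f F"
  shows "awin N M p \<epsilon> f = Delta N M p F"
  unfolding awin_def using assms Delta_unique[OF assms(1,2)] by (intro the_equality) blast+

end

text \<open>Genericity makes the projection to time injective on the fibre. So \<open>pas\<close> is
  the number of points in the fibre, and each of them enters the signed count with absolute value
  \<open>1\<close>.\<close>

lemma signed_count_generic_le:
  assumes inj: "\<And>n n' t. t \<in> {t\<^sub>1<..<t\<^sub>2} \<Longrightarrow> W (n, t) = p \<Longrightarrow> W (n', t) = p \<Longrightarrow> n = n'"
    and N: "carrier_of N = UNIV"
  shows "\<bar>signed_count (prod_atlas N (interval_atlas {t\<^sub>1<..<t\<^sub>2})) M W p\<bar> \<le> int (pas p W t\<^sub>1 t\<^sub>2)"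
proof -
  let ?S = "{x. x \<in> carrier_of (prod_atlas N (interval_atlas {t\<^sub>1<..<t\<^sub>2})) \<and> W x = p}"
  have "inj_on snd ?S" using inj N by (auto simp: inj_on_def)
  then have "card (snd ` ?S) = card ?S" by (rule card_image)
  moreover have "snd ` ?S = {t\<in>{t\<^sub>1<..<t\<^sub>2}. p \<in> range (\<lambda>n. W (n, t))}"
    using N by (force simp: image_iff)
  ultimately have "pas p W t\<^sub>1 t\<^sub>2 = card ?S" by (simp only: pas_def)
  moreover have "\<bar>\<Sum>x\<in>?S. local_sign (prod_atlas N (interval_atlas {t\<^sub>1<..<t\<^sub>2})) M W x\<bar> \<le> (\<Sum>x\<in>?S. 1)"
    by (rule order_trans[OF sum_abs sum_mono]) (simp add: local_sign_def)
  ultimately show ?thesis by (simp add: signed_count_eq_sum)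
qed

theorem mainTheorem4:
  fixes N :: "('n::{t2_space,second_countable_topology}, 'e::euclidean_space) atlas"
    and M :: "('m::{t2_space,second_countable_topology}, 'e \<times> real) atlas"
    and p :: 'm
    and T t\<^sub>1 t\<^sub>2 :: real
    and W :: "'n \<times> real \<Rightarrow> 'm"
    and \<N> :: "('n \<Rightarrow> 'm) set"
    and \<epsilon> :: "'n \<Rightarrow> 'm"
  assumes M: "oriented_manifold M" "connected (UNIV :: 'm set)"
    and N: "oriented_manifold N" "connected (UNIV :: 'n set)" "compact (UNIV :: 'n set)"
    and W: "smooth_map (prod_atlas N (interval_atlas {T..})) M W"
    and generic: "generic_propagation N M p T W"
    and t: "T \<le> t\<^sub>1" "t\<^sub>1 < t\<^sub>2"
    and avoid: "p \<notin> range (\<lambda>n. W (n, t\<^sub>1))" "p \<notin> range (\<lambda>n. W (n, t\<^sub>2))"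
    and component: "\<N> \<in> connected_components_of (Cinf_topology N M)"
      "\<forall>t\<ge>T. (\<lambda>n. W (n, t)) \<in> \<N>"
    and indeterminacy: "indeterminacy_subgroup N M \<N> = {0}"
    and base: "\<epsilon> \<in> \<N>" "p \<notin> range \<epsilon>"
  shows "int (pas p W t\<^sub>1 t\<^sub>2)
    \<ge> \<bar>awin N M p \<epsilon> (\<lambda>n. W (n, t\<^sub>2)) - awin N M p \<epsilon> (\<lambda>n. W (n, t\<^sub>1))\<bar>"
proof -
  note oN = oriented_manifold_atlas[OF N(1)] and oM = oriented_manifold_atlas[OF M(1)]
  interpret S: winding_setup N M p
    by (rule winding_setup.intro[OF oN N(3) oM M(2)])
  let ?J = "{t\<^sub>1<..<t\<^sub>2}"
  let ?W = "signed_count (prod_atlas N (interval_atlas ?J)) M W p"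
  have J: "open ?J" "?J \<subseteq> {T..}" using t by auto
  have reg: "regular_value (prod_atlas N (interval_atlas ?J)) M W p"
    by (rule regular_value_interval_subset[OF oN(1) J]) (use generic in \<open>simp add: generic_propagation_def\<close>)
  have bij: "bij_betw (\<lambda>s. t\<^sub>1 + (t\<^sub>2 - t\<^sub>1) * s) {0<..<1} ?J"
  proof (rule bij_betw_byWitness[where f' = "\<lambda>s. (s - t\<^sub>1) / (t\<^sub>2 - t\<^sub>1)"])
    show "(\<lambda>s. t\<^sub>1 + (t\<^sub>2 - t\<^sub>1) * s) ` {0<..<1} \<subseteq> ?J"
    proof
      fix y assume "y \<in> (\<lambda>s. t\<^sub>1 + (t\<^sub>2 - t\<^sub>1) * s) ` {0<..<1}"
      then obtain s where s: "0 < s" "s < 1" "y = t\<^sub>1 + (t\<^sub>2 - t\<^sub>1) * s" by auto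
      have "0 < (t\<^sub>2 - t\<^sub>1) * s" "(t\<^sub>2 - t\<^sub>1) * s < (t\<^sub>2 - t\<^sub>1) * 1"
        using s t by (auto intro!: mult_strict_left_mono)
      then show "y \<in> ?J" using s(3) by simp
    qed
  qed (use t in \<open>auto simp: divide_simps\<close>)
  have img: "t\<^sub>1 + (t\<^sub>2 - t\<^sub>1) * s \<in> {T..}" if "s \<in> {0..1}" for s
  proof -
    have "0 \<le> (t\<^sub>2 - t\<^sub>1) * s" using t that by simp
    then show ?thesis using t(1) by simp
  qed
  have e: "1 = (1::int) \<or> 1 = (-1::int)" "(t\<^sub>2 - t\<^sub>1) * of_int 1 > 0" using t by auto
  have end2: "t\<^sub>1 + (t\<^sub>2 - t\<^sub>1) = t\<^sub>2" by simp
  define H where "H = (\<lambda>(n, s). W (n, t\<^sub>1 + (t\<^sub>2 - t\<^sub>1) * s))"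
  have H: "good_homotopy N M p (\<lambda>n. W (n, t\<^sub>1)) (\<lambda>n. W (n, t\<^sub>2)) H" "Delta N M p H = ?W"
    using S.good_homotopy_reparam[OF W J reg bij img e, unfolded end2, OF _ avoid] by (simp_all add: H_def)
  have "\<bar>?W\<bar> \<le> int (pas p W t\<^sub>1 t\<^sub>2)"
    by (rule signed_count_generic_le)
      (use generic J(2) oN(2) in \<open>auto simp: generic_propagation_def subset_iff\<close>)
  moreover have "awin N M p \<epsilon> (\<lambda>n. W (n, t\<^sub>2)) - awin N M p \<epsilon> (\<lambda>n. W (n, t\<^sub>1)) = ?W \<or>
    awin N M p \<epsilon> (\<lambda>n. W (n, t\<^sub>2)) - awin N M p \<epsilon> (\<lambda>n. W (n, t\<^sub>1)) = 0"
  \<comment> \<open>Good homotopies from \<open>\<epsilon>\<close> to the two positions of the front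
    exist together or not at all: \<open>H\<close> and its reverse lead from one position to the
    other.\<close>
  proof (cases "\<exists>F. good_homotopy N M p \<epsilon> (\<lambda>n. W (n, t\<^sub>1)) F")
    case True
    then obtain F where F: "good_homotopy N M p \<epsilon> (\<lambda>n. W (n, t\<^sub>1)) F" by blast
    obtain C where C: "good_homotopy N M p \<epsilon> (\<lambda>n. W (n, t\<^sub>2)) C" "Delta N M p C = Delta N M p F + Delta N M p H"
      by (rule S.good_homotopy_concat[OF F H(1)]) blast
    show ?thesis
      using S.awin_eq[OF indeterminacy base(1) F] S.awin_eq[OF indeterminacy base(1) C(1)] C(2) H(2) by simp
  next
    \<comment> \<open>Here both winding numbers are \<open>THE\<close> over the same empty predicate, hence equal.\<close>
    case False
    have no: "\<not> good_homotopy N M p \<epsilon> (\<lambda>n. W (n, t\<^sub>2)) F" for F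
    proof
      assume F: "good_homotopy N M p \<epsilon> (\<lambda>n. W (n, t\<^sub>2)) F"
      obtain H' where H': "good_homotopy N M p (\<lambda>n. W (n, t\<^sub>2)) (\<lambda>n. W (n, t\<^sub>1)) H'"
        by (rule S.good_homotopy_reverse[OF H(1)])
      show False
        by (rule S.good_homotopy_concat[OF F H']) (use False in blast)
    qed
    then show ?thesis using False by (simp add: awin_def)
  qed
  ultimately show ?thesis by linarith
qed

end
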